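(* Let $p$ be an odd prime and let $G$ be a multi-edge spinal group acting on the regular $p$-adic rooted tree. Suppose that $G$ is torsion. If $H$ is a group commensurable with $G$, then every maximal subgroup of $H$ has finite index in $H$.
   Context: Two groups are commensurable if they have isomorphic subgroups of finite index, i.e. some finite-index subgroup of one is isomorphic to some finite-index subgroup of the other. Let $p$ be an odd prime and $X=\{1,\ldots,p\}$. The regular $p$-adic rooted tree $T$ has as vertices the finite words over $X$, with root the empty word and an edge from $v$ to $vx$ for each word $v$ and each $x\in X$. $\operatorname{Aut}(T)$ is the group of automorphisms of the rooted tree $T$, acting on the right. For a vertex $u$, the full subtree $T_u$ of words with prefix $u$ is identified with $T$ by deleting the prefix $u$. The section of $f\in\operatorname{Aut}(T)$ at $u$ is the automorphism $f_u$ of $T$ with $(uv)^f=u^f v^{f_u}$ for all words $v$. $\operatorname{Stab}_{\operatorname{Aut}(T)}(1)$ is the subgroup fixing all vertices of length $1$, and $\psi_1\colon \operatorname{Stab}_{\operatorname{Aut}(T)}(1)\to \operatorname{Aut}(T)\times\overset{p}{\ldots}\times\operatorname{Aut}(T)$ is the isomorphism $f\mapsto(f_1,\ldots,f_p)$, where $f_x$ is the section at the vertex $x\in X$. Let $a$ be the rooted automorphism corresponding to the $p$-cycle $(1\,2\,\ldots\,p)$, i.e. $(xv)^a=x^{(1\,2\,\ldots\,p)}v$ for $x\in X$ and words $v$. Given $r\ge 1$ and an $r$-tuple $\mathbf{E}$ of $(\mathbb{Z}/p\mathbb{Z})$-linearly independent vectors $\mathbf{e}_i=(e_{i,1},\ldots,e_{i,p-1})\in(\mathbb{Z}/p\mathbb{Z})^{p-1}$,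 $i\in\{1,\ldots,r\}$, define recursively $b_1,\ldots,b_r\in\operatorname{Stab}_{\operatorname{Aut}(T)}(1)$ by $\psi_1(b_i)=(a^{e_{i,1}},\ldots,a^{e_{i,p-1}},b_i)$. The multi-edge spinal group associated to $\mathbf{E}$ is $G_{\mathbf{E}}=\langle a,b_1,\ldots,b_r\rangle\le\operatorname{Aut}(T)$. *)

theory Defs
  imports
    "HOL-Algebra.Bij"
    "HOL-Algebra.Coset"
    "HOL-Algebra.Generated_Groups"
    "HOL-Number_Theory.Cong"
    "HOL-Computational_Algebra.Primes"
begin

section \<open>Groups\<close>

definition finite_index :: "'a set \<Rightarrow> ('a, 'm) monoid_scheme \<Rightarrow> bool" where
  "finite_index K G \<longleftrightarrow> subgroup K G \<and> finite (rcosets\<^bsub>G\<^esub> K)"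

definition maximal_subgroup :: "'a set \<Rightarrow> ('a, 'm) monoid_scheme \<Rightarrow> bool" where
  "maximal_subgroup M G \<longleftrightarrow>
     subgroup M G \<and> M \<noteq> carrier G \<and>
     (\<forall>K. subgroup K G \<and> M \<subseteq> K \<longrightarrow> K = M \<or> K = carrier G)"

definition commensurable :: "('a, 'm) monoid_scheme \<Rightarrow> ('b, 'n) monoid_scheme \<Rightarrow> bool" where
  "commensurable G H \<longleftrightarrow>
     (\<exists>K L. finite_index K G \<and> finite_index L H \<and> G\<lparr>carrier := K\<rparr> \<cong> H\<lparr>carrier := L\<rparr>)"

definition torsion_group :: "('a, 'm) monoid_scheme \<Rightarrow> bool" where
  "torsion_group G \<longleftrightarrow> (\<forall>g\<in>carrier G. \<exists>n::nat. n > 0 \<and> g [^]\<^bsub>G\<^esub> n = \<one>\<^bsub>G\<^esub>)"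


section \<open>The regular rooted tree and its automorphism group\<close>

definition tree_verts :: "nat \<Rightarrow> nat list set" where
  "tree_verts p = lists {1..p}"

definition tree_edges :: "nat \<Rightarrow> nat list set set" where
  "tree_edges p = {{v, v @ [x]} | v x. v \<in> tree_verts p \<and> x \<in> {1..p}}"

text \<open>Automorphisms act on the right: the product \<open>f g\<close> applies \<open>f\<close> first.
  They are extensional functions (undefined off the vertex set), so that the identity of
  automorphisms is the equality of functions.\<close>

definition tree_aut :: "nat \<Rightarrow> (nat list \<Rightarrow> nat list) monoid" where
  "tree_aut p =
     \<lparr>carrier = {f \<in> Bij (tree_verts p). f [] = [] \<and>
        (\<forall>u\<in>tree_verts p. \<forall>v\<in>tree_verts p. {f u, f v} \<in> tree_edges p \<longleftrightarrow> {u, v} \<in> tree_edges p)},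
      monoid.mult = \<lambda>f g. compose (tree_verts p) g f,
      one = \<lambda>v\<in>tree_verts p. v\<rparr>"

definition tree_section :: "nat \<Rightarrow> (nat list \<Rightarrow> nat list) \<Rightarrow> nat list \<Rightarrow> nat list \<Rightarrow> nat list" where
  "tree_section p f u = (\<lambda>v\<in>tree_verts p. drop (length u) (f (u @ v)))"

definition level_one_stab :: "nat \<Rightarrow> (nat list \<Rightarrow> nat list) set" where
  "level_one_stab p = {f \<in> carrier (tree_aut p). \<forall>x\<in>{1..p}. f [x] = [x]}"

definition psi_one :: "nat \<Rightarrow> (nat list \<Rightarrow> nat list) \<Rightarrow> nat \<Rightarrow> nat list \<Rightarrow> nat list" where
  "psi_one p f = (\<lambda>x\<in>{1..p}. tree_section p f [x])"


section \<open>Multi-edge spinal groups\<close>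

definition rooted_cycle :: "nat \<Rightarrow> nat list \<Rightarrow> nat list" where
  "rooted_cycle p = (\<lambda>w\<in>tree_verts p.
     case w of [] \<Rightarrow> [] | x # v \<Rightarrow> (if x = p then 1 else Suc x) # v)"

text \<open>Elements of $\mathbb{Z}/p\mathbb{Z}$ are given by integer representatives; since
  \<open>rooted_cycle p\<close> has order \<open>p\<close>, its powers depend only on the residue class of the exponent.
  A vector in $(\mathbb{Z}/p\mathbb{Z})^{p-1}$ is a function of which only the values at
  \<open>1, \<dots>, p - 1\<close> are used.\<close>

fun directed_word :: "nat \<Rightarrow> (nat \<Rightarrow> int) \<Rightarrow> nat list \<Rightarrow> nat list" where
  "directed_word p e [] = []"
| "directed_word p e (x # v) =
     x # (if x = p then directed_word p e v else (rooted_cycle p [^]\<^bsub>tree_aut p\<^esub> e x) v)"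

definition directed_aut :: "nat \<Rightarrow> (nat \<Rightarrow> int) \<Rightarrow> nat list \<Rightarrow> nat list" where
  "directed_aut p e = (\<lambda>w\<in>tree_verts p. directed_word p e w)"

definition lin_indep_mod :: "nat \<Rightarrow> nat \<Rightarrow> (nat \<Rightarrow> nat \<Rightarrow> int) \<Rightarrow> bool" where
  "lin_indep_mod p r e \<longleftrightarrow>
     (\<forall>c :: nat \<Rightarrow> int. (\<forall>j\<in>{1..p - 1}. [(\<Sum>i=1..r. c i * e i j) = 0] (mod int p)) \<longrightarrow>
        (\<forall>i\<in>{1..r}. [c i = 0] (mod int p)))"

definition multi_edge_spinal_group ::
    "nat \<Rightarrow> nat \<Rightarrow> (nat \<Rightarrow> nat \<Rightarrow> int) \<Rightarrow> (nat list \<Rightarrow> nat list) monoid" where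
  "multi_edge_spinal_group p r e =
     (tree_aut p)\<lparr>carrier :=
        generate (tree_aut p) (insert (rooted_cycle p) ((\<lambda>i. directed_aut p (e i)) ` {1..r}))\<rparr>"


section \<open>Correctness of the encoding\<close>

lemma tree_verts_simps [simp]:
  "[] \<in> tree_verts p"
  "x # v \<in> tree_verts p \<longleftrightarrow> x \<in> {1..p} \<and> v \<in> tree_verts p"
  "u @ v \<in> tree_verts p \<longleftrightarrow> u \<in> tree_verts p \<and> v \<in> tree_verts p"
  by (auto simp: tree_verts_def)

lemma tree_edgesD:
  assumes "{u, v} \<in> tree_edges p"
  shows "(\<exists>x\<in>{1..p}. v = u @ [x]) \<or> (\<exists>x\<in>{1..p}. u = v @ [x])"
  using assms by (auto simp: tree_edges_def doubleton_eq_iff)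

lemma tree_edgesI [intro]:
  "v \<in> tree_verts p \<Longrightarrow> x \<in> {1..p} \<Longrightarrow> {v, v @ [x]} \<in> tree_edges p"
  by (auto simp: tree_edges_def)

lemma group_tree_aut: "group (tree_aut p)"
proof (rule groupI)
  fix f g assume "f \<in> carrier (tree_aut p)" "g \<in> carrier (tree_aut p)"
  moreover from this have "f v \<in> tree_verts p" if "v \<in> tree_verts p" for v
    using that by (auto simp: tree_aut_def dest!: Bij_imp_funcset)
  ultimately show "f \<otimes>\<^bsub>tree_aut p\<^esub> g \<in> carrier (tree_aut p)"
    by (simp add: tree_aut_def compose_Bij compose_eq)
next
  show "\<one>\<^bsub>tree_aut p\<^esub> \<in> carrier (tree_aut p)"
    by (simp add: tree_aut_def id_Bij)
next
  fix f g h assume "f \<in> carrier (tree_aut p)" "g \<in> carrier (tree_aut p)" "h \<in> carrier (tree_aut p)"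
  then show "f \<otimes>\<^bsub>tree_aut p\<^esub> g \<otimes>\<^bsub>tree_aut p\<^esub> h = f \<otimes>\<^bsub>tree_aut p\<^esub> (g \<otimes>\<^bsub>tree_aut p\<^esub> h)"
    by (auto simp: tree_aut_def compose_def fun_eq_iff dest!: Bij_imp_funcset)
next
  fix f assume "f \<in> carrier (tree_aut p)"
  then show "\<one>\<^bsub>tree_aut p\<^esub> \<otimes>\<^bsub>tree_aut p\<^esub> f = f"
    by (auto simp: tree_aut_def compose_def fun_eq_iff extensional_def dest!: Bij_imp_extensional)
next
  fix f assume f: "f \<in> carrier (tree_aut p)"
  let ?V = "tree_verts p"
  let ?g = "\<lambda>v\<in>?V. inv_into ?V f v"
  have fB: "f \<in> Bij ?V" and f0: "f [] = []"
    and fe: "\<And>u v. u \<in> ?V \<Longrightarrow> v \<in> ?V \<Longrightarrow> {f u, f v} \<in> tree_edges p \<longleftrightarrow> {u, v} \<in> tree_edges p"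
    using f by (auto simp: tree_aut_def)
  have bij: "bij_betw f ?V ?V" using fB by (simp add: Bij_def)
  have gV: "?g v \<in> ?V" "f (?g v) = v" if "v \<in> ?V" for v
    using that fB bij by (auto simp: Bij_inv_into_mem bij_betw_def f_inv_into_f)
  have "?g [] = []"
    using f0 bij by (metis bij_betw_def inv_into_f_f restrict_apply' tree_verts_simps(1))
  moreover have "{?g u, ?g v} \<in> tree_edges p \<longleftrightarrow> {u, v} \<in> tree_edges p"
    if "u \<in> ?V" "v \<in> ?V" for u v
    using fe[of "?g u" "?g v"] gV[OF that(1)] gV[OF that(2)] by simp
  ultimately have "?g \<in> carrier (tree_aut p)"
    using restrict_inv_into_Bij[OF fB] by (simp add: tree_aut_def)
  moreover have "compose ?V f ?g = (\<lambda>v\<in>?V. v)"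
    using gV by (auto simp: compose_def fun_eq_iff)
  then have "?g \<otimes>\<^bsub>tree_aut p\<^esub> f = \<one>\<^bsub>tree_aut p\<^esub>"
    by (simp add: tree_aut_def)
  ultimately show "\<exists>g\<in>carrier (tree_aut p). g \<otimes>\<^bsub>tree_aut p\<^esub> f = \<one>\<^bsub>tree_aut p\<^esub>" by blast
qed

lemma tree_autD:
  assumes f: "f \<in> carrier (tree_aut p)"
  shows "f \<in> extensional (tree_verts p)" "inj_on f (tree_verts p)"
    "v \<in> tree_verts p \<Longrightarrow> f v \<in> tree_verts p"
    "f [] = []"
  using f by (auto simp: tree_aut_def Bij_def bij_betw_def)

lemma tree_aut_edge:
  assumes "f \<in> carrier (tree_aut p)" "u \<in> tree_verts p" "v \<in> tree_verts p"
  shows "{f u, f v} \<in> tree_edges p \<longleftrightarrow> {u, v} \<in> tree_edges p"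
  using assms by (simp add: tree_aut_def)

lemma tree_aut_step:
  assumes f: "f \<in> carrier (tree_aut p)" and "v \<in> tree_verts p" "x \<in> {1..p}"
  shows "\<exists>y\<in>{1..p}. f (v @ [x]) = f v @ [y]"
  using assms(2,3)
proof (induction v arbitrary: x rule: rev_induct)
  case Nil
  have "{f [], f [x]} \<in> tree_edges p"
    using tree_aut_edge[OF f, of "[]" "[x]"] Nil tree_edgesI[of "[]" p x] by simp
  from tree_edgesD[OF this] show ?case using tree_autD(4)[OF f] by auto
next
  case (snoc z v)
  have v: "v \<in> tree_verts p" "z \<in> {1..p}" using snoc.prems by auto
  have "{f (v @ [z]), f ((v @ [z]) @ [x])} \<in> tree_edges p"
    using tree_aut_edge[OF f, of "v @ [z]" "(v @ [z]) @ [x]"] snoc.prems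
      tree_edgesI[of "v @ [z]" p x] by simp
  from tree_edgesD[OF this] show ?case
  proof
    assume "\<exists>y\<in>{1..p}. f (v @ [z]) = f ((v @ [z]) @ [x]) @ [y]"
    moreover obtain z' where "f (v @ [z]) = f v @ [z']" using snoc.IH[OF v] by blast
    ultimately have "f v = f ((v @ [z]) @ [x])" by auto
    then have "v = (v @ [z]) @ [x]"
      using tree_autD(2)[OF f] v snoc.prems by (auto dest!: inj_onD)
    then show ?thesis by simp
  qed auto
qed

lemma tree_aut_append:
  assumes f: "f \<in> carrier (tree_aut p)" and "u \<in> tree_verts p" "v \<in> tree_verts p"
  shows "length (f u) = length u" "take (length u) (f (u @ v)) = f u"
proof -
  have len: "length (f u) = length u" if "u \<in> tree_verts p" for u
    using that
  proof (induction u rule: rev_induct)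
    case Nil
    then show ?case using tree_autD(4)[OF f] by simp
  next
    case (snoc x u)
    then obtain y where "f (u @ [x]) = f u @ [y]" using tree_aut_step[OF f, of u x] by auto
    then show ?case using snoc by simp
  qed
  show "length (f u) = length u" using assms(2) by (rule len)
  show "take (length u) (f (u @ v)) = f u"
    using assms(3)
  proof (induction v rule: rev_induct)
    case Nil
    then show ?case using len[OF assms(2)] by simp
  next
    case (snoc x v)
    then obtain y where "f ((u @ v) @ [x]) = f (u @ v) @ [y]"
      using tree_aut_step[OF f, of "u @ v" x] assms(2) by auto
    moreover have "length (f (u @ v)) = length u + length v" 
      using len[of "u @ v"] assms(2) snoc by simp
    ultimately show ?case using snoc by simp
  qed
qed

lemma tree_autI:
  assumes ext: "f \<in> extensional (tree_verts p)" and inj: "inj_on f (tree_verts p)"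
    and into: "\<And>v. v \<in> tree_verts p \<Longrightarrow> f v \<in> tree_verts p"
    and len: "\<And>v. v \<in> tree_verts p \<Longrightarrow> length (f v) = length v"
    and pre: "\<And>v x. v \<in> tree_verts p \<Longrightarrow> x \<in> {1..p} \<Longrightarrow> take (length v) (f (v @ [x])) = f v"
  shows "f \<in> carrier (tree_aut p)"
proof -
  let ?V = "tree_verts p"
  have surj: "f ` ?V = ?V"
  proof
    show "f ` ?V \<subseteq> ?V" using into by auto
    show "?V \<subseteq> f ` ?V"
    proof
      fix w assume w: "w \<in> ?V"
      let ?L = "{v \<in> ?V. length v = length w}"
      have "?L = {v. set v \<subseteq> {1..p} \<and> length v = length w}"
        by (auto simp: tree_verts_def lists_eq_set)
      then have "finite ?L" by (simp add: finite_lists_length_eq)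
      moreover have "f ` ?L \<subseteq> ?L" using into len by auto
      moreover have "inj_on f ?L" using inj by (rule inj_on_subset) auto
      ultimately have "f ` ?L = ?L" by (rule endo_inj_surj)
      then show "w \<in> f ` ?V" using w by blast
    qed
  qed
  have step: "\<exists>y\<in>{1..p}. f (v @ [x]) = f v @ [y]" if "v \<in> ?V" "x \<in> {1..p}" for v x
  proof -
    have "f (v @ [x]) = take (length v) (f (v @ [x])) @ drop (length v) (f (v @ [x]))" by simp
    moreover have "length (drop (length v) (f (v @ [x]))) = 1" using len[of "v @ [x]"] that by simp
    then obtain y where "drop (length v) (f (v @ [x])) = [y]" by (metis One_nat_def length_0_conv length_Suc_conv)
    ultimately have "f (v @ [x]) = f v @ [y]" using pre[OF that] by simp
    then show ?thesis using into[of "v @ [x]"] that by auto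
  qed
  have reflect: "\<exists>x\<in>{1..p}. v = u @ [x]"
    if uv: "u \<in> ?V" "v \<in> ?V" and fv: "f v = f u @ [y]" for u v y
  proof -
    have "length v = Suc (length u)" using len[of u] len[of v] uv fv by simp
    then obtain v' x where v: "v = v' @ [x]" by (metis length_Suc_conv_rev)
    then obtain y' where "f v = f v' @ [y']" using step[of v' x] uv by auto
    then have "f v' = f u" using fv by simp
    then have "v' = u" using inj uv v by (auto dest!: inj_onD)
    then show ?thesis using v uv by auto
  qed
  have "{f u, f v} \<in> tree_edges p \<longleftrightarrow> {u, v} \<in> tree_edges p" if uv: "u \<in> ?V" "v \<in> ?V" for u v
  proof
    assume "{f u, f v} \<in> tree_edges p"
    from tree_edgesD[OF this] have "(\<exists>x\<in>{1..p}. v = u @ [x]) \<or> (\<exists>x\<in>{1..p}. u = v @ [x])"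
      using reflect uv by blast
    then show "{u, v} \<in> tree_edges p"
      using uv tree_edgesI[of u p] tree_edgesI[of v p] by (auto simp: insert_commute)
  next
    assume "{u, v} \<in> tree_edges p"
    from tree_edgesD[OF this] have "(\<exists>x\<in>{1..p}. f v = f u @ [x]) \<or> (\<exists>x\<in>{1..p}. f u = f v @ [x])"
      using step uv by blast
    then show "{f u, f v} \<in> tree_edges p"
      using into[OF uv(1)] into[OF uv(2)] tree_edgesI[of "f u" p] tree_edgesI[of "f v" p]
      by (auto simp: insert_commute)
  qed
  moreover have "f [] = []" using len[of "[]"] by simp
  ultimately show ?thesis
    using ext inj surj by (simp add: tree_aut_def Bij_def bij_betw_def)
qed

lemma append_tree_section:
  assumes "f \<in> carrier (tree_aut p)" "u \<in> tree_verts p" "v \<in> tree_verts p"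
  shows "f (u @ v) = f u @ tree_section p f u v"
  using tree_aut_append(2)[OF assms] assms(3)
  by (simp add: tree_section_def) (metis append_take_drop_id)

lemma tree_section_closed:
  assumes f: "f \<in> carrier (tree_aut p)" and u: "u \<in> tree_verts p"
  shows "tree_section p f u \<in> carrier (tree_aut p)"
proof (rule tree_autI)
  note app = append_tree_section[OF f u]
  show "tree_section p f u \<in> extensional (tree_verts p)" by (simp add: tree_section_def)
  show "inj_on (tree_section p f u) (tree_verts p)"
  proof (rule inj_onI)
    fix v w assume vw: "v \<in> tree_verts p" "w \<in> tree_verts p"
      "tree_section p f u v = tree_section p f u w"
    then have "f (u @ v) = f (u @ w)" using app by simp
    then have "u @ v = u @ w" using tree_autD(2)[OF f] u vw(1,2) by (auto dest!: inj_onD)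
    then show "v = w" by simp
  qed
  fix v assume v: "v \<in> tree_verts p"
  show "tree_section p f u v \<in> tree_verts p"
    using tree_autD(3)[OF f, of "u @ v"] u v app[OF v] by simp
  show len: "length (tree_section p f u v) = length v"
    using tree_aut_append(1)[OF f, of "u @ v" "[]"] tree_aut_append(1)[OF f u, of "[]"] u v app[OF v] by simp
  fix x assume x: "x \<in> {1..p}"
  have "take (length (u @ v)) (f ((u @ v) @ [x])) = f (u @ v)"
    using tree_aut_append(2)[OF f, of "u @ v" "[x]"] u v x by simp
  then show "take (length v) (tree_section p f u (v @ [x])) = tree_section p f u v"
    using app[OF v] app[of "v @ [x]"] tree_aut_append(1)[OF f u, of "[]"] v x by simp
qed

lemma rooted_cycle_closed: "rooted_cycle p \<in> carrier (tree_aut p)"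
  by (rule tree_autI)
     (auto simp: rooted_cycle_def inj_on_def split: list.splits if_splits)

lemma directed_aut_Cons:
  assumes "x \<in> {1..p}" "v \<in> tree_verts p"
  shows "directed_aut p e (x # v) =
     x # (if x = p then directed_aut p e v else (rooted_cycle p [^]\<^bsub>tree_aut p\<^esub> e x) v)"
  using assms by (simp add: directed_aut_def)

lemma directed_aut_in_stab: "directed_aut p e \<in> level_one_stab p"
proof -
  let ?b = "directed_aut p e" and ?a = "\<lambda>x. rooted_cycle p [^]\<^bsub>tree_aut p\<^esub> e x"
  interpret group "tree_aut p" by (rule group_tree_aut)
  have a: "?a x \<in> carrier (tree_aut p)" for x
    using rooted_cycle_closed by (rule int_pow_closed)
  have b0: "?b [] = []" by (simp add: directed_aut_def)
  have "?b \<in> carrier (tree_aut p)"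
  proof (rule tree_autI)
    show "?b \<in> extensional (tree_verts p)" by (simp add: directed_aut_def)
    fix v assume v: "v \<in> tree_verts p"
    show "?b v \<in> tree_verts p"
      using v by (induction v) (use b0 tree_autD(3)[OF a] in \<open>auto simp: directed_aut_Cons\<close>)
    show "length (?b v) = length v"
      using v by (induction v)
        (use b0 tree_aut_append(1)[OF a, of _ "[]"] in \<open>auto simp: directed_aut_Cons\<close>)
    fix x assume x: "x \<in> {1..p}"
    show "take (length v) (?b (v @ [x])) = ?b v"
      using v x by (induction v)
        (use b0 tree_aut_append(2)[OF a, of _ "[x]"] in \<open>auto simp: directed_aut_Cons\<close>)
  next
    have "v = w" if "v \<in> tree_verts p" "w \<in> tree_verts p" "?b v = ?b w" for v w
      using that
    proof (induction v arbitrary: w)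
      case Nil
      then show ?case by (cases w) (auto simp: b0 directed_aut_Cons)
    next
      case (Cons x v)
      then obtain w' where w: "w = x # w'"
        by (cases w) (auto simp: b0 directed_aut_Cons)
      show ?case
      proof (cases "x = p")
        case True
        then show ?thesis using Cons w by (auto simp: directed_aut_Cons)
      next
        case False
        then have "?a x v = ?a x w'" using Cons w by (auto simp: directed_aut_Cons)
        then show ?thesis using Cons.prems w tree_autD(2)[OF a[of x]] by (auto dest: inj_onD)
      qed
    qed
    then show "inj_on ?b (tree_verts p)" by (auto intro: inj_onI)
  qed
  moreover have "?b [x] = [x]" if "x \<in> {1..p}" for x
    using that tree_autD(4)[OF a] by (simp add: directed_aut_Cons b0)
  ultimately show ?thesis by (simp add: level_one_stab_def)
qed

text \<open>\<open>directed_aut p e\<close> is the unique \<open>b\<close> in the stabiliser of the first level with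
  $\psi_1(b) = (a^{e_1}, \dots, a^{e_{p-1}}, b)$.\<close>

theorem directed_aut_unique:
  "f \<in> level_one_stab p \<and>
   psi_one p f = (\<lambda>x\<in>{1..p}. if x = p then f else rooted_cycle p [^]\<^bsub>tree_aut p\<^esub> e x)
   \<longleftrightarrow> f = directed_aut p e" (is "?L f \<longleftrightarrow> _")
proof
  let ?b = "directed_aut p e" and ?a = "\<lambda>x. rooted_cycle p [^]\<^bsub>tree_aut p\<^esub> e x"
  interpret group "tree_aut p" by (rule group_tree_aut)
  have a: "?a x \<in> carrier (tree_aut p)" for x
    using rooted_cycle_closed by (rule int_pow_closed)
  show "?L f" if "f = ?b"
  proof -
    have "tree_section p ?b [x] = (if x = p then ?b else ?a x)" if "x \<in> {1..p}" for x
    proof (rule extensionalityI[of _ "tree_verts p"])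
      show "tree_section p ?b [x] \<in> extensional (tree_verts p)" by (simp add: tree_section_def)
      show "(if x = p then ?b else ?a x) \<in> extensional (tree_verts p)"
        using tree_autD(1)[OF a[of x]] by (simp add: directed_aut_def)
    qed (use that in \<open>simp add: tree_section_def directed_aut_Cons\<close>)
    then show ?thesis
      using \<open>f = ?b\<close> directed_aut_in_stab by (auto simp: psi_one_def fun_eq_iff)
  qed
  assume L: "?L f"
  then have f: "f \<in> carrier (tree_aut p)" and f1: "\<And>x. x \<in> {1..p} \<Longrightarrow> f [x] = [x]"
    and sec: "\<And>x. x \<in> {1..p} \<Longrightarrow> tree_section p f [x] = (if x = p then f else ?a x)"
    by (auto simp: level_one_stab_def psi_one_def fun_eq_iff split: if_splits)
  show "f = ?b"
  proof (rule extensionalityI[of _ "tree_verts p"])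
    show "f \<in> extensional (tree_verts p)" by (rule tree_autD(1)[OF f])
    show "?b \<in> extensional (tree_verts p)" by (simp add: directed_aut_def)
    fix v assume "v \<in> tree_verts p"
    then show "f v = ?b v"
    proof (induction v)
      case Nil
      then show ?case using tree_autD(4)[OF f] by (simp add: directed_aut_def)
    next
      case (Cons x v)
      then show ?case
        using append_tree_section[OF f, of "[x]" v] f1[of x] sec[of x]
        by (simp add: directed_aut_Cons)
    qed
  qed
qed

lemma group_multi_edge_spinal_group: "group (multi_edge_spinal_group p r e)"
proof -
  interpret group "tree_aut p" by (rule group_tree_aut)
  have "insert (rooted_cycle p) ((\<lambda>i. directed_aut p (e i)) ` {1..r}) \<subseteq> carrier (tree_aut p)"
    using rooted_cycle_closed directed_aut_in_stab by (auto simp: level_one_stab_def)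
  from generate_is_subgroup[OF this] show ?thesis
    unfolding multi_edge_spinal_group_def by (rule subgroup_imp_group)
qed

end

theory Submission
  imports Defs
begin

text \<open>
  Call a subgroup dense if no proper finite-index subgroup contains it; a maximal subgroup of
  infinite index is dense. It suffices to show that no group commensurable with \<open>G\<close> has a proper
  dense subgroup. Torsion forces the exponent sum of every vector to vanish modulo \<open>p\<close>, and it makes
  all derived subgroups of finite index; since sufficiently deep derived subgroups embed in \<open>G\<close> as
  rigid stabilisers of vertices, \<open>G\<close> is just infinite. If \<open>M\<close> is a proper dense subgroup of \<open>G\<close>, so are
  its sections at the vertices of the tree: a subgroup dense in a subgroup of the product of
  copies of \<open>G\<close> and projecting onto each factor is everything. Taking sections (of \<open>p\<close>-th powers
  if necessary) shortens words, so after finitely many sections and conjugations \<open>M\<close> contains a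
  directed generator, then also \<open>a\<close>, and finally all directed generators, a contradiction.
  For a subgroup of finite index of \<open>G\<close>, all sections on some level equal \<open>G\<close>, and the same product
  argument applies; overgroups of finite index inherit the property.

  Groups are written additively, as subgroups of types of class \<^class>\<open>group_add\<close>.
\<close>

section \<open>Subgroups, commutators and finite index\<close>

text \<open>Maximality is hard to carry through sections; density is density in the profinite
  topology, and it survives intersection with finite-index subgroups and homomorphic images. What
  has to be earned is that a section is proper: if one section of \<open>M\<close> were all of
  \<open>G\<close>, transitivity on the first level would make all of them full, and the product
  argument would put the whole first-level stabiliser into \<open>M\<close>. The vanishing exponent
  sums are used three times. A nonzero vector has two nonzero entries, so commutators can isolate a
  single vertex. It is not constant, so even the derived subgroup has full sections. And the
  \<open>p\<close>-th power of an element moving the first level has sections whose total rotation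
  is trivial. Length counts directed factors. Each factor is directed at exactly one letter, so the
  lengths of the sections of a word add up to its length, and a section is as long as the word only
  if all factors are directed at that letter and merge into one.\<close>

lemmas grp_simps = add.assoc minus_add minus_minus diff_conv_add_uminus add_minus_cancel
  minus_add_cancel add_0 add_0_right minus_zero right_minus left_minus

definition subgrp :: "'a::group_add set \<Rightarrow> bool" where
  "subgrp S \<longleftrightarrow> 0 \<in> S \<and> (\<forall>x\<in>S. \<forall>y\<in>S. x - y \<in> S)"

lemma subgrpI: "0 \<in> S \<Longrightarrow> (\<And>x y. x \<in> S \<Longrightarrow> y \<in> S \<Longrightarrow> x - y \<in> S) \<Longrightarrow> subgrp S"
  by (simp add: subgrp_def)

lemma subgrp_zero: "subgrp S \<Longrightarrow> 0 \<in> S"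
  by (simp add: subgrp_def)

lemma subgrp_diff: "subgrp S \<Longrightarrow> x \<in> S \<Longrightarrow> y \<in> S \<Longrightarrow> x - y \<in> S"
  by (simp add: subgrp_def)

lemma subgrp_uminus: "subgrp S \<Longrightarrow> x \<in> S \<Longrightarrow> - x \<in> S"
  using subgrp_diff[of S 0 x] by (simp add: subgrp_zero)

lemma subgrp_add: "subgrp S \<Longrightarrow> x \<in> S \<Longrightarrow> y \<in> S \<Longrightarrow> x + y \<in> S"
  using subgrp_diff[of S x "- y"] by (simp add: subgrp_uminus)

lemma subgrp_add_left: "subgrp S \<Longrightarrow> x \<in> S \<Longrightarrow> x + y \<in> S \<longleftrightarrow> y \<in> S"
  using subgrp_add[of S x y] subgrp_add[of S "- x" "x + y"] by (auto simp: subgrp_uminus)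

lemma subgrp_Int: "subgrp S \<Longrightarrow> subgrp T \<Longrightarrow> subgrp (S \<inter> T)"
  by (simp add: subgrp_def)

lemma subgrp_conj: "subgrp S \<Longrightarrow> x \<in> S \<Longrightarrow> g \<in> S \<Longrightarrow> - g + x + g \<in> S"
  by (simp add: subgrp_add subgrp_uminus)

definition gen :: "'a::group_add set \<Rightarrow> 'a set" where
  "gen A = \<Inter>{H. subgrp H \<and> A \<subseteq> H}"

lemma subgrp_gen: "subgrp (gen A)"
  by (auto simp: gen_def subgrp_def)

lemma gen_incl: "x \<in> A \<Longrightarrow> x \<in> gen A"
  by (auto simp: gen_def)

lemma gen_least: "subgrp H \<Longrightarrow> A \<subseteq> H \<Longrightarrow> gen A \<subseteq> H"
  by (auto simp: gen_def)

lemma gen_mono: "A \<subseteq> B \<Longrightarrow> gen A \<subseteq> gen B"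
  by (auto simp: gen_def)

definition hom_on :: "'a::group_add set \<Rightarrow> ('a \<Rightarrow> 'b::group_add) \<Rightarrow> bool" where
  "hom_on L \<phi> \<longleftrightarrow> (\<forall>x\<in>L. \<forall>y\<in>L. \<phi> (x + y) = \<phi> x + \<phi> y)"

lemma hom_on_add: "hom_on L \<phi> \<Longrightarrow> x \<in> L \<Longrightarrow> y \<in> L \<Longrightarrow> \<phi> (x + y) = \<phi> x + \<phi> y"
  by (simp add: hom_on_def)

lemma hom_on_subset: "hom_on L \<phi> \<Longrightarrow> L' \<subseteq> L \<Longrightarrow> hom_on L' \<phi>"
  by (auto simp: hom_on_def)

lemma hom_on_zero: "hom_on L \<phi> \<Longrightarrow> subgrp L \<Longrightarrow> \<phi> 0 = 0"
  using hom_on_add[of L \<phi> 0 0] add_left_cancel[of "\<phi> 0" "\<phi> 0" 0] by (simp add: subgrp_zero)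

lemma hom_on_uminus:
  assumes "hom_on L \<phi>" "subgrp L" "x \<in> L"
  shows "\<phi> (- x) = - \<phi> x"
  using hom_on_add[OF assms(1,3) subgrp_uminus[OF assms(2,3)]] hom_on_zero[OF assms(1,2)]
    minus_unique[of "\<phi> x" "\<phi> (- x)"] by simp

lemma hom_on_diff: "hom_on L \<phi> \<Longrightarrow> subgrp L \<Longrightarrow> x \<in> L \<Longrightarrow> y \<in> L \<Longrightarrow> \<phi> (x - y) = \<phi> x - \<phi> y"
  using hom_on_add[of L \<phi> x "- y"] by (simp add: hom_on_uminus subgrp_uminus)

lemma hom_on_conj:
  "hom_on L \<phi> \<Longrightarrow> subgrp L \<Longrightarrow> x \<in> L \<Longrightarrow> g \<in> L \<Longrightarrow> \<phi> (- g + x + g) = - \<phi> g + \<phi> x + \<phi> g"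
  by (simp add: hom_on_add hom_on_uminus subgrp_uminus subgrp_add)

lemma subgrp_image:
  assumes "hom_on L \<phi>" "subgrp L"
  shows "subgrp (\<phi> ` L)"
proof (rule subgrpI)
  show "0 \<in> \<phi> ` L" using hom_on_zero[OF assms] subgrp_zero[OF assms(2)] by force
  fix x y assume "x \<in> \<phi> ` L" "y \<in> \<phi> ` L"
  then show "x - y \<in> \<phi> ` L"
    using subgrp_diff[OF assms(2)] by (auto simp: hom_on_diff[OF assms, symmetric])
qed

lemma subgrp_preimage:
  assumes "hom_on L \<phi>" "subgrp L" "subgrp J"
  shows "subgrp {x \<in> L. \<phi> x \<in> J}"
  using assms by (auto intro!: subgrpI simp: hom_on_zero hom_on_diff subgrp_zero subgrp_diff)

lemma image_gen_subset:
  assumes "hom_on L \<phi>" "subgrp L" "A \<subseteq> L"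
  shows "\<phi> ` gen A = gen (\<phi> ` A)"
proof
  have "gen A \<subseteq> {x \<in> L. \<phi> x \<in> gen (\<phi> ` A)}"
    using assms by (intro gen_least subgrp_preimage subgrp_gen) (auto intro: gen_incl)
  then show "\<phi> ` gen A \<subseteq> gen (\<phi> ` A)" by auto
  have "gen A \<subseteq> L" using assms by (intro gen_least)
  then have "hom_on (gen A) \<phi>" by (rule hom_on_subset[OF assms(1)])
  then show "gen (\<phi> ` A) \<subseteq> \<phi> ` gen A"
    by (intro gen_least subgrp_image subgrp_gen) (auto intro: gen_incl)
qed

definition normal_in :: "'a::group_add set \<Rightarrow> 'a set \<Rightarrow> bool" where
  "normal_in N G \<longleftrightarrow> subgrp N \<and> N \<subseteq> G \<and> (\<forall>g\<in>G. \<forall>n\<in>N. - g + n + g \<in> N)"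

lemma normal_in_subgrp: "normal_in N G \<Longrightarrow> subgrp N"
  and normal_in_subset: "normal_in N G \<Longrightarrow> N \<subseteq> G"
  and normal_in_conj: "normal_in N G \<Longrightarrow> g \<in> G \<Longrightarrow> n \<in> N \<Longrightarrow> - g + n + g \<in> N"
  by (auto simp: normal_in_def)

lemma normal_in_conj': "subgrp G \<Longrightarrow> normal_in N G \<Longrightarrow> g \<in> G \<Longrightarrow> n \<in> N \<Longrightarrow> g + n - g \<in> N"
  using normal_in_conj[of N G "- g" n] by (simp add: subgrp_uminus)

lemma normal_in_self: "subgrp G \<Longrightarrow> normal_in G G"
  by (simp add: normal_in_def subgrp_conj)

definition commutator :: "'a::group_add \<Rightarrow> 'a \<Rightarrow> 'a" where
  "commutator x y = - x - y + x + y"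

lemma commutator_in: "subgrp S \<Longrightarrow> x \<in> S \<Longrightarrow> y \<in> S \<Longrightarrow> commutator x y \<in> S"
  by (simp add: commutator_def subgrp_add subgrp_diff subgrp_uminus)

lemma commutator_zero [simp]: "commutator 0 x = 0" "commutator x 0 = 0" "commutator x x = 0"
  by (simp_all add: commutator_def)

lemma commutator_eq_0_iff: "commutator x y = 0 \<longleftrightarrow> x + y = y + x"
proof -
  have *: "(y + x) + commutator x y = x + y"
    by (simp only: commutator_def grp_simps)
  have "commutator x y = 0 \<longleftrightarrow> (y + x) + commutator x y = (y + x) + 0"
    by (simp only: add_left_cancel)
  then show ?thesis unfolding * add_0_right .
qed

lemma uminus_commutator: "- commutator x y = commutator y x"
  by (simp only: commutator_def grp_simps)

lemma conj_commutator:
  "- g + commutator x y + g = commutator (- g + x + g) (- g + y + g)"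
  by (simp only: commutator_def grp_simps)

lemma hom_on_commutator:
  "hom_on L \<phi> \<Longrightarrow> subgrp L \<Longrightarrow> x \<in> L \<Longrightarrow> y \<in> L \<Longrightarrow> \<phi> (commutator x y) = commutator (\<phi> x) (\<phi> y)"
  by (simp add: commutator_def hom_on_add hom_on_uminus hom_on_diff subgrp_uminus subgrp_add subgrp_diff)

definition der :: "'a::group_add set \<Rightarrow> 'a set" where
  "der H = gen {commutator x y | x y. x \<in> H \<and> y \<in> H}"

lemma subgrp_der: "subgrp (der H)"
  by (simp add: der_def subgrp_gen)

lemma commutator_der: "x \<in> H \<Longrightarrow> y \<in> H \<Longrightarrow> commutator x y \<in> der H"
  by (auto simp: der_def intro: gen_incl)

lemma der_least: "subgrp K \<Longrightarrow> (\<And>x y. x \<in> H \<Longrightarrow> y \<in> H \<Longrightarrow> commutator x y \<in> K) \<Longrightarrow> der H \<subseteq> K"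
  unfolding der_def by (rule gen_least) auto

lemma der_subset: "subgrp H \<Longrightarrow> der H \<subseteq> H"
  by (intro der_least commutator_in)

lemma der_mono: "H \<subseteq> K \<Longrightarrow> der H \<subseteq> der K"
  unfolding der_def by (rule gen_mono) auto

lemma image_der:
  assumes "hom_on L \<phi>" "subgrp L"
  shows "\<phi> ` der L = der (\<phi> ` L)"
proof -
  let ?C = "{commutator x y | x y. x \<in> L \<and> y \<in> L}"
  have "\<phi> ` ?C = {commutator x y | x y. x \<in> \<phi> ` L \<and> y \<in> \<phi> ` L}"
  proof safe
    fix x y assume "x \<in> L" "y \<in> L"
    then show "\<exists>u v. \<phi> (commutator x y) = commutator u v \<and> u \<in> \<phi> ` L \<and> v \<in> \<phi> ` L"
      by (metis hom_on_commutator[OF assms] image_eqI)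
    show "commutator (\<phi> x) (\<phi> y) \<in> \<phi> ` ?C"
      using \<open>x \<in> L\<close> \<open>y \<in> L\<close> by (auto simp: hom_on_commutator[OF assms, symmetric])
  qed
  moreover have "?C \<subseteq> L" using commutator_in[OF assms(2)] by auto
  ultimately show ?thesis
    unfolding der_def using image_gen_subset[OF assms, of ?C] by simp
qed

lemma normal_in_der:
  assumes "normal_in N G"
  shows "normal_in (der N) G"
proof -
  have "der N \<subseteq> G" using der_subset normal_in_subgrp normal_in_subset assms by blast
  moreover have "- g + n + g \<in> der N" if "g \<in> G" "n \<in> der N" for g n
  proof -
    have "hom_on UNIV (\<lambda>x. - g + x + g)"
      by (simp add: hom_on_def add.assoc)
    moreover have "subgrp (UNIV :: 'a set)" by (simp add: subgrp_def)
    ultimately have "subgrp {x \<in> UNIV. - g + x + g \<in> der N}"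
      by (rule subgrp_preimage) (rule subgrp_der)
    then have "der N \<subseteq> {x \<in> UNIV. - g + x + g \<in> der N}"
      using assms that(1) by (intro der_least) (auto simp: conj_commutator commutator_der normal_in_conj)
    then show ?thesis using that(2) by auto
  qed
  ultimately show ?thesis by (simp add: normal_in_def subgrp_der)
qed

text \<open>This is the preimage of the centraliser of the image of \<open>s\<close> in the quotient
  by \<open>N\<close>; the commutator of a difference is a difference of conjugates of the two
  commutators.\<close>

lemma commutator_mod_subgrp:
  assumes "normal_in N G" "subgrp G" "s \<in> G"
  shows "subgrp {g \<in> G. commutator g s \<in> N}"
proof (rule subgrpI)
  show "0 \<in> {g \<in> G. commutator g s \<in> N}"
    using assms by (auto simp: subgrp_zero normal_in_def)
  fix x y assume *: "x \<in> {g \<in> G. commutator g s \<in> N}" "y \<in> {g \<in> G. commutator g s \<in> N}"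
  have "commutator (x - y) s = (y + commutator x s - y) + - (y + commutator y s - y)"
    by (simp only: commutator_def grp_simps)
  moreover have "\<dots> \<in> N"
    using * assms normal_in_conj'[OF assms(2,1)]
    by (intro subgrp_add subgrp_uminus) (auto intro: normal_in_subgrp)
  ultimately show "x - y \<in> {g \<in> G. commutator g s \<in> N}"
    using * assms by (simp add: subgrp_diff)
qed

text \<open>If generators commute modulo \<open>N\<close>, the quotient is abelian. The commutator
  relation is extended from generators to all elements one argument at a time.\<close>

lemma der_gen_subset:
  assumes N: "normal_in N (gen S)" and S: "\<And>x y. x \<in> S \<Longrightarrow> y \<in> S \<Longrightarrow> commutator x y \<in> N"
  shows "der (gen S) \<subseteq> N"
proof -
  let ?G = "gen S"
  have G: "subgrp ?G" by (rule subgrp_gen)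
  have 1: "commutator g s \<in> N" if "g \<in> ?G" "s \<in> S" for g s
  proof -
    have "?G \<subseteq> {g \<in> ?G. commutator g s \<in> N}"
      using S that by (intro gen_least commutator_mod_subgrp N G) (auto intro: gen_incl)
    then show ?thesis using that by auto
  qed
  have 2: "commutator h g \<in> N" if "g \<in> ?G" "h \<in> ?G" for g h
  proof -
    have "commutator s g \<in> N" if "s \<in> S" for s
      using 1[OF \<open>g \<in> ?G\<close> that] subgrp_uminus[OF normal_in_subgrp[OF N]] uminus_commutator by metis
    then have "?G \<subseteq> {h \<in> ?G. commutator h g \<in> N}"
      using that by (intro gen_least commutator_mod_subgrp N G) (auto intro: gen_incl)
    then show ?thesis using that by auto
  qed
  show ?thesis using N 2 by (intro der_least) (auto intro: normal_in_subgrp)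
qed

section \<open>Subgroups of finite index\<close>

definition fin_idx :: "'a::group_add set \<Rightarrow> 'a set \<Rightarrow> bool" where
  "fin_idx J L \<longleftrightarrow> subgrp J \<and> J \<subseteq> L \<and> finite ((\<lambda>x. (\<lambda>j. j + x) ` J) ` L)"

lemma fin_idx_subgrp: "fin_idx J L \<Longrightarrow> subgrp J"
  and fin_idx_subset: "fin_idx J L \<Longrightarrow> J \<subseteq> L"
  by (auto simp: fin_idx_def)

lemma coset_eqI:
  assumes "subgrp J" "x - y \<in> J"
  shows "(\<lambda>j. j + x) ` J = (\<lambda>j. j + y) ` J"
proof -
  have "(\<lambda>j. j + x) ` J \<subseteq> (\<lambda>j. j + y) ` J" if "x - y \<in> J" for x y
  proof safe
    fix j assume "j \<in> J"
    have "j + x = (j + (x - y)) + y" by (simp only: grp_simps)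
    then show "j + x \<in> (\<lambda>j. j + y) ` J" using that subgrp_add[OF assms(1) \<open>j \<in> J\<close>] by blast
  qed
  from this[OF assms(2)] this[of y x] subgrp_uminus[OF assms] show ?thesis by auto
qed

text \<open>Finite index is certified by a colouring with finitely many colours that separates cosets.\<close>

lemma fin_idxI:
  assumes "subgrp J" "J \<subseteq> L" "finite (f ` L)"
    and "\<And>x y. x \<in> L \<Longrightarrow> y \<in> L \<Longrightarrow> f x = f y \<Longrightarrow> x - y \<in> J"
  shows "fin_idx J L"
proof -
  let ?c = "\<lambda>x. (\<lambda>j. j + x) ` J"
  define g where "g c = ?c (SOME x. x \<in> L \<and> f x = c)" for c
  have "?c x = g (f x)" if "x \<in> L" for x
  proof -
    define y where "y = (SOME y. y \<in> L \<and> f y = f x)"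
    have "y \<in> L \<and> f y = f x"
      unfolding y_def by (rule someI[of _ x]) (simp add: that)
    then have "x - y \<in> J" using assms(4)[OF that, of y] by simp
    then show ?thesis unfolding g_def y_def[symmetric] by (rule coset_eqI[OF assms(1)])
  qed
  then have "?c ` L = (\<lambda>x. g (f x)) ` L" by (rule image_cong[OF refl])
  also have "\<dots> = g ` f ` L" by (simp only: image_image)
  finally have "finite (?c ` L)" using assms(3) by simp
  then show ?thesis unfolding fin_idx_def using assms(1,2) by blast
qed

lemma fin_idx_colouring:
  assumes "fin_idx J L"
  shows "\<exists>f :: 'a::group_add \<Rightarrow> 'a set. finite (f ` L) \<and> (\<forall>x\<in>L. \<forall>y\<in>L. f x = f y \<longrightarrow> x - y \<in> J)"
proof (intro exI conjI ballI impI)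
  let ?c = "\<lambda>x. (\<lambda>j. j + x) ` J"
  show "finite (?c ` L)" using assms by (simp add: fin_idx_def)
  fix x y assume "?c x = ?c y"
  moreover have "x \<in> ?c x" using subgrp_zero[OF fin_idx_subgrp[OF assms]] by force
  ultimately obtain j where "j \<in> J" "x = j + y" by auto
  then show "x - y \<in> J" by simp
qed

lemma fin_idx_self: "subgrp L \<Longrightarrow> fin_idx L L"
  by (rule fin_idxI[where f = "\<lambda>_. ()"]) (auto simp: subgrp_diff)

lemma fin_idx_mono:
  assumes "fin_idx J L" "subgrp J'" "J \<subseteq> J'" "J' \<subseteq> L"
  shows "fin_idx J' L"
proof -
  obtain f :: "'a \<Rightarrow> 'a set" where f: "finite (f ` L)" "\<And>x y. x \<in> L \<Longrightarrow> y \<in> L \<Longrightarrow> f x = f y \<Longrightarrow> x - y \<in> J"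
    using fin_idx_colouring[OF assms(1)] by blast
  show ?thesis using assms f by (intro fin_idxI[where f = f]) auto
qed

lemma fin_idx_preimage:
  assumes "hom_on L \<phi>" "subgrp L" "fin_idx J L2" "\<phi> ` L \<subseteq> L2"
  shows "fin_idx {x \<in> L. \<phi> x \<in> J} L"
proof -
  obtain f :: "'b \<Rightarrow> 'b set" where f: "finite (f ` L2)" "\<And>x y. x \<in> L2 \<Longrightarrow> y \<in> L2 \<Longrightarrow> f x = f y \<Longrightarrow> x - y \<in> J"
    using fin_idx_colouring[OF assms(3)] by blast
  show ?thesis
  proof (rule fin_idxI[where f = "\<lambda>x. f (\<phi> x)"])
    show "subgrp {x \<in> L. \<phi> x \<in> J}"
      using assms by (intro subgrp_preimage) (auto intro: fin_idx_subgrp)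
    have "(\<lambda>x. f (\<phi> x)) ` L \<subseteq> f ` L2" using assms(4) by auto
    then show "finite ((\<lambda>x. f (\<phi> x)) ` L)" using f(1) by (rule finite_subset)
    show "x - y \<in> {x \<in> L. \<phi> x \<in> J}" if "x \<in> L" "y \<in> L" "f (\<phi> x) = f (\<phi> y)" for x y
      using that f(2)[of "\<phi> x" "\<phi> y"] assms by (auto simp: hom_on_diff subgrp_diff)
  qed auto
qed

lemma fin_idx_Int_subgrp:
  assumes "fin_idx J L" "subgrp L'" "L' \<subseteq> L"
  shows "fin_idx (J \<inter> L') L'"
proof -
  have "fin_idx {x \<in> L'. id x \<in> J} L'"
    using assms by (intro fin_idx_preimage) (auto simp: hom_on_def)
  moreover have "{x \<in> L'. id x \<in> J} = J \<inter> L'" by auto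
  ultimately show ?thesis by simp
qed

lemma fin_idx_trans:
  assumes "fin_idx K J" "fin_idx J L" "subgrp L"
  shows "fin_idx K L"
proof -
  obtain f :: "'a \<Rightarrow> 'a set" where f: "finite (f ` L)" "\<And>x y. x \<in> L \<Longrightarrow> y \<in> L \<Longrightarrow> f x = f y \<Longrightarrow> x - y \<in> J"
    using fin_idx_colouring[OF assms(2)] by blast
  obtain h :: "'a \<Rightarrow> 'a set" where h: "finite (h ` J)" "\<And>x y. x \<in> J \<Longrightarrow> y \<in> J \<Longrightarrow> h x = h y \<Longrightarrow> x - y \<in> K"
    using fin_idx_colouring[OF assms(1)] by blast
  define r where "r c = (SOME x. x \<in> L \<and> f x = c)" for c
  have r: "r (f x) \<in> L \<and> f (r (f x)) = f x" if "x \<in> L" for x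
    unfolding r_def by (rule someI[of _ x]) (simp add: that)
  have rJ: "x - r (f x) \<in> J" if "x \<in> L" for x using r[OF that] f(2)[of x] that by auto
  \<comment> \<open>An element is coloured by its \<open>J\<close>-colour together with the
    \<open>K\<close>-colour of its difference from the representative chosen for that
    \<open>J\<close>-colour.\<close>
  show ?thesis
  proof (rule fin_idxI[where f = "\<lambda>x. (f x, h (x - r (f x)))"])
    show "subgrp K" "K \<subseteq> L" using assms fin_idx_subset fin_idx_subgrp by blast+
    have "(\<lambda>x. (f x, h (x - r (f x)))) ` L \<subseteq> f ` L \<times> h ` J" using rJ by auto
    then show "finite ((\<lambda>x. (f x, h (x - r (f x)))) ` L)"
      by (rule finite_subset) (simp add: f(1) h(1))
    fix x y assume xy: "x \<in> L" "y \<in> L" "(f x, h (x - r (f x))) = (f y, h (y - r (f y)))"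
    then have "(x - r (f x)) - (y - r (f x)) \<in> K"
      using h(2)[OF rJ[of x] rJ[of y]] by auto
    then show "x - y \<in> K" by (simp only: grp_simps)
  qed
qed

lemma fin_idx_Inter:
  assumes "finite I" "subgrp L" "\<And>i. i \<in> I \<Longrightarrow> fin_idx (J i) L"
  shows "fin_idx {x \<in> L. \<forall>i\<in>I. x \<in> J i} L"
  using assms
proof (induction I rule: finite_induct)
  case empty
  then show ?case by (simp add: fin_idx_self)
next
  case (insert i I)
  let ?K = "{x \<in> L. \<forall>i\<in>I. x \<in> J i}"
  have K: "fin_idx ?K L" using insert by auto
  have "fin_idx (J i \<inter> ?K) ?K"
    using insert.prems K by (intro fin_idx_Int_subgrp[where L = L]) (auto intro: fin_idx_subgrp)
  then have "fin_idx (J i \<inter> ?K) L" by (rule fin_idx_trans[OF _ K insert.prems(1)])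
  moreover have "J i \<inter> ?K = {x \<in> L. \<forall>i\<in>insert i I. x \<in> J i}" by auto
  ultimately show ?case by simp
qed

text \<open>The witness is the normal core. An element is coloured by the self-map that it induces,
  by addition on the right, on the finitely many colours; elements inducing the same self-map differ
  by an element of the core.\<close>

lemma fin_idx_core:
  assumes Q: "fin_idx Q L" and L: "subgrp L"
  obtains N where "fin_idx N L" "normal_in N L" "N \<subseteq> Q"
proof
  let ?N = "{x \<in> L. \<forall>g\<in>L. - g + x + g \<in> Q}"
  have Qs: "subgrp Q" by (rule fin_idx_subgrp[OF Q])
  obtain f :: "'a \<Rightarrow> 'a set" where f: "finite (f ` L)" "\<And>x y. x \<in> L \<Longrightarrow> y \<in> L \<Longrightarrow> f x = f y \<Longrightarrow> x - y \<in> Q"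
    using fin_idx_colouring[OF Q] by blast
  define r where "r c = (SOME x. x \<in> L \<and> f x = c)" for c
  have r: "r (f x) \<in> L \<and> f (r (f x)) = f x" if "x \<in> L" for x
    unfolding r_def by (rule someI[of _ x]) (simp add: that)
  have N: "subgrp ?N"
  proof (rule subgrpI)
    show "0 \<in> ?N" using Qs L by (simp add: subgrp_zero)
    fix x y assume xy: "x \<in> ?N" "y \<in> ?N"
    have "- g + (x - y) + g = (- g + x + g) - (- g + y + g)" for g
      by (simp only: grp_simps)
    with xy show "x - y \<in> ?N" using Qs L by (auto simp: subgrp_diff)
  qed
  show "?N \<subseteq> Q" using subgrp_zero[OF L] by force
  show "normal_in ?N L"
    unfolding normal_in_def
  proof (intro conjI ballI N)
    fix g x assume g: "g \<in> L" and x: "x \<in> ?N"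
    have "- h + (- g + x + g) + h = - (g + h) + x + (g + h)" for h
      by (simp only: grp_simps)
    then show "- g + x + g \<in> ?N" using g x L by (auto simp: subgrp_add subgrp_conj)
  qed auto
  show "fin_idx ?N L"
  proof (rule fin_idxI[where f = "\<lambda>x. \<lambda>c\<in>f ` L. f (r c + x)"])
    have "(\<lambda>x. \<lambda>c\<in>f ` L. f (r c + x)) ` L \<subseteq> (f ` L \<rightarrow>\<^sub>E f ` L)"
      using r L by (auto simp: subgrp_add)
    then show "finite ((\<lambda>x. \<lambda>c\<in>f ` L. f (r c + x)) ` L)"
      by (rule finite_subset) (simp add: f(1) finite_PiE)
    fix x y assume xy: "x \<in> L" "y \<in> L" "(\<lambda>c\<in>f ` L. f (r c + x)) = (\<lambda>c\<in>f ` L. f (r c + y))"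
    have "- g + (x - y) + g \<in> Q" if g: "g \<in> L" for g
    proof -
      have mg: "- g \<in> L" using L g by (rule subgrp_uminus)
      define s where "s = r (f (- g))"
      have s: "s \<in> L" "f s = f (- g)" using r[OF mg] by (auto simp: s_def)
      have "f (s + x) = f (s + y)" using fun_cong[OF xy(3), of "f (- g)"] mg by (simp add: s_def)
      then have 1: "(s + x) - (s + y) \<in> Q" using xy s L by (intro f) (auto simp: subgrp_add)
      have 2: "- g - s \<in> Q" using s mg by (intro f) auto
      have "- g + (x - y) + g = (- g - s) + ((s + x) - (s + y)) + - (- g - s)"
        by (simp only: grp_simps)
      then show ?thesis using 1 2 Qs by (metis subgrp_add subgrp_uminus)
    qed
    then show "x - y \<in> ?N" using xy L by (simp add: subgrp_diff)
  qed (use N in auto)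
qed

section \<open>Density in the profinite topology\<close>

definition dense_in :: "'a::group_add set \<Rightarrow> 'a set \<Rightarrow> bool" where
  "dense_in D L \<longleftrightarrow> subgrp D \<and> D \<subseteq> L \<and> (\<forall>P. fin_idx P L \<and> D \<subseteq> P \<longrightarrow> P = L)"

lemma dense_in_subgrp: "dense_in D L \<Longrightarrow> subgrp D"
  and dense_in_subset: "dense_in D L \<Longrightarrow> D \<subseteq> L"
  and dense_inD: "dense_in D L \<Longrightarrow> fin_idx P L \<Longrightarrow> D \<subseteq> P \<Longrightarrow> P = L"
  by (auto simp: dense_in_def)

text \<open>Shrinking \<open>Q\<close> to its normal core \<open>N\<close> makes
  \<open>D + N\<close> a subgroup; it has finite index and contains \<open>D\<close>, hence is
  \<open>L\<close>. This approximation is the form in which density is applied.\<close>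

lemma dense_in_decomp:
  assumes D: "dense_in D L" and L: "subgrp L" and Q: "fin_idx Q L" and x: "x \<in> L"
  obtains d q where "d \<in> D" "q \<in> Q" "x = d + q"
proof -
  obtain N where N: "fin_idx N L" "normal_in N L" "N \<subseteq> Q" by (rule fin_idx_core[OF Q L])
  have Ds: "subgrp D" "D \<subseteq> L" using D by (auto simp: dense_in_def)
  have Ns: "subgrp N" "N \<subseteq> L" using N by (auto simp: normal_in_def)
  let ?P = "{d + n | d n. d \<in> D \<and> n \<in> N}"
  have "subgrp ?P"
  proof (rule subgrpI)
    show "0 \<in> ?P" using Ds Ns subgrp_zero by force
    fix x y assume "x \<in> ?P" "y \<in> ?P"
    then obtain d n d' n' where *: "x = d + n" "y = d' + n'" "d \<in> D" "n \<in> N" "d' \<in> D" "n' \<in> N" by auto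
    have "x - y = (d - d') + (d' + (n - n') - d')"
      unfolding * by (simp only: grp_simps)
    moreover have "d' + (n - n') - d' \<in> N"
      using * Ds Ns by (intro normal_in_conj'[OF L N(2)]) (auto simp: subgrp_diff)
    ultimately show "x - y \<in> ?P" using * Ds subgrp_diff by blast
  qed
  moreover have "?P \<subseteq> L" using Ds Ns L by (auto simp: subgrp_add subset_iff)
  moreover have "N \<subseteq> ?P" using subgrp_zero[OF Ds(1)] by force
  ultimately have "fin_idx ?P L" using N(1) by (meson fin_idx_mono)
  moreover have "D \<subseteq> ?P" using subgrp_zero[OF Ns(1)] by force
  ultimately have "?P = L" using D by (auto simp: dense_in_def)
  then show ?thesis using x N(3) that by blast
qed

text \<open>A subgroup \<open>P\<close> of finite index in \<open>L'\<close> has finite index in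
  \<open>L\<close> too, so an element of \<open>L'\<close> splits along \<open>D\<close> and
  \<open>P\<close>; its \<open>D\<close>-part then lies in \<open>L'\<close>.\<close>

lemma dense_in_Int:
  assumes D: "dense_in D L" and L: "subgrp L" and L': "fin_idx L' L"
  shows "dense_in (D \<inter> L') L'"
proof -
  have s: "subgrp L'" by (rule fin_idx_subgrp[OF L'])
  have "P = L'" if P: "fin_idx P L'" "D \<inter> L' \<subseteq> P" for P
  proof
    show "P \<subseteq> L'" by (rule fin_idx_subset[OF P(1)])
    show "L' \<subseteq> P"
    proof
      fix x assume x: "x \<in> L'"
      have "fin_idx P L" by (rule fin_idx_trans[OF P(1) L' L])
      then obtain d q where dq: "d \<in> D" "q \<in> P" "x = d + q"
        using dense_in_decomp[OF D L] x fin_idx_subset[OF L'] by (metis subsetD)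
      then have "d = x - q" by simp
      then have "d \<in> L'" using x dq(2) \<open>P \<subseteq> L'\<close> s by (auto simp: subgrp_diff)
      then show "x \<in> P" using dq P fin_idx_subgrp[OF P(1)] by (auto simp: subgrp_add)
    qed
  qed
  then show ?thesis using dense_in_subgrp[OF D] s by (auto simp: dense_in_def subgrp_Int)
qed

lemma dense_in_image:
  assumes D: "dense_in D L" and L: "subgrp L" and h: "hom_on L \<phi>"
  shows "dense_in (\<phi> ` D) (\<phi> ` L)"
proof -
  have Ds: "subgrp D" "D \<subseteq> L" using D by (auto simp: dense_in_def)
  have "P = \<phi> ` L" if P: "fin_idx P (\<phi> ` L)" "\<phi> ` D \<subseteq> P" for P
  proof -
    have "fin_idx {x \<in> L. \<phi> x \<in> P} L" using fin_idx_preimage[OF h L P(1)] by simp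
    moreover have "D \<subseteq> {x \<in> L. \<phi> x \<in> P}" using P(2) Ds by auto
    ultimately have "{x \<in> L. \<phi> x \<in> P} = L" by (rule dense_inD[OF D])
    then show ?thesis using fin_idx_subset[OF P(1)] by blast
  qed
  moreover have "subgrp (\<phi> ` D)" by (rule subgrp_image[OF hom_on_subset[OF h Ds(2)] Ds(1)])
  ultimately show ?thesis using Ds by (auto simp: dense_in_def)
qed

lemma dense_in_fin_idx_eq:
  "dense_in D L \<Longrightarrow> fin_idx J L \<Longrightarrow> J \<subseteq> D \<Longrightarrow> D = L"
  by (meson dense_in_def fin_idx_mono subset_refl)

definition no_proper_dense :: "'a::group_add set \<Rightarrow> bool" where
  "no_proper_dense L \<longleftrightarrow> (\<forall>D. dense_in D L \<longrightarrow> D = L)"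

text \<open>\<open>D\<close> meets \<open>K\<close> densely, hence contains \<open>K\<close>; so
  \<open>D\<close> has finite index itself and density gives equality.\<close>

lemma no_proper_dense_up:
  assumes K: "no_proper_dense K" "fin_idx K H" and H: "subgrp H"
  shows "no_proper_dense H"
  unfolding no_proper_dense_def
proof (intro allI impI)
  fix D assume D: "dense_in D H"
  have "D \<inter> K = K" using K dense_in_Int[OF D H K(2)] by (auto simp: no_proper_dense_def)
  then show "D = H" by (intro dense_in_fin_idx_eq[OF D K(2)]) auto
qed

lemma no_proper_dense_image:
  assumes K: "no_proper_dense K" "subgrp K" and h: "hom_on K \<phi>" and inj: "inj_on \<phi> K"
  shows "no_proper_dense (\<phi> ` K)"
  unfolding no_proper_dense_def
proof (intro allI impI)
  fix D assume D: "dense_in D (\<phi> ` K)"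
  let ?\<psi> = "inv_into K \<phi>"
  have "hom_on (\<phi> ` K) ?\<psi>"
    unfolding hom_on_def
  proof safe
    fix x y assume "x \<in> K" "y \<in> K"
    then show "?\<psi> (\<phi> x + \<phi> y) = ?\<psi> (\<phi> x) + ?\<psi> (\<phi> y)"
      using inj K(2) by (simp add: hom_on_add[OF h, symmetric] subgrp_add)
  qed
  then have "dense_in (?\<psi> ` D) (?\<psi> ` \<phi> ` K)"
    using subgrp_image[OF h K(2)] by (intro dense_in_image[OF D])
  moreover have "?\<psi> ` \<phi> ` K = K" using inj by simp
  ultimately have "?\<psi> ` D = K" using K(1) by (auto simp: no_proper_dense_def)
  then have "\<phi> ` ?\<psi> ` D = \<phi> ` K" by simp
  moreover have "\<phi> ` ?\<psi> ` D = D" using dense_in_subset[OF D] by (simp add: image_inv_into_cancel)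
  ultimately show "D = \<phi> ` K" by simp
qed

section \<open>Torsion and finite generation\<close>

primrec nmul :: "nat \<Rightarrow> 'a::group_add \<Rightarrow> 'a" where
  "nmul 0 x = 0"
| "nmul (Suc n) x = x + nmul n x"

lemma nmul_add: "nmul (m + n) x = nmul m x + nmul n x"
  by (induction m) (simp_all add: add.assoc)

lemma nmul_zero [simp]: "nmul n 0 = 0"
  by (induction n) simp_all

lemma nmul_mult: "nmul (m * n) x = nmul m (nmul n x)"
  by (induction m) (simp_all add: nmul_add)

lemma subgrp_nmul: "subgrp S \<Longrightarrow> x \<in> S \<Longrightarrow> nmul n x \<in> S"
  by (induction n) (simp_all add: subgrp_zero subgrp_add)

definition torsion_on :: "'a::group_add set \<Rightarrow> bool" where
  "torsion_on G \<longleftrightarrow> (\<forall>g\<in>G. \<exists>n>0. nmul n g = 0)"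

definition fin_gen :: "'a::group_add set \<Rightarrow> bool" where
  "fin_gen G \<longleftrightarrow> (\<exists>S. finite S \<and> G = gen S)"

text \<open>Modulo \<open>Q\<close> every element is one of the multiples of \<open>s\<close> with
  factor below \<open>m\<close>. Torsion also turns negative multiples of \<open>s\<close> into
  natural ones, which makes the set closed under differences.\<close>

lemma fin_idx_add_torsion:
  assumes Q: "normal_in Q G" and G: "subgrp G" and s: "s \<in> G" and m: "m > 0" "nmul m s = 0"
  shows "subgrp {q + nmul i s | q i. q \<in> Q}" (is "subgrp ?R") and "fin_idx Q {q + nmul i s | q i. q \<in> Q}"
proof -
  have Qs: "subgrp Q" using Q by (rule normal_in_subgrp)
  have neg: "\<exists>j. - nmul i s = nmul j s" for i
  proof -
    have "nmul ((m - 1) * i) s + nmul i s = nmul (i * m) s"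
      using m(1) by (cases m) (simp_all add: nmul_add[symmetric] algebra_simps)
    then have "nmul ((m - 1) * i) s + nmul i s = 0" using m(2) by (simp add: nmul_mult)
    then have "- nmul i s = nmul ((m - 1) * i) s" by (simp add: eq_neg_iff_add_eq_0[symmetric])
    then show ?thesis by blast
  qed
  show R: "subgrp ?R"
  proof (rule subgrpI)
    have "\<exists>q i. 0 = q + nmul i s \<and> q \<in> Q"
      using subgrp_zero[OF Qs] by (intro exI[of _ 0] exI[of _ "0::nat"]) simp
    then show "0 \<in> ?R" by simp
    fix x y assume "x \<in> ?R" "y \<in> ?R"
    then obtain q i q' i' where *: "x = q + nmul i s" "y = q' + nmul i' s" "q \<in> Q" "q' \<in> Q" by auto
    obtain j where j: "- nmul i' s = nmul j s" using neg by blast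
    have jG: "nmul (i + j) s \<in> G" using G s by (rule subgrp_nmul)
    have "x - y = q + (nmul (i + j) s - q' - nmul (i + j) s) + nmul (i + j) s"
      unfolding * nmul_add j[symmetric] by (simp only: grp_simps)
    moreover have "nmul (i + j) s - q' - nmul (i + j) s \<in> Q"
      using normal_in_conj'[OF G Q jG subgrp_uminus[OF Qs \<open>q' \<in> Q\<close>]] by simp
    ultimately show "x - y \<in> ?R" using subgrp_add[OF Qs \<open>q \<in> Q\<close>] by blast
  qed
  have red: "\<exists>i<m. x - nmul i s \<in> Q" if xR: "x \<in> ?R" for x
  proof -
    obtain q i where x: "x = q + nmul i s" "q \<in> Q" using xR by auto
    have "nmul i s = nmul ((i div m) * m + i mod m) s" by simp
    also have "\<dots> = nmul (i mod m) s" unfolding nmul_add nmul_mult using m(2) by simp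
    finally show ?thesis using x m(1) by (intro exI[of _ "i mod m"]) simp
  qed
  define c where "c x = (SOME i. i < m \<and> x - nmul i s \<in> Q)" for x
  have c: "c x < m \<and> x - nmul (c x) s \<in> Q" if "x \<in> ?R" for x
    using someI_ex[OF red[OF that]] by (simp add: c_def)
  show "fin_idx Q ?R"
  proof (rule fin_idxI[where f = c])
    show "Q \<subseteq> ?R"
    proof
      fix q assume "q \<in> Q"
      then have "\<exists>q' i. q = q' + nmul i s \<and> q' \<in> Q" by (intro exI[of _ q] exI[of _ 0]) simp
      then show "q \<in> ?R" by simp
    qed
    have "c ` ?R \<subseteq> {..<m}" using c by blast
    then show "finite (c ` ?R)" by (rule finite_subset) simp
    fix x y assume xy: "x \<in> ?R" "y \<in> ?R" "c x = c y"
    have "x - nmul (c x) s - (y - nmul (c x) s) \<in> Q"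
      using c[OF xy(1)] c[OF xy(2)] subgrp_diff[OF Qs] unfolding xy(3) by blast
    moreover have "x - nmul (c x) s - (y - nmul (c x) s) = x - y" by (simp only: grp_simps)
    ultimately show "x - y \<in> Q" by simp
  qed (rule Qs)
qed

lemma normal_in_over_der:
  assumes "subgrp Q" "der G \<subseteq> Q" "Q \<subseteq> G"
  shows "normal_in Q G"
  unfolding normal_in_def
proof (intro conjI ballI assms)
  fix g q assume "g \<in> G" "q \<in> Q"
  then have "commutator q g \<in> Q" using assms commutator_der by blast
  moreover have "- g + q + g = q + commutator q g" by (simp only: commutator_def grp_simps)
  ultimately show "- g + q + g \<in> Q" using assms(1) \<open>q \<in> Q\<close> by (simp add: subgrp_add)
qed

text \<open>A finitely generated abelian torsion group is finite: generators are adjoined to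
  \<open>der G\<close> one at a time, and each intermediate subgroup is normal because it contains
  \<open>der G\<close>.\<close>

lemma fin_idx_der:
  assumes G: "subgrp G" and fg: "fin_gen G" and t: "torsion_on G"
  shows "fin_idx (der G) G"
proof -
  obtain S where S: "finite S" "G = gen S" using fg by (auto simp: fin_gen_def)
  have "T \<subseteq> G \<Longrightarrow> \<exists>Q. fin_idx (der G) Q \<and> subgrp Q \<and> T \<subseteq> Q \<and> Q \<subseteq> G" if "finite T" for T
    using that
  proof (induction T)
    case empty
    then show ?case using der_subset[OF G] fin_idx_self[OF subgrp_der] subgrp_der by blast
  next
    case (insert s T)
    then obtain Q where Q: "fin_idx (der G) Q" "subgrp Q" "T \<subseteq> Q" "Q \<subseteq> G" by auto
    have N: "normal_in Q G" using fin_idx_subset[OF Q(1)] Q by (intro normal_in_over_der)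
    have s: "s \<in> G" using insert.prems by auto
    obtain m where m: "m > 0" "nmul m s = 0" using t s by (auto simp: torsion_on_def)
    let ?R = "{q + nmul i s | q i. q \<in> Q}"
    note R = fin_idx_add_torsion[OF N G s m]
    have "0 + nmul 1 s \<in> ?R" using subgrp_zero[OF Q(2)] by blast
    then have "s \<in> ?R" by simp
    then have "insert s T \<subseteq> ?R" using fin_idx_subset[OF R(2)] Q(3) by blast
    moreover have "?R \<subseteq> G" using Q(4) s G by (auto simp: subgrp_add subgrp_nmul subset_iff)
    moreover have "fin_idx (der G) ?R" by (rule fin_idx_trans[OF Q(1) R(2,1)])
    ultimately show ?case using R(1) by blast
  qed
  from this[OF S(1)] obtain Q where "fin_idx (der G) Q" "subgrp Q" "S \<subseteq> Q" "Q \<subseteq> G"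
    using S(2) gen_incl by blast
  moreover from this have "G = Q" using gen_least[of Q S] S(2) by blast
  ultimately show ?thesis by simp
qed

text \<open>Schreier's lemma: the elements \<open>t + s - r (t + s)\<close>, for coset
  representatives \<open>t\<close> and generators or negated generators \<open>s\<close>, generate
  the subgroup.\<close>

lemma fin_gen_fin_idx:
  assumes fg: "fin_gen G" and J: "fin_idx J G"
  shows "fin_gen J"
proof -
  obtain S where S: "finite S" "G = gen S" using fg by (auto simp: fin_gen_def)
  have G: "subgrp G" unfolding S(2) by (rule subgrp_gen)
  have Js: "subgrp J" by (rule fin_idx_subgrp[OF J])
  define r where "r x = (SOME y. y \<in> G \<and> x - y \<in> J)" for x
  have r: "r x \<in> G \<and> x - r x \<in> J" if "x \<in> G" for x
    unfolding r_def by (rule someI[of _ x]) (simp add: that subgrp_zero[OF Js])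
  \<comment> \<open>Elements of one coset have the same candidates for a representative, so the
    choice operator returns the same one.\<close>
  have r_cong: "r x = r y" if "x - y \<in> J" for x y
  proof -
    have "x - z \<in> J \<longleftrightarrow> y - z \<in> J" for z
    proof -
      have "x - z = (x - y) + (y - z)" by (simp only: grp_simps)
      then show ?thesis using subgrp_add_left[OF Js that] by simp
    qed
    then show ?thesis by (simp add: r_def)
  qed
  obtain f :: "'a \<Rightarrow> 'a set" where f: "finite (f ` G)" "\<And>x y. x \<in> G \<Longrightarrow> y \<in> G \<Longrightarrow> f x = f y \<Longrightarrow> x - y \<in> J"
    using fin_idx_colouring[OF J] by blast
  have fin: "finite (r ` G)"
  proof -
    define q where "q c = r (SOME x. x \<in> G \<and> f x = c)" for c
    have "r x = q (f x)" if "x \<in> G" for x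
    proof -
      define y where "y = (SOME y. y \<in> G \<and> f y = f x)"
      have "y \<in> G \<and> f y = f x"
        unfolding y_def by (rule someI[of _ x]) (simp add: that)
      then show ?thesis unfolding q_def y_def[symmetric] by (intro r_cong f(2)) (auto simp: that)
    qed
    then have "r ` G \<subseteq> q ` f ` G" by blast
    then show ?thesis by (rule finite_subset) (simp add: f(1))
  qed
  define A where "A = (\<lambda>(t, s). t + s - r (t + s)) ` (r ` G \<times> (S \<union> uminus ` S))"
  \<comment> \<open>The representative chosen for \<open>J\<close> itself need not be
    \<open>0\<close>; it is therefore added to the generators.\<close>
  let ?J = "gen (insert (r 0) A)"
  have A: "finite A" using fin S(1) by (simp add: A_def)
  define U where "U = {g \<in> G. g - r g \<in> ?J}"
  have r0: "r 0 \<in> ?J" by (simp add: gen_incl)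
  have Js': "subgrp ?J" by (rule subgrp_gen)
  have step: "g + s \<in> U" if "g \<in> U" "s \<in> S \<union> uminus ` S" for g s
  proof -
    have g: "g \<in> G" "g - r g \<in> ?J" using that(1) by (auto simp: U_def)
    have s: "s \<in> G" using that(2) S(2) G gen_incl[of _ S] by (auto simp: subgrp_uminus)
    have "(g + s) - (r g + s) = g - r g" by (simp only: grp_simps)
    then have eq: "r (g + s) = r (r g + s)" using r[OF g(1)] by (intro r_cong) simp
    have "(g + s) - r (g + s) = (g - r g) + (r g + s - r (r g + s))"
      unfolding eq by (simp only: grp_simps)
    moreover have "r g + s - r (r g + s) \<in> A" using g(1) that(2) by (force simp: A_def)
    then have "r g + s - r (r g + s) \<in> ?J" by (intro gen_incl insertI2)
    ultimately have "(g + s) - r (g + s) \<in> ?J"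
      using subgrp_add[OF Js' g(2)] by simp
    then show ?thesis using g s G by (simp add: U_def subgrp_add)
  qed
  \<comment> \<open>\<open>U\<close> is not visibly a subgroup, but the elements whose addition and
    subtraction on the right preserve \<open>U\<close> form one. It contains the generators, hence
    \<open>G\<close>, and \<open>0 \<in> U\<close> then puts all of \<open>G\<close> into
    \<open>U\<close>.\<close>
  define V where "V = {h \<in> G. \<forall>g\<in>U. g + h \<in> U \<and> g - h \<in> U}"
  have "subgrp V"
  proof (rule subgrpI)
    show "0 \<in> V" using G by (auto simp: V_def subgrp_zero)
    fix x y assume "x \<in> V" "y \<in> V"
    then show "x - y \<in> V" using G unfolding V_def
      by (auto simp: subgrp_diff add_diff_eq diff_diff_eq2)
  qed
  moreover have "S \<subseteq> V"
  proof
    fix s assume s: "s \<in> S"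
    then have "g - s \<in> U" if "g \<in> U" for g using step[OF that, of "- s"] by simp
    then show "s \<in> V" using s step S(2) by (auto simp: V_def gen_incl)
  qed
  ultimately have "G \<subseteq> V" unfolding S(2) by (rule gen_least)
  moreover have "0 \<in> U" using G r0 Js' by (auto simp: U_def subgrp_zero subgrp_uminus)
  ultimately have U: "g \<in> U" if "g \<in> G" for g
    using that by (auto simp: V_def subset_iff dest!: bspec[of U _ 0])
  have "J \<subseteq> ?J"
  proof
    fix j assume j: "j \<in> J"
    then have "r j = r 0" by (intro r_cong) simp
    moreover have "j - r j \<in> ?J" using U[of j] j fin_idx_subset[OF J] by (auto simp: U_def)
    ultimately have "(j - r 0) + r 0 \<in> ?J" using r0 by (intro subgrp_add Js') auto
    then show "j \<in> ?J" by simp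
  qed
  moreover have "?J \<subseteq> J"
  proof (rule gen_least[OF Js])
    have "- (0 - r 0) \<in> J" using r[OF subgrp_zero[OF G]] by (intro subgrp_uminus Js) auto
    then have "r 0 \<in> J" by simp
    moreover have "t + s - r (t + s) \<in> J" if "t \<in> r ` G" "s \<in> S \<union> uminus ` S" for t s
    proof -
      have "t \<in> G" using that(1) r by auto
      moreover have "s \<in> G" using that(2) S(2) G gen_incl[of _ S] by (auto simp: subgrp_uminus)
      ultimately show ?thesis using r subgrp_add[OF G] by blast
    qed
    ultimately show "insert (r 0) A \<subseteq> J" by (auto simp: A_def)
  qed
  ultimately have "J = ?J" by blast
  then show ?thesis using A by (auto simp: fin_gen_def)
qed

section \<open>The derived series\<close>

definition dser :: "nat \<Rightarrow> 'a::group_add set \<Rightarrow> 'a set" where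
  "dser k G = (der ^^ k) G"

lemma dser_0 [simp]: "dser 0 G = G"
  and dser_Suc [simp]: "dser (Suc k) G = der (dser k G)"
  by (simp_all add: dser_def)

lemma dser_mono: "A \<subseteq> B \<Longrightarrow> dser k A \<subseteq> dser k B"
  by (induction k) (simp_all add: der_mono)

lemma dser_add: "dser (j + k) G = dser j (dser k G)"
  by (simp add: dser_def funpow_add)

lemma subgrp_dser: "subgrp G \<Longrightarrow> subgrp (dser k G)"
  by (cases k) (simp_all add: subgrp_der)

lemma normal_in_dser: "subgrp G \<Longrightarrow> normal_in (dser k G) G"
  by (induction k) (simp_all add: normal_in_self normal_in_der)

lemma dser_subset: "subgrp G \<Longrightarrow> dser k G \<subseteq> G"
  using normal_in_dser normal_in_subset by blast

lemma dser_antimono: "subgrp G \<Longrightarrow> j \<le> k \<Longrightarrow> dser k G \<subseteq> dser j G"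
  using dser_subset[OF subgrp_dser[of G j], of "k - j"] by (simp add: dser_add[symmetric])

lemma image_dser:
  assumes "hom_on L \<phi>" "subgrp L"
  shows "\<phi> ` dser k L = dser k (\<phi> ` L)"
proof (induction k)
  case (Suc k)
  have "hom_on (dser k L) \<phi>" by (rule hom_on_subset[OF assms(1) dser_subset[OF assms(2)]])
  from image_der[OF this subgrp_dser[OF assms(2)]] show ?case using Suc by simp
qed simp

text \<open>Each term is finitely generated by Schreier's lemma, so the next quotient is again a
  finitely generated abelian torsion group.\<close>

lemma fin_idx_dser:
  assumes G: "subgrp G" and fg: "fin_gen G" and t: "torsion_on G"
  shows "fin_idx (dser k G) G"
proof (induction k)
  case 0
  then show ?case using G by (simp add: fin_idx_self)
next
  case (Suc k)
  have "torsion_on (dser k G)" using t dser_subset[OF G] by (auto simp: torsion_on_def)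
  then have "fin_idx (der (dser k G)) (dser k G)"
    using fin_gen_fin_idx[OF fg Suc] by (intro fin_idx_der subgrp_dser G)
  then show ?case using fin_idx_trans[OF _ Suc G] by simp
qed

section \<open>Dense subgroups of subdirect products\<close>

lemma normal_in_image_section:
  assumes D: "subgrp D" and G: "G = \<phi> ` D" and h: "hom_on D \<phi>"
    and C: "subgrp C" "C \<subseteq> D" "\<And>d c. d \<in> D \<Longrightarrow> c \<in> C \<Longrightarrow> - d + c + d \<in> C"
  shows "normal_in (\<phi> ` C) G"
  unfolding normal_in_def
proof (intro conjI ballI)
  show "subgrp (\<phi> ` C)" by (rule subgrp_image[OF hom_on_subset[OF h C(2)] C(1)])
  show "\<phi> ` C \<subseteq> G" using C(2) G by blast
  fix g n assume "g \<in> G" "n \<in> \<phi> ` C"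
  then obtain d c where dc: "g = \<phi> d" "n = \<phi> c" "d \<in> D" "c \<in> C" using G by auto
  then have "- g + n + g = \<phi> (- d + c + d)" using hom_on_conj[OF h D] C(2) by auto
  then show "- g + n + g \<in> \<phi> ` C" using C(3) dc by blast
qed

text \<open>Density forces elements of \<open>D\<close> to separate any two coordinates, commutators shrink the
  support to a single coordinate, and just-infiniteness makes the resulting subgroups large.\<close>

lemma subdirect_dense_eq:
  fixes \<phi> :: "'i \<Rightarrow> 'a::group_add \<Rightarrow> 'b::group_add"
  assumes I: "finite I" and L: "subgrp L" and G: "subgrp G"
    and h: "\<And>i. i \<in> I \<Longrightarrow> hom_on L (\<phi> i)"
    and into: "\<And>i. i \<in> I \<Longrightarrow> \<phi> i ` L \<subseteq> G"
    and inj: "\<And>x. x \<in> L \<Longrightarrow> (\<And>i. i \<in> I \<Longrightarrow> \<phi> i x = 0) \<Longrightarrow> x = 0"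
    and D: "dense_in D L" and full: "\<And>i. i \<in> I \<Longrightarrow> \<phi> i ` D = G"
    and K: "K \<subseteq> G" "k \<in> K" "k \<noteq> 0"
    and copies: "\<And>i k. i \<in> I \<Longrightarrow> k \<in> K \<Longrightarrow> \<exists>n\<in>L. \<phi> i n = k \<and> (\<forall>j\<in>I - {i}. \<phi> j n = 0)"
    and just_infinite: "\<And>N. normal_in N G \<Longrightarrow> N \<noteq> {0} \<Longrightarrow> fin_idx N G"
    and res_finite: "\<And>k. k \<in> G \<Longrightarrow> k \<noteq> 0 \<Longrightarrow> \<exists>W. normal_in W G \<and> fin_idx W G \<and> k \<notin> W"
    and noncomm: "\<And>A B. normal_in A G \<Longrightarrow> normal_in B G \<Longrightarrow> A \<noteq> {0} \<Longrightarrow> B \<noteq> {0} \<Longrightarrow>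
        \<exists>a\<in>A. \<exists>b\<in>B. commutator a b \<noteq> 0"
  shows "D = L"
proof -
  have Ds: "subgrp D" "D \<subseteq> L" using D by (auto simp: dense_in_def)
  have hD: "hom_on D (\<phi> i)" if "i \<in> I" for i using hom_on_subset[OF h[OF that] Ds(2)] .
  have z: "\<phi> i 0 = 0" if "i \<in> I" for i by (rule hom_on_zero[OF h[OF that] L])
  \<comment> \<open>The part of \<open>D\<close> vanishing on the coordinates in \<open>T\<close>.
    Its image in each coordinate is normal in \<open>G\<close> because \<open>D\<close> projects
    onto \<open>G\<close>.\<close>
  define C where "C T = {m \<in> D. \<forall>z\<in>T. \<phi> z m = 0}" for T
  have CsD: "C T \<subseteq> D" for T by (auto simp: C_def)
  have Cs: "subgrp (C T)" if "T \<subseteq> I" for T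
  proof (rule subgrpI)
    show "0 \<in> C T" using that z Ds by (auto simp: C_def subgrp_zero)
    fix x y assume "x \<in> C T" "y \<in> C T"
    then show "x - y \<in> C T" using that hom_on_diff[OF hD Ds(1)] Ds by (auto simp: C_def subgrp_diff)
  qed
  have Cn: "- d + c + d \<in> C T" if "T \<subseteq> I" "d \<in> D" "c \<in> C T" for T c d
    using that hom_on_conj[OF hD Ds(1)] Ds by (auto simp: C_def subgrp_conj)
  have An: "normal_in (\<phi> x ` C T) G" if "T \<subseteq> I" "x \<in> I" for T x
    using Cs[OF that(1)] CsD Cn[OF that(1)]
    by (intro normal_in_image_section[OF Ds(1) full[OF that(2), symmetric] hD[OF that(2)]]) auto
  have pair: "\<exists>m\<in>D. \<phi> y m = 0 \<and> \<phi> x m \<noteq> 0" if xy: "x \<in> I" "y \<in> I" "x \<noteq> y" for x y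
  proof -
    obtain W where W: "normal_in W G" "fin_idx W G" "k \<notin> W" using res_finite K by blast
    have Ws: "subgrp W" by (rule normal_in_subgrp[OF W(1)])
    define B' where "B' = {m \<in> D. \<phi> x m \<in> W}"
    have Bs: "subgrp B'" unfolding B'_def by (rule subgrp_preimage[OF hD[OF xy(1)] Ds(1) Ws])
    have Bn: "normal_in (\<phi> y ` B') G"
    proof (rule normal_in_image_section[OF Ds(1) full[OF xy(2), symmetric] hD[OF xy(2)] Bs])
      show "B' \<subseteq> D" by (auto simp: B'_def)
      fix d c assume dc: "d \<in> D" "c \<in> B'"
      then show "- d + c + d \<in> B'"
        using hom_on_conj[OF hD[OF xy(1)] Ds(1), of c d] full[OF xy(1)] normal_in_conj[OF W(1)] Ds(1)
        by (auto simp: B'_def subgrp_conj)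
    qed
    have pre: "fin_idx {n \<in> L. \<phi> i n \<in> Z} L" if "i \<in> I" "fin_idx Z G" for i Z
      by (rule fin_idx_preimage[OF h[OF that(1)] L that(2) into[OF that(1)]])
    have pre2: "fin_idx {n \<in> L. \<phi> x n \<in> W \<and> \<phi> y n \<in> Z} L" if "fin_idx Z G" for Z
    proof -
      have "fin_idx {n \<in> L. \<phi> x n \<in> W} L" by (rule pre[OF xy(1) W(2)])
      note 1 = this fin_idx_subgrp[OF this]
      have "fin_idx ({n \<in> L. \<phi> y n \<in> Z} \<inter> {n \<in> L. \<phi> x n \<in> W}) {n \<in> L. \<phi> x n \<in> W}"
        by (rule fin_idx_Int_subgrp[OF pre[OF xy(2) that] 1(2)]) auto
      from fin_idx_trans[OF this 1(1) L] show ?thesis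
        by (rule back_subst[of "\<lambda>S. fin_idx S L"]) auto
    qed
    \<comment> \<open>Approximating a copy of \<open>k\<close> in coordinate \<open>y\<close> yields
      an element of \<open>B'\<close> with nonzero image there, so by just-infiniteness the image of
      \<open>B'\<close> has finite index.\<close>
    obtain n where n: "n \<in> L" "\<phi> y n = k" "\<phi> x n = 0" using copies[OF xy(2) K(2)] xy by blast
    obtain d q where dq: "d \<in> D" "q \<in> {n \<in> L. \<phi> x n \<in> W \<and> \<phi> y n \<in> W}" "n = d + q"
      using dense_in_decomp[OF D L pre2[OF W(2)] n(1)] by blast
    have dL: "d \<in> L" using dq(1) Ds(2) by blast
    have "\<phi> x d + \<phi> x q = 0" "\<phi> y d + \<phi> y q = k"
      using n dq dL hom_on_add[OF h[OF xy(1)], of d q] hom_on_add[OF h[OF xy(2)], of d q] by auto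
    then have "\<phi> x d = - \<phi> x q" "\<phi> y d \<noteq> 0"
      using dq(2) W(3) by (auto simp: eq_neg_iff_add_eq_0)
    then have "d \<in> B'" "\<phi> y d \<noteq> 0" using dq(1,2) subgrp_uminus[OF Ws] by (auto simp: B'_def)
    then have "fin_idx (\<phi> y ` B') G" by (intro just_infinite Bn) auto
    note Bf = pre2[OF this]
    \<comment> \<open>Now a copy of \<open>k\<close> at \<open>x\<close> is approximated, up to
      \<open>W\<close> at \<open>x\<close> and up to the image of \<open>B'\<close> at
      \<open>y\<close>. Subtracting a suitable element of \<open>B'\<close> clears coordinate
      \<open>y\<close> and leaves the class of \<open>k\<close> modulo \<open>W\<close> at
      \<open>x\<close>, which is not trivial.\<close>
    obtain n where n: "n \<in> L" "\<phi> x n = k" "\<phi> y n = 0" using copies[OF xy(1) K(2)] xy by blast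
    obtain m q where mq: "m \<in> D" "q \<in> {n \<in> L. \<phi> x n \<in> W \<and> \<phi> y n \<in> \<phi> y ` B'}" "n = m + q"
      using dense_in_decomp[OF D L Bf n(1)] by blast
    have mL: "m \<in> L" using mq(1) Ds(2) by blast
    have eqs: "\<phi> y m + \<phi> y q = 0" "\<phi> x m + \<phi> x q = k"
      using n mq mL hom_on_add[OF h[OF xy(1)], of m q] hom_on_add[OF h[OF xy(2)], of m q] by auto
    then have "\<phi> y m = - \<phi> y q" by (simp add: eq_neg_iff_add_eq_0)
    then have "\<phi> y m \<in> \<phi> y ` B'" using mq(2) subgrp_uminus[OF normal_in_subgrp[OF Bn]] by auto
    then obtain m' where m': "m' \<in> B'" "\<phi> y m = \<phi> y m'" by auto
    have m'D: "m' \<in> D" "\<phi> x m' \<in> W" using m'(1) by (auto simp: B'_def)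
    have "\<phi> y (m - m') = 0" using hom_on_diff[OF hD[OF xy(2)] Ds(1) mq(1) m'D(1)] m'(2) by simp
    moreover have "\<phi> x (m - m') \<noteq> 0"
    proof
      assume "\<phi> x (m - m') = 0"
      then have "\<phi> x m = \<phi> x m'" using hom_on_diff[OF hD[OF xy(1)] Ds(1) mq(1) m'D(1)] by simp
      then have "k \<in> W" using eqs(2) m'D(2) mq(2) subgrp_add[OF Ws, of "\<phi> x m" "\<phi> x q"] by simp
      then show False using W(3) by blast
    qed
    ultimately show ?thesis using subgrp_diff[OF Ds(1) mq(1) m'D(1)] by blast
  qed
  \<comment> \<open>To enlarge the zero set by \<open>y\<close>, take the commutator of an element
    vanishing on \<open>S\<close> with one vanishing at \<open>y\<close>; \<open>noncomm\<close>
    lets both be chosen so that the result is nonzero at \<open>x\<close>.\<close>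
  have single: "\<exists>m\<in>C S. \<phi> x m \<noteq> 0" if "finite S" "S \<subseteq> I - {x}" "x \<in> I" for S x
    using that
  proof (induction S rule: finite_induct)
    case empty
    have "k \<in> \<phi> x ` D" using full[OF empty(2)] K by blast
    then show ?case using K(3) by (auto simp: C_def)
  next
    case (insert y S)
    have y: "y \<in> I" "y \<noteq> x" "S \<subseteq> I" using insert.prems by auto
    have "\<phi> x ` C S \<noteq> {0}" using insert by blast
    moreover have "\<phi> x ` C {y} \<noteq> {0}" using pair[OF insert.prems(2) y(1)] y(2) by (auto simp: C_def)
    ultimately obtain m m' where m: "m \<in> C S" "m' \<in> C {y}" "commutator (\<phi> x m) (\<phi> x m') \<noteq> 0"
      using noncomm[OF An An, of S x "{y}" x] y insert.prems by blast
    have mD: "m \<in> D" "m' \<in> D" using m CsD by blast+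
    note hc = hom_on_commutator[OF hD Ds(1) mD]
    have "commutator m m' \<in> C (insert y S)"
      using m mD y Ds(1) hc by (auto simp: C_def commutator_in subset_iff)
    moreover have "\<phi> x (commutator m m') \<noteq> 0" using hc[OF insert.prems(2)] m(3) by simp
    ultimately show ?case by blast
  qed
  define J where "J x = \<phi> x ` C (I - {x})" for x
  have J: "fin_idx (J x) G" if "x \<in> I" for x
    unfolding J_def using single[of "I - {x}" x] I that by (intro just_infinite An) auto
  \<comment> \<open>An element whose coordinates all lie in the \<open>J i\<close> is assembled
    inside \<open>D\<close> from elements supported on one coordinate each.\<close>
  define Q where "Q = {n \<in> L. \<forall>i\<in>I. n \<in> {n \<in> L. \<phi> i n \<in> J i}}"
  have Q: "fin_idx Q L"
    unfolding Q_def by (intro fin_idx_Inter I L fin_idx_preimage[OF h _ J into])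
  have "Q \<subseteq> D"
  proof
    fix n assume "n \<in> Q"
    then have n: "n \<in> L" "\<And>i. i \<in> I \<Longrightarrow> \<phi> i n \<in> J i" by (auto simp: Q_def)
    have "\<exists>d\<in>D. (\<forall>i\<in>S. \<phi> i d = \<phi> i n) \<and> (\<forall>i\<in>I - S. \<phi> i d = 0)" if "finite S" "S \<subseteq> I" for S
      using that
    proof (induction S rule: finite_induct)
      case empty
      then show ?case using z subgrp_zero[OF Ds(1)] by auto
    next
      case (insert x S)
      then obtain d where d: "d \<in> D" "\<forall>i\<in>S. \<phi> i d = \<phi> i n" "\<forall>i\<in>I - S. \<phi> i d = 0" by auto
      obtain m where m: "m \<in> D" "\<phi> x m = \<phi> x n" "\<forall>i\<in>I - {x}. \<phi> i m = 0"
        using n(2)[of x] insert.prems by (auto simp: J_def C_def)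
      have "\<phi> i (d + m) = \<phi> i d + \<phi> i m" if "i \<in> I" for i by (rule hom_on_add[OF hD[OF that] d(1) m(1)])
      then have "\<phi> i (d + m) = (if i = x then \<phi> i n else \<phi> i d)" if "i \<in> I" for i
        using d m insert.hyps that by auto
      then have "(\<forall>i\<in>insert x S. \<phi> i (d + m) = \<phi> i n) \<and> (\<forall>i\<in>I - insert x S. \<phi> i (d + m) = 0)"
        using d(2,3) insert.prems by auto
      then show ?case using subgrp_add[OF Ds(1) d(1) m(1)] by blast
    qed
    from this[OF I subset_refl] obtain d where d: "d \<in> D" "\<forall>i\<in>I. \<phi> i d = \<phi> i n" by blast
    have "d - n = 0"
      using d n(1) Ds L hom_on_diff[OF h L] by (intro inj) (auto simp: subgrp_diff subset_iff)
    then show "n \<in> D" using d(1) by simp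
  qed
  then show ?thesis by (rule dense_in_fin_idx_eq[OF D Q])
qed

section \<open>Automorphisms of a rooted tree\<close>

text \<open>Automorphisms of the rooted tree of all words over the integers; additive notation, with
  \<open>f + g\<close> applying \<open>f\<close> first. The \<open>p\<close>-adic tree is the subtree of words over \<open>{0..<p}\<close>.\<close>

typedef taut = "{f :: int list \<Rightarrow> int list. bij f \<and> (\<forall>n u. take n (f u) = f (take n u))}"
  morphisms app Abs_taut
  by (rule exI[of _ id]) auto

setup_lifting type_definition_taut

lemma bij_app: "bij (app f)"
  and take_app: "take n (app f u) = app f (take n u)"
  using app[of f] by auto

lemma inv_take:
  assumes "bij f" "\<And>n u. take n (f u) = f (take n u)"
  shows "take n (inv_into UNIV f u) = inv_into UNIV f (take n u)"
proof -
  have "f (take n (inv_into UNIV f u)) = take n u" using assms by (simp add: assms(2)[symmetric] bij_is_surj surj_f_inv_f)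
  then show ?thesis using assms(1) by (metis bij_inv_eq_iff)
qed

instantiation taut :: group_add
begin

lift_definition zero_taut :: taut is id by auto
lift_definition plus_taut :: "taut \<Rightarrow> taut \<Rightarrow> taut" is "\<lambda>f g. g \<circ> f"
  by (auto intro: bij_comp)
lift_definition uminus_taut :: "taut \<Rightarrow> taut" is "inv_into UNIV"
  by (auto simp: bij_imp_bij_inv inv_take)
definition minus_taut :: "taut \<Rightarrow> taut \<Rightarrow> taut" where
  "minus_taut f g = f + - g"

instance
proof
  fix a b c :: taut
  show "a + b + c = a + (b + c)" by transfer (simp add: comp_assoc)
  show "0 + a = a" by transfer simp
  show "a + 0 = a" by transfer simp
  show "- a + a = 0" by transfer (auto simp: bij_is_surj surj_f_inv_f fun_eq_iff)
  show "a + - b = a - b" by (simp add: minus_taut_def)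
qed

end

lemma app_zero [simp]: "app 0 u = u"
  by transfer simp

lemma app_add [simp]: "app (f + g) u = app g (app f u)"
  by transfer simp

lemma app_diff [simp]: "app (f - g) u = app (- g) (app f u)"
  by (simp only: minus_taut_def app_add)

lemma app_uminus_app [simp]: "app (- f) (app f u) = u"
  and app_app_uminus [simp]: "app f (app (- f) u) = u"
  using app_add[of f "- f" u] app_add[of "- f" f u] by simp_all

lemma app_eq_iff [simp]: "app f u = app f v \<longleftrightarrow> u = v"
  by (metis app_uminus_app)

lemma taut_eqI: "(\<And>u. app f u = app g u) \<Longrightarrow> f = g"
  by (simp add: app_inject[symmetric] fun_eq_iff)

text \<open>Truncating at the length of the word shows that no automorphism lengthens a word; the
  inverse gives the other inequality.\<close>

lemma length_app [simp]: "length (app f u) = length u"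
proof -
  have le: "length (app g v) \<le> length v" for g v
    using take_app[of "length v" g v] by (metis length_take min.cobounded2 min.commute order_refl take_all_iff)
  show ?thesis using le[of f u] le[of "- f" "app f u"] by simp
qed

lemma app_Nil [simp]: "app f [] = []"
  by (metis length_0_conv length_app)

lemma app_append_take: "app f (u @ v) = app f u @ drop (length u) (app f (u @ v))"
  using take_app[of "length u" f "u @ v"] by (metis append_eq_conv_conj append_take_drop_id)

lift_definition sec :: "taut \<Rightarrow> int list \<Rightarrow> taut" is
  "\<lambda>f u v. drop (length u) (f (u @ v))"
proof (intro conjI allI)
  fix f :: "int list \<Rightarrow> int list" and u :: "int list" and n :: nat and v :: "int list"
  assume f: "bij f \<and> (\<forall>n u. take n (f u) = f (take n u))"
  define F where "F = Abs_taut f"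
  have F: "f = app F" using f by (simp add: F_def Abs_taut_inverse)
  show "bij (\<lambda>v. drop (length u) (f (u @ v)))"
  proof (rule bijI)
    show "inj (\<lambda>v. drop (length u) (f (u @ v)))"
      by (rule injI) (metis F app_append_take app_eq_iff same_append_eq)
    show "surj (\<lambda>v. drop (length u) (f (u @ v)))"
    proof (rule surjI)
      fix w
      have "app (- F) (app F u @ w) = u @ drop (length u) (app (- F) (app F u @ w))"
        using app_append_take[of "- F" "app F u" w] by simp
      then have "app F (u @ drop (length u) (app (- F) (app F u @ w))) = app F u @ w"
        by (metis app_app_uminus)
      then show "drop (length u) (f (u @ drop (length u) (app (- F) (app F u @ w)))) = w"
        by (simp add: F)
    qed
  qed
  have "take n (drop (length u) (f (u @ v))) = drop (length u) (take (length u + n) (app F (u @ v)))"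
    by (simp add: F take_drop add.commute)
  also have "\<dots> = drop (length u) (app F (u @ take n v))"
    unfolding take_app by simp
  finally show "take n (drop (length u) (f (u @ v))) = drop (length u) (f (u @ take n v))"
    by (simp add: F)
qed

lemma app_append: "app f (u @ v) = app f u @ app (sec f u) v"
  using app_append_take[of f u v] by transfer simp

lemma app_Cons: "app f (x # v) = app f [x] @ app (sec f [x]) v"
  using app_append[of f "[x]" v] by simp

lemma sec_eqI: "(\<And>v. app f (u @ v) = app f u @ app g v) \<Longrightarrow> sec f u = g"
  by (rule taut_eqI) (simp add: app_append)

lemma sec_zero [simp]: "sec 0 u = 0"
  by (rule sec_eqI) simp

lemma sec_Nil [simp]: "sec f [] = f"
  by (rule sec_eqI) simp

lemma sec_add: "sec (f + g) u = sec f u + sec g (app f u)"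
  by (rule sec_eqI) (simp only: app_add, simp only: app_append)

lemma sec_uminus: "sec (- f) u = - sec f (app (- f) u)"
  using sec_add[of "- f" f u] by (simp add: eq_neg_iff_add_eq_0)

lemma sec_append: "sec f (u @ v) = sec (sec f u) v"
  by (rule sec_eqI) (simp add: app_append)

lemma app_uminus_fix: "app f u = u \<Longrightarrow> app (- f) u = u"
  by (metis app_uminus_app)

lemma sec_uminus_fix: "app f u = u \<Longrightarrow> sec (- f) u = - sec f u"
  by (simp add: sec_uminus app_uminus_fix)

text \<open>Longer words are decided by the sections on level \<open>n\<close>, shorter ones by
  padding them to length \<open>n\<close> and truncating.\<close>

lemma taut_eq_level:
  assumes "\<And>u. length u = n \<Longrightarrow> app f u = app g u" "\<And>u. length u = n \<Longrightarrow> sec f u = sec g u"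
  shows "f = g"
proof (rule taut_eqI)
  fix u :: "int list"
  show "app f u = app g u"
  proof (cases "length u < n")
    case True
    define w where "w = u @ replicate (n - length u) (0::int)"
    have w: "length w = n" "take (length u) w = u" using True by (simp_all add: w_def)
    have "app f u = take (length u) (app f w)" by (simp add: take_app w(2))
    also have "\<dots> = app g u" using assms(1)[OF w(1)] by (simp add: take_app w(2))
    finally show ?thesis .
  next
    case False
    have "app f (take n u @ drop n u) = app g (take n u @ drop n u)"
      using False assms[of "take n u"] by (simp only: app_append) simp
    then show ?thesis by simp
  qed
qed

text \<open>The automorphism supported below \<open>v\<close> that acts there as \<open>k\<close>;
  for fixed \<open>v\<close> these form the rigid stabiliser of \<open>v\<close>.\<close>

lift_definition at_vertex :: "int list \<Rightarrow> taut \<Rightarrow> taut" is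
  "\<lambda>v k w. if take (length v) w = v then v @ k (drop (length v) w) else w"
proof (intro conjI allI)
  fix k :: "int list \<Rightarrow> int list" and v :: "int list" and n :: nat and w :: "int list"
  assume k: "bij k \<and> (\<forall>n u. take n (k u) = k (take n u))"
  let ?F = "\<lambda>k w. if take (length v) w = v then v @ k (drop (length v) w) else w"
  have kk: "k (inv_into UNIV k x) = x" "inv_into UNIV k (k x) = x" for x
    using k by (auto simp: bij_is_surj surj_f_inv_f bij_is_inj)
  have "v @ drop (length v) x = x" if "take (length v) x = v" for x
    using that append_take_drop_id[of "length v" x] by simp
  then show "bij (?F k)"
    by (intro o_bij[of "?F (inv_into UNIV k)"]) (auto simp: fun_eq_iff kk)
  have k0: "k [] = []" using k by (metis take_0)
  show "take n (?F k w) = ?F k (take n w)"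
  proof (cases "length v \<le> n")
    case True
    then have "take (length v) (take n w) = take (length v) w" by (simp add: min_def)
    then show ?thesis using k True by (auto simp: drop_take)
  next
    case False
    show ?thesis
    proof (cases "take (length v) w = v")
      case True
      then have "take n w = take n v" using False by (metis min.absorb1 nat_le_linear take_take)
      moreover have "take (length v) (take n w) \<noteq> v \<or> drop (length v) (take n w) = [] \<and> take n w = v"
        using False by auto
      ultimately show ?thesis using True False k0 by auto
    next
      case notv: False
      have "take (length v) (take n w) \<noteq> v" using False notv
        by (metis min.absorb1 nat_le_linear take_all_iff take_take)
      then show ?thesis using notv by simp
    qed
  qed
qed

lemma app_at_vertex_if:
  "app (at_vertex v k) w = (if take (length v) w = v then v @ app k (drop (length v) w) else w)"
  by transfer simp

lemma app_at_vertex: "length u = length v \<Longrightarrow> app (at_vertex v k) u = u"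
  by (simp add: app_at_vertex_if)

lemma sec_at_vertex: "length u = length v \<Longrightarrow> sec (at_vertex v k) u = (if u = v then k else 0)"
  by (rule sec_eqI) (simp add: app_at_vertex_if)

lemma at_vertex_eqI:
  assumes "\<And>u. length u = length v \<Longrightarrow> app g u = u"
    and "\<And>u. length u = length v \<Longrightarrow> sec g u = (if u = v then k else 0)"
  shows "g = at_vertex v k"
  by (rule taut_eq_level[of "length v"]) (simp_all add: assms app_at_vertex sec_at_vertex)

lemma at_vertex_zero [simp]: "at_vertex v 0 = 0"
  by (rule at_vertex_eqI[symmetric]) simp_all

lemma at_vertex_add: "at_vertex v (k + l) = at_vertex v k + at_vertex v l"
  by (rule at_vertex_eqI[symmetric]) (simp_all add: sec_add app_at_vertex sec_at_vertex)

lemma hom_on_at_vertex: "hom_on S (at_vertex v)"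
  by (simp add: hom_on_def at_vertex_add)

lemma at_vertex_Cons: "at_vertex (x # v) k = at_vertex [x] (at_vertex v k)"
proof (rule at_vertex_eqI[symmetric])
  fix u :: "int list" assume "length u = length (x # v)"
  then obtain y w where u: "u = y # w" "length w = length v" by (cases u) auto
  show "app (at_vertex [x] (at_vertex v k)) u = u"
    using u app_append[of "at_vertex [x] (at_vertex v k)" "[y]" w]
    by (simp add: app_at_vertex sec_at_vertex)
  show "sec (at_vertex [x] (at_vertex v k)) u = (if u = x # v then k else 0)"
    using u sec_append[of _ "[y]" w] by (simp add: sec_at_vertex)
qed

lemma at_vertex_Nil [simp]: "at_vertex [] k = k"
  by (rule at_vertex_eqI[symmetric]) simp_all

lemma at_vertex_append: "at_vertex (u @ v) k = at_vertex u (at_vertex v k)"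
  by (induction u) (simp_all, metis at_vertex_Cons)

lemma conj_at_vertex:
  "- g + at_vertex v k + g = at_vertex (app g v) (- sec g v + k + sec g v)"
proof (rule at_vertex_eqI)
  fix u :: "int list" assume l: "length u = length (app g v)"
  show "app (- g + at_vertex v k + g) u = u"
    using l by (simp add: app_at_vertex)
  show "sec (- g + at_vertex v k + g) u = (if u = app g v then - sec g v + k + sec g v else 0)"
  proof (cases "u = app g v")
    case True
    then show ?thesis by (simp add: sec_add sec_uminus sec_at_vertex app_at_vertex)
  next
    case False
    then have "app (- g) u \<noteq> v" by auto
    then show ?thesis using False l by (simp add: sec_add sec_uminus sec_at_vertex app_at_vertex)
  qed
qed

lemma commutator_at_vertex_disjoint:
  assumes "length u = length v" "u \<noteq> v"
  shows "at_vertex u k + at_vertex v l = at_vertex v l + at_vertex u k"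
  by (rule taut_eq_level[of "length v"])
     (use assms in \<open>auto simp: sec_add app_at_vertex sec_at_vertex\<close>)

section \<open>Multi-edge spinal groups\<close>

lemma sec_diff: "sec (f - g) u = sec f u + sec (- g) (app f u)"
  by (simp only: minus_taut_def sec_add)

section \<open>Rooted and directed automorphisms\<close>

fun rot_word :: "int \<Rightarrow> int \<Rightarrow> int list \<Rightarrow> int list" where
  "rot_word p k [] = []"
| "rot_word p k (x # v) = (if x \<in> {0..<p} then (x + k) mod p else x) # v"

text \<open>The letter \<open>0\<close> plays the part of \<open>p\<close>, so the directed path is
  \<open>0, 0, ...\<close>; a letter outside \<open>{0..<p}\<close> carries the trivial
  section.\<close>

fun dir_word :: "int \<Rightarrow> (int \<Rightarrow> int) \<Rightarrow> int list \<Rightarrow> int list" where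
  "dir_word p \<xi> [] = []"
| "dir_word p \<xi> (x # v) =
     x # (if x = 0 then dir_word p \<xi> v else if x \<in> {0..<p} then rot_word p (\<xi> x) v else v)"

definition rot :: "int \<Rightarrow> int \<Rightarrow> taut" where
  "rot p k = Abs_taut (rot_word p k)"

definition dir :: "int \<Rightarrow> (int \<Rightarrow> int) \<Rightarrow> taut" where
  "dir p \<xi> = Abs_taut (dir_word p \<xi>)"

context
  fixes p :: int
  assumes p0: "p > 0"
begin

lemma rot_word_add: "rot_word p l (rot_word p k u) = rot_word p (k + l) u"
  by (cases u) (auto simp: p0 mod_simps algebra_simps)

lemma rot_word_0: "rot_word p 0 u = u"
  by (cases u) auto

lemma dir_word_add: "dir_word p \<zeta> (dir_word p \<xi> u) = dir_word p (\<lambda>d. \<xi> d + \<zeta> d) u"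
  by (induction u) (auto simp: rot_word_add)

lemma dir_word_0: "dir_word p (\<lambda>_. 0) u = u"
  by (induction u) (auto simp: rot_word_0)

lemma app_rot: "app (rot p k) = rot_word p k"
  unfolding rot_def
proof (rule Abs_taut_inverse, safe)
  show "bij (rot_word p k)"
    by (rule o_bij[of "rot_word p (- k)"]) (auto simp: rot_word_add rot_word_0)
  show "take n (rot_word p k u) = rot_word p k (take n u)" for n u
    by (cases n; cases u) auto
qed

lemma app_dir: "app (dir p \<xi>) = dir_word p \<xi>"
  unfolding dir_def
proof (rule Abs_taut_inverse, safe)
  show "bij (dir_word p \<xi>)"
    by (rule o_bij[of "dir_word p (\<lambda>d. - \<xi> d)"]) (auto simp: dir_word_add dir_word_0)
  show "take n (dir_word p \<xi> u) = dir_word p \<xi> (take n u)" for n u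
  proof (induction u arbitrary: n)
    case (Cons x u)
    have "take m (rot_word p k u) = rot_word p k (take m u)" for m k
      using take_app[of m "rot p k" u] by (simp add: app_rot)
    with Cons show ?case by (cases n) auto
  qed simp
qed

lemma rot_add: "rot p (k + l) = rot p k + rot p l"
  by (rule taut_eqI) (simp add: app_rot rot_word_add)

lemma rot_0 [simp]: "rot p 0 = 0"
  by (rule taut_eqI) (simp add: app_rot rot_word_0)

lemma rot_uminus: "rot p (- k) = - rot p k"
  using rot_add[of "- k" k] by (simp add: eq_neg_iff_add_eq_0)

lemma rot_comm: "rot p k + rot p l = rot p l + rot p k"
  by (simp add: rot_add[symmetric] add.commute)

lemma app_rot_letter: "app (rot p k) [x] = [if x \<in> {0..<p} then (x + k) mod p else x]"
  by (simp add: app_rot)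

lemma sec_rot: "sec (rot p k) [x] = 0"
  by (rule sec_eqI) (simp add: app_rot)

lemma rot_cong: "k mod p = l mod p \<Longrightarrow> rot p k = rot p l"
proof (rule taut_eqI)
  fix u assume "k mod p = l mod p"
  then have "(x + k) mod p = (x + l) mod p" for x by (metis mod_add_right_eq)
  then show "app (rot p k) u = app (rot p l) u" by (cases u) (auto simp: app_rot)
qed

lemma rot_mult_mem:
  assumes "subgrp S" "rot p k \<in> S"
  shows "rot p (k * m) \<in> S"
proof -
  have nat: "rot p (k * int n) \<in> S" for n
  proof (induction n)
    case 0
    then show ?case using assms by (simp add: subgrp_zero)
  next
    case (Suc n)
    have "rot p (k * int (Suc n)) = rot p (k * int n) + rot p k"
      by (simp add: rot_add[symmetric] algebra_simps)
    then show ?case using Suc assms by (simp add: subgrp_add)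
  qed
  show ?thesis
  proof (cases "m \<ge> 0")
    case True
    then show ?thesis using nat[of "nat m"] by simp
  next
    case False
    then have "rot p (k * m) = - rot p (k * int (nat (- m)))"
      by (simp add: rot_uminus[symmetric])
    then show ?thesis using subgrp_uminus[OF assms(1) nat[of "nat (- m)"]] by simp
  qed
qed

text \<open>Modulo the prime \<open>p\<close> the factor \<open>k\<close> is invertible, so some
  multiple of it is congruent to \<open>l\<close>.\<close>

lemma rot_unit_mem:
  assumes "subgrp S" "rot p k \<in> S" "prime p" "\<not> p dvd k"
  shows "rot p l \<in> S"
proof -
  have "coprime k p" using assms(3,4) by (metis coprime_commute prime_imp_coprime)
  then obtain m where m: "[k * m = 1] (mod p)" using cong_solve_coprime_int by blast
  have "rot p (k * (m * l)) = rot p l"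
    using cong_scalar_right[OF m, of l] by (intro rot_cong) (simp add: cong_def mult.assoc)
  then show ?thesis using rot_mult_mem[OF assms(1,2), of "m * l"] by simp
qed

lemma dir_add: "dir p (\<lambda>d. \<xi> d + \<zeta> d) = dir p \<xi> + dir p \<zeta>"
  by (rule taut_eqI) (simp add: app_dir dir_word_add)

lemma dir_0 [simp]: "dir p (\<lambda>_. 0) = 0"
  by (rule taut_eqI) (simp add: app_dir dir_word_0)

lemma dir_uminus: "dir p (\<lambda>d. - \<xi> d) = - dir p \<xi>"
  using dir_add[of "\<lambda>d. - \<xi> d" \<xi>] by (simp add: eq_neg_iff_add_eq_0)

lemma dir_comm: "dir p \<xi> + dir p \<zeta> = dir p \<zeta> + dir p \<xi>"
  by (simp add: dir_add[symmetric] add.commute)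

lemma app_dir_letter: "app (dir p \<xi>) [x] = [x]"
  by (simp add: app_dir)

lemma sec_dir:
  "sec (dir p \<xi>) [x] = (if x = 0 then dir p \<xi> else if x \<in> {0..<p} then rot p (\<xi> x) else 0)"
  by (rule sec_eqI) (simp add: app_dir app_rot)

lemma dir_cong:
  assumes "\<And>d. d \<in> {1..<p} \<Longrightarrow> \<xi> d mod p = \<zeta> d mod p"
  shows "dir p \<xi> = dir p \<zeta>"
proof (rule taut_eqI)
  fix u show "app (dir p \<xi>) u = app (dir p \<zeta>) u"
    unfolding app_dir
  proof (induction u)
    case (Cons x u)
    have "rot_word p (\<xi> x) u = rot_word p (\<zeta> x) u" if "x \<in> {1..<p}"
      using rot_cong[OF assms[OF that]] by (metis app_rot)
    with Cons show ?case by auto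
  qed simp
qed

text \<open>Only residues of the exponents matter, so even an infinite set of integer-valued
  functions gives finitely many automorphisms. This makes \<open>spinal_group\<close> finitely
  generated and bounds the number of directed elements that a subgroup can miss.\<close>

lemma finite_range_dir: "finite (range (dir p))"
proof -
  have "range (dir p) \<subseteq> dir p ` ({1..<p} \<rightarrow>\<^sub>E {0..<p})"
  proof safe
    fix \<xi>
    have "dir p \<xi> = dir p (\<lambda>d\<in>{1..<p}. \<xi> d mod p)" by (rule dir_cong) simp
    then show "dir p \<xi> \<in> dir p ` ({1..<p} \<rightarrow>\<^sub>E {0..<p})" using p0 by auto
  qed
  then show ?thesis by (rule finite_subset) (simp add: finite_PiE)
qed

text \<open>The conjugate of a directed automorphism whose directed path leaves through the letter
  \<open>t mod p\<close>.\<close>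

definition cdir :: "int \<Rightarrow> (int \<Rightarrow> int) \<Rightarrow> taut" where
  "cdir t \<xi> = - rot p t + dir p \<xi> + rot p t"

lemma app_cdir: "app (cdir t \<xi>) [x] = [x]"
  unfolding cdir_def rot_uminus[symmetric]
  by (auto simp: app_rot_letter app_dir_letter p0 mod_simps)

lemma sec_cdir:
  assumes "x \<in> {0..<p}"
  shows "sec (cdir t \<xi>) [x] =
    (if (x - t) mod p = 0 then dir p \<xi> else rot p (\<xi> ((x - t) mod p)))"
  using assms p0 unfolding cdir_def rot_uminus[symmetric]
  by (auto simp: sec_add sec_rot app_rot_letter sec_dir app_dir_letter)

lemma sec_cdir_outside: "x \<notin> {0..<p} \<Longrightarrow> sec (cdir t \<xi>) [x] = 0"
  unfolding cdir_def rot_uminus[symmetric] using p0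
  by (auto simp: sec_add sec_rot app_rot_letter sec_dir app_dir_letter)

lemma cdir_conj: "- rot p s + cdir t \<xi> + rot p s = cdir (t + s) \<xi>"
  by (simp only: cdir_def rot_add grp_simps)

lemma cdir_cong: "t mod p = s mod p \<Longrightarrow> cdir t \<xi> = cdir s \<xi>"
  unfolding cdir_def using rot_cong by metis

lemma cdir_add: "cdir t (\<lambda>d. \<xi> d + \<zeta> d) = cdir t \<xi> + cdir t \<zeta>"
  by (simp only: cdir_def dir_add grp_simps)

lemma cdir_0 [simp]: "cdir 0 \<xi> = dir p \<xi>"
  by (simp add: cdir_def)

end

definition spinal_group :: "int \<Rightarrow> (int \<Rightarrow> int) set \<Rightarrow> taut set" where
  "spinal_group p E = gen (insert (rot p 1) (dir p ` E))"

definition words :: "int \<Rightarrow> nat \<Rightarrow> int list set" where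
  "words p n = {u. length u = n \<and> set u \<subseteq> {0..<p}}"

lemma finite_words: "finite (words p n)"
proof -
  have "words p n = {u. set u \<subseteq> {0..<p} \<and> length u = n}" by (auto simp: words_def)
  then show ?thesis by (simp add: finite_lists_length_eq)
qed

lemma words_0 [simp]: "words p 0 = {[]}"
  by (auto simp: words_def)

lemma words_Suc: "u \<in> words p (Suc n) \<longleftrightarrow> (\<exists>x v. u = x # v \<and> x \<in> {0..<p} \<and> v \<in> words p n)"
  by (cases u) (auto simp: words_def)

text \<open>\<open>E\<close> is an additive group of exponent functions instead of a basis: the
  directed elements then form a subgroup, and factors directed at one letter merge into a single
  one.\<close>

locale spinal =
  fixes p :: int and E :: "(int \<Rightarrow> int) set"
  assumes prime_p: "prime p"
    and E_0: "(\<lambda>_. 0) \<in> E"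
    and E_add: "\<xi> \<in> E \<Longrightarrow> \<zeta> \<in> E \<Longrightarrow> (\<lambda>d. \<xi> d + \<zeta> d) \<in> E"
    and E_uminus: "\<xi> \<in> E \<Longrightarrow> (\<lambda>d. - \<xi> d) \<in> E"
    and E_nonzero: "\<exists>\<xi>\<in>E. \<exists>d\<in>{1..<p}. \<not> p dvd \<xi> d"
    and torsion: "torsion_on (spinal_group p E)"
begin

lemma p_pos: "p > 0" and p_gt1: "p > 1"
  using prime_p by (auto simp: prime_gt_0_int prime_gt_1_int)

abbreviation "G \<equiv> spinal_group p E"
abbreviation "a \<equiv> rot p"
abbreviation "b \<equiv> dir p"
abbreviation "cb \<equiv> cdir p"
abbreviation "X \<equiv> {0..<p}"

lemmas a_add = rot_add[OF p_pos]
  and a_0 [simp] = rot_0[OF p_pos]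
  and a_uminus = rot_uminus[OF p_pos]
  and a_comm = rot_comm[OF p_pos]
  and app_a = app_rot_letter[OF p_pos]
  and sec_a [simp] = sec_rot[OF p_pos]
  and a_cong = rot_cong[OF p_pos]
  and a_unit_mem = rot_unit_mem[OF p_pos _ _ prime_p]
  and a_mult_mem = rot_mult_mem[OF p_pos]
  and b_add = dir_add[OF p_pos]
  and b_0 [simp] = dir_0[OF p_pos]
  and b_uminus = dir_uminus[OF p_pos]
  and b_comm = dir_comm[OF p_pos]
  and app_b [simp] = app_dir_letter[OF p_pos]
  and sec_b = sec_dir[OF p_pos]
  and cb_def = cdir_def[OF p_pos]
  and app_cb [simp] = app_cdir[OF p_pos]
  and sec_cb = sec_cdir[OF p_pos]
  and sec_cb_outside = sec_cdir_outside[OF p_pos]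
  and cb_conj = cdir_conj[OF p_pos]
  and cb_cong = cdir_cong[OF p_pos]
  and cb_add = cdir_add[OF p_pos]
  and cb_0 [simp] = cdir_0[OF p_pos]

lemma G: "subgrp G"
  by (simp add: spinal_group_def subgrp_gen)

lemma a_G: "a k \<in> G"
  using a_mult_mem[OF G, of 1 k] by (simp add: spinal_group_def gen_incl)

lemma b_G: "\<xi> \<in> E \<Longrightarrow> b \<xi> \<in> G"
  by (simp add: spinal_group_def gen_incl)

lemma cb_G: "\<xi> \<in> E \<Longrightarrow> cb t \<xi> \<in> G"
  unfolding cb_def by (intro subgrp_conj G b_G a_G)

lemma G_least: "subgrp S \<Longrightarrow> a 1 \<in> S \<Longrightarrow> (\<And>\<xi>. \<xi> \<in> E \<Longrightarrow> b \<xi> \<in> S) \<Longrightarrow> G \<subseteq> S"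
  unfolding spinal_group_def by (rule gen_least) auto

lemma fin_gen_G: "fin_gen G"
proof -
  have "finite (insert (a 1) (b ` E))"
    using finite_subset[OF image_mono[OF subset_UNIV] finite_range_dir[OF p_pos]] by simp
  then show ?thesis unfolding fin_gen_def spinal_group_def by blast
qed

section \<open>Self-similarity and level stabilisers\<close>

definition self_sim :: "taut set" where
  "self_sim = {g. (\<forall>x. x \<notin> X \<longrightarrow> app g [x] = [x] \<and> sec g [x] = 0) \<and>
     (\<exists>k. \<forall>x\<in>X. app g [x] = [(x + k) mod p]) \<and> (\<forall>x. sec g [x] \<in> G)}"

lemma G_self_sim: "G \<subseteq> self_sim"
proof (rule G_least)
  show "subgrp self_sim"
  proof (rule subgrpI)
    show "0 \<in> self_sim" by (auto simp: self_sim_def subgrp_zero[OF G] intro!: exI[of _ 0])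
    fix g h assume g: "g \<in> self_sim" and h: "h \<in> self_sim"
    obtain k where k: "\<And>x. x \<in> X \<Longrightarrow> app g [x] = [(x + k) mod p]" using g by (auto simp: self_sim_def)
    obtain l where l: "\<And>x. x \<in> X \<Longrightarrow> app h [x] = [(x + l) mod p]" using h by (auto simp: self_sim_def)
    have hX: "app (- h) [x] = [(x - l) mod p]" if "x \<in> X" for x
    proof -
      have "app h [(x - l) mod p] = [x]" using l[of "(x - l) mod p"] p_pos that by (simp add: mod_simps)
      then show ?thesis by (metis app_uminus_app)
    qed
    have ho: "app (- h) [x] = [x]" if "x \<notin> X" for x
      using h that by (intro app_uminus_fix) (auto simp: self_sim_def)
    have sh: "sec (- h) [x] \<in> G" for x
    proof (cases "x \<in> X")
      case True
      then show ?thesis using h by (auto simp: sec_uminus hX self_sim_def intro!: subgrp_uminus[OF G])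
    next
      case False
      then show ?thesis using h
        by (auto simp: sec_uminus ho self_sim_def subgrp_zero[OF G] intro!: subgrp_uminus[OF G])
    qed
    have "sec (g - h) [x] \<in> G" for x
    proof -
      obtain y where "app g [x] = [y]" using g by (cases "x \<in> X") (auto simp: self_sim_def)
      then show ?thesis using g sh by (auto simp: sec_diff self_sim_def intro!: subgrp_add[OF G])
    qed
    moreover have "app (g - h) [x] = [(x + (k - l)) mod p]" if "x \<in> X" for x
      using k[OF that] p_pos by (simp add: hX mod_simps algebra_simps)
    moreover have "app (g - h) [x] = [x] \<and> sec (g - h) [x] = 0" if "x \<notin> X" for x
      using that g h by (auto simp: ho sec_diff sec_uminus self_sim_def)
    ultimately show "g - h \<in> self_sim" unfolding self_sim_def by auto
  qed
  show "a 1 \<in> self_sim" by (auto simp: self_sim_def app_a subgrp_zero[OF G])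
  show "b \<xi> \<in> self_sim" if "\<xi> \<in> E" for \<xi>
    using that p_pos
    by (auto simp: self_sim_def sec_b b_G a_G subgrp_zero[OF G] intro!: exI[of _ 0])
qed

lemma G_shift: "g \<in> G \<Longrightarrow> \<exists>k. \<forall>x\<in>X. app g [x] = [(x + k) mod p]"
  and G_outside: "g \<in> G \<Longrightarrow> x \<notin> X \<Longrightarrow> app g [x] = [x]" "g \<in> G \<Longrightarrow> x \<notin> X \<Longrightarrow> sec g [x] = 0"
  and sec_letter_G: "g \<in> G \<Longrightarrow> sec g [x] \<in> G"
  using G_self_sim by (auto simp: self_sim_def subset_iff)

lemma sec_G: "g \<in> G \<Longrightarrow> sec g u \<in> G"
proof (induction u arbitrary: g)
  case (Cons x u)
  then have "sec (sec g [x]) u \<in> G" using sec_letter_G by blast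
  then show ?case using sec_append[of g "[x]" u] by simp
qed simp

lemma app_letter_X: "g \<in> G \<Longrightarrow> x \<in> X \<Longrightarrow> \<exists>y\<in>X. app g [x] = [y]"
  using G_shift[of g] p_pos by (metis atLeastLessThan_iff pos_mod_bound pos_mod_sign)

lemma app_words: "g \<in> G \<Longrightarrow> u \<in> words p n \<Longrightarrow> app g u \<in> words p n"
proof (induction u arbitrary: g n)
  case (Cons x u)
  then obtain m where m: "n = Suc m" "x \<in> X" "u \<in> words p m"
    by (cases n) (auto simp: words_def)
  obtain y where y: "y \<in> X" "app g [x] = [y]" using app_letter_X Cons.prems(1) m(2) by blast
  have "app (sec g [x]) u \<in> words p m" using Cons.IH[OF sec_letter_G[OF Cons.prems(1)] m(3)] .
  then show ?case using y m(1) app_Cons[of g x u] by (simp add: words_Suc)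
qed simp

text \<open>Letters outside \<open>X\<close> are fixed with trivial section, so finitely many words
  decide whether a level is fixed. Stabilisers may thus quantify over all integer words and still
  have finite index.\<close>

lemma fix_words_imp:
  "g \<in> G \<Longrightarrow> (\<And>u. u \<in> words p n \<Longrightarrow> app g u = u) \<Longrightarrow> length u = n \<Longrightarrow> app g u = u"
proof (induction n arbitrary: g u)
  case (Suc n)
  obtain x v where u: "u = x # v" "length v = n" using Suc.prems(3) by (cases u) auto
  have fix1: "app g [y] = [y] \<and> (\<forall>w\<in>words p n. app (sec g [y]) w = w)" if y: "y \<in> X" for y
  proof -
    have "app g [y] @ app (sec g [y]) w = [y] @ w" if "w \<in> words p n" for w
      using Suc.prems(2)[of "y # w"] y that by (simp add: words_Suc app_Cons[of g y w])
    then have *: "app g [y] = [y] \<and> app (sec g [y]) w = w" if "w \<in> words p n" for w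
      using that by (metis append_eq_append_conv length_app)
    \<comment> \<open>Some word of length \<open>n\<close> must exist for the fixing of
      \<open>[y]\<close> itself to be read off.\<close>
    have "replicate n 0 \<in> words p n" using p_pos by (auto simp: words_def)
    then show ?thesis using * by blast
  qed
  show ?case
  proof (cases "x \<in> X")
    case True
    have "app (sec g [x]) v = v"
      using fix1[OF True] by (intro Suc.IH[OF sec_letter_G[OF Suc.prems(1)] _ u(2)]) blast
    then show ?thesis using fix1[OF True] u by (simp add: app_Cons[of g x v])
  next
    case False
    then show ?thesis using G_outside[OF Suc.prems(1) False] u by (simp add: app_Cons[of g x v])
  qed
qed simp

lemma sec_outside_words: "g \<in> G \<Longrightarrow> u \<notin> words p (length u) \<Longrightarrow> sec g u = 0"
proof (induction u arbitrary: g)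
  case (Cons x u)
  show ?case
  proof (cases "x \<in> X")
    case True
    then have "u \<notin> words p (length u)" using Cons.prems(2) by (auto simp: words_def)
    then show ?thesis using Cons.IH[OF sec_letter_G[OF Cons.prems(1)]] sec_append[of g "[x]" u] by simp
  next
    case False
    then show ?thesis using G_outside(2)[OF Cons.prems(1) False] sec_append[of g "[x]" u] by simp
  qed
qed simp

definition St :: "nat \<Rightarrow> taut set" where
  "St n = {g \<in> G. \<forall>u. length u = n \<longrightarrow> app g u = u}"

lemma St_G: "St n \<subseteq> G"
  by (auto simp: St_def)

lemma St_fix: "g \<in> St n \<Longrightarrow> length u = n \<Longrightarrow> app g u = u"
  by (auto simp: St_def)

lemma subgrp_St: "subgrp (St n)"
proof (rule subgrpI)
  fix x y assume *: "x \<in> St n" "y \<in> St n"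
  then have "app (x - y) u = u" if "length u = n" for u
    using that by (simp add: St_def app_uminus_fix)
  then show "x - y \<in> St n" using * G by (simp add: St_def subgrp_diff)
qed (use G in \<open>simp add: St_def subgrp_zero\<close>)

lemma normal_in_St: "normal_in (St n) G"
  unfolding normal_in_def using subgrp_St[of n] by (auto simp: St_def subgrp_conj[OF G])

lemma hom_on_sec: "length u = n \<Longrightarrow> hom_on (St n) (\<lambda>g. sec g u)"
  by (simp add: hom_on_def sec_add St_fix)

lemma St_1I: "g \<in> G \<Longrightarrow> (\<And>x. app g [x] = [x]) \<Longrightarrow> g \<in> St 1"
  by (auto simp: St_def length_Suc_conv)

lemma St_1_letter: "g \<in> St 1 \<Longrightarrow> app g [x] = [x]"
  by (simp add: St_def)

lemma cb_St: "\<xi> \<in> E \<Longrightarrow> cb t \<xi> \<in> St 1"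
  by (intro St_1I cb_G) simp_all

lemma fin_idx_St: "fin_idx (St n) G"
proof (rule fin_idxI[where f = "\<lambda>g. \<lambda>u\<in>words p n. app g u"])
  have "(\<lambda>g. \<lambda>u\<in>words p n. app g u) ` G \<subseteq> words p n \<rightarrow>\<^sub>E words p n"
    using app_words by auto
  then show "finite ((\<lambda>g. \<lambda>u\<in>words p n. app g u) ` G)"
    by (rule finite_subset) (simp add: finite_PiE finite_words)
  fix x y assume xy: "x \<in> G" "y \<in> G"
    "(\<lambda>u\<in>words p n. app x u) = (\<lambda>u\<in>words p n. app y u)"
  have "app x u = app y u" if "u \<in> words p n" for u
    using fun_cong[OF xy(3), of u] that by simp
  then have "app (x - y) u = u" if "u \<in> words p n" for u using that by simp
  from fix_words_imp[OF subgrp_diff[OF G xy(1,2)] this] show "x - y \<in> St n"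
    using subgrp_diff[OF G xy(1,2)] by (simp add: St_def)
qed (auto simp: subgrp_St St_G)

lemma St_sec_St:
  assumes "g \<in> St m" "\<And>u. u \<in> words p m \<Longrightarrow> sec g u \<in> St n"
  shows "g \<in> St (m + n)"
proof -
  have "app g w = w" if "length w = m + n" for w
  proof -
    let ?u = "take m w" and ?v = "drop m w"
    have l: "length ?u = m" "length ?v = n" using that by auto
    have "app (sec g ?u) ?v = ?v"
    proof (cases "?u \<in> words p m")
      case True
      then show ?thesis using assms(2) l(2) St_fix by blast
    next
      case False
      then have "sec g ?u = 0" using sec_outside_words[of g ?u] assms(1) St_G[of m] l(1) by auto
      then show ?thesis by simp
    qed
    moreover have "app g ?u = ?u" using assms(1) l(1) by (rule St_fix)
    ultimately have "app g (?u @ ?v) = ?u @ ?v" by (simp only: app_append)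
    then show ?thesis by simp
  qed
  then show ?thesis using assms(1) by (simp add: St_def)
qed

section \<open>Vanishing of the exponent sums\<close>

lemma coprime_mult_bij:
  assumes "\<not> p dvd s"
  shows "bij_betw (\<lambda>k. (x + k * s) mod p) {0..<p} {0..<p}"
proof -
  have "inj_on (\<lambda>k. (x + k * s) mod p) {0..<p}"
  proof (rule inj_onI)
    fix k l assume *: "k \<in> {0..<p}" "l \<in> {0..<p}" "(x + k * s) mod p = (x + l * s) mod p"
    then have "p dvd (k - l) * s" by (simp add: mod_eq_dvd_iff algebra_simps)
    then have "p dvd k - l" using assms prime_p by (simp add: prime_dvd_mult_iff)
    then show "k = l" using *(1,2) by (metis atLeastLessThan_iff mod_eq_dvd_iff mod_pos_pos_trivial)
  qed
  moreover have "(\<lambda>k. (x + k * s) mod p) ` {0..<p} \<subseteq> {0..<p}" using p_pos by auto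
  ultimately show ?thesis by (simp add: bij_betw_def endo_inj_surj)
qed

text \<open>If the exponent sum \<open>s\<close> of \<open>\<xi>\<close> were nonzero, the \<open>p\<close>-th power of \<open>g = b \<xi> + a s\<close> would
  have \<open>g\<close> itself as a section, so \<open>g\<close> would have infinite order.\<close>

lemma E_sum_zero:
  assumes \<xi>: "\<xi> \<in> E"
  shows "p dvd (\<Sum>d\<in>{1..<p}. \<xi> d)"
proof (rule ccontr)
  define s where "s = (\<Sum>d\<in>{1..<p}. \<xi> d)"
  assume "\<not> p dvd (\<Sum>d\<in>{1..<p}. \<xi> d)"
  then have s: "\<not> p dvd s" by (simp add: s_def)
  define g where "g = b \<xi> + a s"
  have gG: "g \<in> G" unfolding g_def by (intro subgrp_add G a_G b_G \<xi>)
  have app_g: "app g [x] = [(x + s) mod p]" if "x \<in> X" for x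
    using that by (simp add: g_def app_a)
  have sec_g: "sec g [x] = sec (b \<xi>) [x]" for x by (simp add: g_def sec_add)
  have app_n: "app (nmul n g) [x] = [(x + int n * s) mod p]" if "x \<in> X" for n x
    using that
  proof (induction n arbitrary: x)
    case (Suc n)
    have "(x + s) mod p \<in> X" using p_pos by simp
    from Suc.IH[OF this] Suc.prems show ?case by (simp add: app_g mod_simps algebra_simps)
  qed simp
  \<comment> \<open>The letters visited are the multiples of \<open>s\<close> with factors from
    \<open>m\<close> to \<open>m + j - 1\<close>, all strictly between \<open>0\<close> and
    \<open>p\<close>; the letter \<open>0\<close> is never met, so every step contributes a
    rotation.\<close>
  have sec_n: "sec (nmul j g) [(int m * s) mod p] = a (\<Sum>i\<in>{m..<m + j}. \<xi> ((int i * s) mod p))"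
    if "m > 0" "m + j \<le> nat p" for m j
    using that
  proof (induction j arbitrary: m)
    case (Suc j)
    let ?x = "(int m * s) mod p"
    have x: "?x \<in> X" using p_pos by simp
    have "\<not> p dvd int m" using Suc.prems zdvd_imp_le[of p "int m"] by auto
    then have x0: "?x \<noteq> 0" using s prime_p by (auto simp: mod_eq_0_iff_dvd prime_dvd_mult_iff)
    have "(?x + s) mod p = (int (Suc m) * s) mod p" by (simp add: mod_simps algebra_simps)
    then have "sec (nmul (Suc j) g) [?x] = a (\<xi> ?x) + sec (nmul j g) [(int (Suc m) * s) mod p]"
      using x x0 by (simp add: sec_add sec_g sec_b app_g)
    also have "\<dots> = a (\<xi> ?x + (\<Sum>i\<in>{Suc m..<Suc m + j}. \<xi> ((int i * s) mod p)))"
      using Suc.IH[of "Suc m"] Suc.prems by (simp add: a_add)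
    also have "\<xi> ?x + (\<Sum>i\<in>{Suc m..<Suc m + j}. \<xi> ((int i * s) mod p)) = (\<Sum>i\<in>{m..<m + Suc j}. \<xi> ((int i * s) mod p))"
      by (subst (2) sum.atLeast_Suc_lessThan) auto
    finally show ?case .
  qed simp
  have "(\<Sum>i\<in>{1..<nat p}. \<xi> ((int i * s) mod p)) = s"
  proof -
    have bij: "bij_betw (\<lambda>k. (0 + k * s) mod p) {0..<p} {0..<p}" by (rule coprime_mult_bij[OF s])
    have "bij_betw (\<lambda>k. (0 + k * s) mod p) ({0..<p} - {0}) ({0..<p} - {0})"
      using bij p_pos by (intro bij_betw_DiffI) (auto simp: bij_betw_def)
    moreover have "{0..<p} - {0} = {1..<p}" by auto
    ultimately have "bij_betw (\<lambda>k. (k * s) mod p) {1..<p} {1..<p}" by simp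
    then have "(\<Sum>k\<in>{1..<p}. \<xi> ((k * s) mod p)) = s" unfolding s_def by (rule sum.reindex_bij_betw)
    moreover have "(\<Sum>i\<in>{1..<nat p}. \<xi> ((int i * s) mod p)) = (\<Sum>k\<in>{1..<p}. \<xi> ((k * s) mod p))"
      by (rule sum.reindex_bij_witness[where i = nat and j = int]) auto
    ultimately show ?thesis by simp
  qed
  define P where "P = nat p"
  have P: "P > 1" "int P = p" using p_gt1 by (auto simp: P_def)
  \<comment> \<open>From the letter \<open>0\<close> the first step contributes
    \<open>b \<xi>\<close>; the remaining \<open>p - 1\<close> steps visit every nonzero letter once
    and contribute \<open>a s\<close>.\<close>
  have sec_P: "sec (nmul P g) [0] = g"
  proof -
    obtain Q where Q: "P = Suc Q" using P by (cases P) auto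
    have "sec (nmul P g) [0] = b \<xi> + sec (nmul Q g) [(int 1 * s) mod p]"
      using p_pos by (simp add: Q sec_add sec_g sec_b app_g)
    also have "sec (nmul Q g) [(int 1 * s) mod p] = a (\<Sum>i\<in>{1..<1 + Q}. \<xi> ((int i * s) mod p))"
      using Q by (intro sec_n) (auto simp: P_def)
    also have "(\<Sum>i\<in>{1..<1 + Q}. \<xi> ((int i * s) mod p)) = s"
      using \<open>(\<Sum>i\<in>{1..<nat p}. \<xi> ((int i * s) mod p)) = s\<close> Q by (simp add: P_def)
    finally show ?thesis by (simp add: g_def)
  qed
  have app_P: "app (nmul P g) [0] = [0]" using app_n[of 0 P] p_pos P by simp
  have sec_mult: "sec (nmul n (nmul P g)) [0] = nmul n g" for n
    by (induction n) (simp_all add: sec_add app_P sec_P)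
  \<comment> \<open>Descent on the order: \<open>p\<close> divides \<open>n\<close> because
    \<open>g\<close> shifts the first level by \<open>s\<close>, and the section at \<open>0\<close>
    shows that \<open>n\<close> divided by \<open>p\<close> already annihilates
    \<open>g\<close>.\<close>
  define n where "n = (LEAST n. n > 0 \<and> nmul n g = 0)"
  have "\<exists>n>0. nmul n g = 0" using torsion gG by (auto simp: torsion_on_def)
  then have "n > 0 \<and> nmul n g = 0" unfolding n_def by (rule LeastI_ex)
  then have n: "n > 0" "nmul n g = 0" by simp_all
  have "(int n * s) mod p = 0" using app_n[of 0 n] n(2) p_pos by simp
  then have "p dvd int n" using s prime_p by (auto simp: mod_eq_0_iff_dvd prime_dvd_mult_iff)
  then have "P dvd n" using P(2) by (metis int_dvd_int_iff)
  then obtain m where m: "n = m * P" by (metis dvdE mult.commute)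
  then have "nmul m g = 0" using sec_mult[of m] n(2) by (simp add: nmul_mult)
  moreover have "m > 0" "m < n" using m n(1) P(1) by auto
  moreover have "\<not> (m > 0 \<and> nmul m g = 0)" using \<open>m < n\<close> unfolding n_def by (rule not_less_Least)
  ultimately show False by simp
qed

end

context spinal
begin

section \<open>Full sections of the derived subgroups\<close>

definition nonzero :: "(int \<Rightarrow> int) \<Rightarrow> bool" where
  "nonzero \<xi> \<longleftrightarrow> (\<exists>d\<in>{1..<p}. \<not> p dvd \<xi> d)"

text \<open>A single nonzero entry would equal the exponent sum modulo \<open>p\<close>.\<close>

lemma nonzero_two:
  assumes "\<xi> \<in> E" "nonzero \<xi>"
  obtains d d' where "d \<in> {1..<p}" "d' \<in> {1..<p}" "d \<noteq> d'" "\<not> p dvd \<xi> d" "\<not> p dvd \<xi> d'"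
proof -
  obtain d where d: "d \<in> {1..<p}" "\<not> p dvd \<xi> d" using assms(2) by (auto simp: nonzero_def)
  have "\<exists>d'\<in>{1..<p} - {d}. \<not> p dvd \<xi> d'"
  proof (rule ccontr)
    assume "\<not> (\<exists>d'\<in>{1..<p} - {d}. \<not> p dvd \<xi> d')"
    then have "p dvd (\<Sum>d'\<in>{1..<p} - {d}. \<xi> d')" by (intro dvd_sum) auto
    moreover have "(\<Sum>d'\<in>{1..<p}. \<xi> d') = \<xi> d + (\<Sum>d'\<in>{1..<p} - {d}. \<xi> d')"
      using d(1) by (intro sum.remove) auto
    ultimately have "p dvd \<xi> d" using E_sum_zero[OF assms(1)] by (metis dvd_add_left_iff)
    then show False using d(2) by blast
  qed
  then show ?thesis using d that by blast
qed

text \<open>A constant vector with entry \<open>c\<close> has exponent sum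
  \<open>(p - 1) * c\<close>, which is congruent to \<open>- c\<close>.\<close>

lemma nonzero_nonconst:
  assumes "\<xi> \<in> E" "nonzero \<xi>"
  obtains d d' where "d \<in> {1..<p}" "d' \<in> {1..<p}" "\<not> p dvd \<xi> d - \<xi> d'"
proof -
  obtain d where d: "d \<in> {1..<p}" "\<not> p dvd \<xi> d" using assms(2) by (auto simp: nonzero_def)
  have "\<exists>d'\<in>{1..<p}. \<not> p dvd \<xi> d - \<xi> d'"
  proof (rule ccontr)
    assume "\<not> (\<exists>d'\<in>{1..<p}. \<not> p dvd \<xi> d - \<xi> d')"
    then have "p dvd (\<Sum>d'\<in>{1..<p}. \<xi> d - \<xi> d')" by (intro dvd_sum) auto
    then have "p dvd (p - 1) * \<xi> d - (\<Sum>d'\<in>{1..<p}. \<xi> d')"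
      using p_gt1 by (simp add: sum_subtractf)
    then have "p dvd (p - 1) * \<xi> d" using E_sum_zero[OF assms(1)] by (metis dvd_diff_left_iff)
    then have "p dvd p * \<xi> d - (p - 1) * \<xi> d" by (intro dvd_diff) auto
    then show False using d(2) by (simp add: algebra_simps)
  qed
  then show ?thesis using d that by blast
qed

lemma E_witness: obtains \<xi> where "\<xi> \<in> E" "nonzero \<xi>"
  using E_nonzero by (auto simp: nonzero_def)

lemma sec_cb_dir: "x \<in> X \<Longrightarrow> sec (cb x \<xi>) [x] = b \<xi>"
  by (simp add: sec_cb)

lemma sec_cb_rot: "x \<in> X \<Longrightarrow> d \<in> {1..<p} \<Longrightarrow> sec (cb (x - d) \<xi>) [x] = a (\<xi> d)"
  by (simp add: sec_cb)

lemma hom_on_sec_letter: "hom_on (St 1) (\<lambda>g. sec g [x])"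
  by (rule hom_on_sec) simp

text \<open>The conjugate \<open>cb t \<xi>\<close> has section \<open>b \<xi>\<close> at the letter
  \<open>t\<close> and \<open>a (\<xi> d)\<close> at the letter \<open>t + d\<close>, modulo
  \<open>p\<close>; varying \<open>t\<close> brings every generator to \<open>x\<close>.\<close>

lemma sec_St_full:
  assumes "x \<in> X"
  shows "(\<lambda>g. sec g [x]) ` St 1 = G"
proof
  show "(\<lambda>g. sec g [x]) ` St 1 \<subseteq> G" using St_G sec_G by blast
  have s: "subgrp ((\<lambda>g. sec g [x]) ` St 1)" by (rule subgrp_image[OF hom_on_sec_letter subgrp_St])
  show "G \<subseteq> (\<lambda>g. sec g [x]) ` St 1"
  proof (rule G_least[OF s])
    obtain \<xi> d where e: "\<xi> \<in> E" "d \<in> {1..<p}" "\<not> p dvd \<xi> d"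
      using E_nonzero by blast
    have "a (\<xi> d) \<in> (\<lambda>g. sec g [x]) ` St 1"
      by (rule image_eqI[OF _ cb_St[OF e(1)]]) (rule sec_cb_rot[OF assms e(2), symmetric])
    then show "a 1 \<in> (\<lambda>g. sec g [x]) ` St 1" by (rule a_unit_mem[OF s _ e(3)])
    show "b \<xi> \<in> (\<lambda>g. sec g [x]) ` St 1" if "\<xi> \<in> E" for \<xi>
      by (rule image_eqI[OF _ cb_St[OF that]]) (rule sec_cb_dir[OF assms, symmetric])
  qed
qed

text \<open>\<open>G\<close> acts on the first level through cyclic shifts, which commute.\<close>

lemma der_St: "der G \<subseteq> St 1"
proof (rule der_least[OF subgrp_St])
  fix g h assume gh: "g \<in> G" "h \<in> G"
  have comm: "app (g + h) [z] = app (h + g) [z]" for z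
  proof (cases "z \<in> X")
    case True
    obtain k where k: "\<forall>x\<in>X. app g [x] = [(x + k) mod p]" using G_shift[OF gh(1)] by blast
    obtain l where l: "\<forall>x\<in>X. app h [x] = [(x + l) mod p]" using G_shift[OF gh(2)] by blast
    show ?thesis using k l True p_pos by (simp add: mod_simps algebra_simps)
  next
    case False
    then show ?thesis using gh by (simp add: G_outside)
  qed
  show "commutator g h \<in> St 1"
  proof (rule St_1I)
    show "commutator g h \<in> G" by (rule commutator_in[OF G gh])
    fix x
    define w where "w = app (- (h + g)) [x]"
    have "length w = 1" unfolding w_def by (simp only: length_app) simp
    then obtain z where "w = [z]" by (cases w) auto
    then have z: "app (- (h + g)) [x] = [z]" by (simp only: w_def)
    have "commutator g h = - (h + g) + (g + h)" by (simp only: commutator_def grp_simps)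
    then have "app (commutator g h) [x] = app (g + h) [z]" using z by (simp only: app_add)
    also have "\<dots> = app (h + g) (app (- (h + g)) [x])" by (simp only: comm z)
    also have "\<dots> = [x]" by (rule app_app_uminus)
    finally show "app (commutator g h) [x] = [x]" .
  qed
qed

lemma cb_diff_der: "\<xi> \<in> E \<Longrightarrow> - cb s \<xi> + cb t \<xi> \<in> der G"
proof -
  assume e: "\<xi> \<in> E"
  have "commutator (b \<xi>) (a r) \<in> der G" for r by (intro commutator_der b_G a_G e)
  moreover have "- cb s \<xi> + cb t \<xi> = - commutator (b \<xi>) (a s) + commutator (b \<xi>) (a t)"
    by (simp only: cb_def commutator_def grp_simps)
  ultimately show ?thesis using subgrp_add[OF subgrp_der] subgrp_uminus[OF subgrp_der] by metis
qed

text \<open>The differences \<open>- cb s \<xi> + cb t \<xi>\<close> lie in the derived subgroup. At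
  \<open>x\<close> a nonconstant vector gives a nontrivial rotation in this way; the difference of a
  rooted and a directed section then yields every \<open>b \<zeta>\<close>.\<close>

lemma sec_der_full:
  assumes x: "x \<in> X"
  shows "(\<lambda>g. sec g [x]) ` der G = G"
proof
  show "(\<lambda>g. sec g [x]) ` der G \<subseteq> G" using der_subset[OF G] sec_G by blast
  let ?I = "(\<lambda>g. sec g [x]) ` der G"
  have s: "subgrp ?I"
    by (rule subgrp_image[OF hom_on_subset[OF hom_on_sec_letter der_St] subgrp_der])
  have sec_eq: "sec (- cb s \<xi> + cb t \<xi>) [x] = - sec (cb s \<xi>) [x] + sec (cb t \<xi>) [x]" for s t \<xi>
    by (simp add: sec_add sec_uminus_fix app_uminus_fix)
  have mem: "- sec (cb s \<xi>) [x] + sec (cb t \<xi>) [x] \<in> ?I" if "\<xi> \<in> E" for s t \<xi>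
    unfolding sec_eq[symmetric] by (rule imageI[OF cb_diff_der[OF that]])
  show "G \<subseteq> ?I"
  proof (rule G_least[OF s])
    obtain \<xi> where e: "\<xi> \<in> E" "nonzero \<xi>" by (rule E_witness)
    obtain d d' where d: "d \<in> {1..<p}" "d' \<in> {1..<p}" "\<not> p dvd \<xi> d - \<xi> d'"
      by (rule nonzero_nonconst[OF e])
    have "- a (\<xi> d') + a (\<xi> d) \<in> ?I"
      using mem[OF e(1), of "x - d'" "x - d"] by (simp only: sec_cb_rot[OF x] d)
    then have "a (\<xi> d - \<xi> d') \<in> ?I" by (simp add: a_add[symmetric] a_uminus[symmetric])
    then show a1: "a 1 \<in> ?I" by (rule a_unit_mem[OF s _ d(3)])
    show "b \<zeta> \<in> ?I" if z: "\<zeta> \<in> E" for \<zeta>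
    proof -
      have "a (\<zeta> d) \<in> ?I" using a_mult_mem[OF s a1, of "\<zeta> d"] by simp
      moreover have "- a (\<zeta> d) + b \<zeta> \<in> ?I"
        using mem[OF z, of "x - d" x] by (simp only: sec_cb_rot[OF x d(1)] sec_cb_dir[OF x])
      ultimately have "a (\<zeta> d) + (- a (\<zeta> d) + b \<zeta>) \<in> ?I" by (rule subgrp_add[OF s])
      then show ?thesis by simp
    qed
  qed
qed

text \<open>Sections map \<open>der G\<close> onto \<open>G\<close>, and homomorphic images commute
  with derived subgroups; so descending one level costs one derived step.\<close>

lemma sec_letter_dser:
  assumes x: "x \<in> X"
  shows "(\<lambda>g. sec g [x]) ` dser (Suc k) G = dser k G"
proof -
  have "(\<lambda>g. sec g [x]) ` dser k (der G) = dser k ((\<lambda>g. sec g [x]) ` der G)"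
    by (rule image_dser[OF hom_on_subset[OF hom_on_sec_letter der_St] subgrp_der])
  moreover have "dser k (der G) = dser (Suc k) G" using dser_add[of k 1 G] by simp
  ultimately show ?thesis using sec_der_full[OF x] by simp
qed

lemma dser_St: "dser n G \<subseteq> St n"
proof (induction n)
  case 0
  then show ?case by (auto simp: St_def)
next
  case (Suc n)
  show ?case
  proof
    fix g assume g: "g \<in> dser (Suc n) G"
    have "dser (Suc n) G \<subseteq> der G" using dser_antimono[OF G, of 1 "Suc n"] by simp
    then have "g \<in> St 1" using g der_St by blast
    moreover have "sec g u \<in> St n" if u: "u \<in> words p 1" for u
    proof -
      obtain x where x: "u = [x]" "x \<in> X" using u words_Suc[of u p 0] by auto
      then show ?thesis using sec_letter_dser[OF x(2), of n] g Suc by blast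
    qed
    ultimately have "g \<in> St (1 + n)" by (rule St_sec_St)
    then show "g \<in> St (Suc n)" by simp
  qed
qed

lemma sec_dser: "u \<in> words p n \<Longrightarrow> (\<lambda>g. sec g u) ` dser (n + k) G = dser k G"
proof (induction n arbitrary: u)
  case (Suc n)
  then obtain x v where u: "u = x # v" "x \<in> X" "v \<in> words p n" by (auto simp: words_Suc)
  have "(\<lambda>g. sec g u) ` dser (Suc n + k) G = (\<lambda>g. sec g v) ` (\<lambda>g. sec g [x]) ` dser (Suc (n + k)) G"
    using sec_append[of _ "[x]" v] u(1) by (simp add: image_image del: dser_Suc)
  also have "\<dots> = dser k G" unfolding sec_letter_dser[OF u(2)] by (rule Suc.IH[OF u(3)])
  finally show ?case .
qed simp

section \<open>Copies of derived subgroups below a vertex\<close>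

text \<open>The elements of \<open>St 1\<close> supported on two letters \<open>x\<close>, \<open>y\<close> already have the derived subgroup
  among their sections at \<open>x\<close>; two choices of \<open>y\<close> leave commutators supported on \<open>x\<close> alone.\<close>

definition pair_supp :: "int \<Rightarrow> int \<Rightarrow> taut set" where
  "pair_supp x y = {g \<in> St 1. \<forall>z. z \<notin> {x, y} \<longrightarrow> sec g [z] = 0}"

lemma subgrp_pair_supp: "subgrp (pair_supp x y)"
proof (rule subgrpI)
  show "0 \<in> pair_supp x y" unfolding pair_supp_def by (simp add: subgrp_zero[OF subgrp_St])
  fix g h assume "g \<in> pair_supp x y" "h \<in> pair_supp x y"
  then show "g - h \<in> pair_supp x y" unfolding pair_supp_def
    using subgrp_diff[OF subgrp_St] hom_on_diff[OF hom_on_sec_letter subgrp_St] by auto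
qed

text \<open>The conjugates of \<open>b \<xi>\<close> and \<open>b \<zeta>\<close> directed at
  \<open>y\<close> and \<open>x\<close> both have rooted sections at every other letter of
  \<open>X\<close>, so their commutator is supported on \<open>{x, y}\<close>. At \<open>x\<close>
  it is the commutator of \<open>a (\<xi> d)\<close> and \<open>b \<zeta>\<close>; as
  \<open>\<xi> d\<close> is invertible, these generate the derived subgroup as a normal
  subgroup.\<close>

lemma der_pair_supp:
  assumes x: "x \<in> X" and e: "\<xi> \<in> E" and d: "d \<in> {1..<p}" "\<not> p dvd \<xi> d"
  shows "der G \<subseteq> (\<lambda>g. sec g [x]) ` pair_supp x ((x - d) mod p)"
proof -
  define y where "y = (x - d) mod p"
  let ?N = "(\<lambda>g. sec g [x]) ` pair_supp x y"
  have y: "cb (x - d) \<zeta> = cb y \<zeta>" for \<zeta> by (rule cb_cong) (simp add: y_def)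
  have N: "normal_in ?N G"
  proof (rule normal_in_image_section[OF subgrp_St sec_St_full[OF x, symmetric] hom_on_sec_letter])
    show "subgrp (pair_supp x y)" by (rule subgrp_pair_supp)
    show "pair_supp x y \<subseteq> St 1" by (auto simp: pair_supp_def)
    fix g c assume "g \<in> St 1" "c \<in> pair_supp x y"
    then show "- g + c + g \<in> pair_supp x y"
      using subgrp_conj[OF subgrp_St] hom_on_conj[OF hom_on_sec_letter subgrp_St]
      by (auto simp: pair_supp_def)
  qed
  have ba: "commutator (a 1) (b \<zeta>) \<in> ?N" if z: "\<zeta> \<in> E" for \<zeta>
  proof -
    let ?c = "commutator (cb y \<xi>) (cb x \<zeta>)"
    have c: "?c \<in> St 1" by (intro commutator_in subgrp_St cb_St e z)
    have sc: "sec ?c [w] = commutator (sec (cb y \<xi>) [w]) (sec (cb x \<zeta>) [w])" for w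
      by (rule hom_on_commutator[OF hom_on_sec_letter subgrp_St cb_St[OF e] cb_St[OF z]])
    have "sec ?c [w] = 0" if w: "w \<notin> {x, y}" for w
    proof (cases "w \<in> X")
      case True
      have yX: "y \<in> X" using p_pos by (simp add: y_def)
      have "(w - y) mod p \<noteq> 0" "(w - x) mod p \<noteq> 0"
        using w True yX x by (auto simp: mod_eq_0_iff_dvd mod_eq_dvd_iff[symmetric])
      then show ?thesis unfolding sc using True by (simp add: sec_cb commutator_eq_0_iff a_comm)
    next
      case False
      then show ?thesis unfolding sc by (simp add: sec_cb_outside)
    qed
    then have "?c \<in> pair_supp x y" using c by (auto simp: pair_supp_def)
    moreover have "sec ?c [x] = commutator (a (\<xi> d)) (b \<zeta>)"
      using sc[of x] sec_cb_dir[OF x, of \<zeta>] sec_cb_rot[OF x d(1), of \<xi>] y[of \<xi>] by simp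
    ultimately have "commutator (a (\<xi> d)) (b \<zeta>) \<in> ?N" by (metis image_eqI)
    then have "a (\<xi> d) \<in> {g \<in> G. commutator g (b \<zeta>) \<in> ?N}" by (simp add: a_G)
    then have "a 1 \<in> {g \<in> G. commutator g (b \<zeta>) \<in> ?N}"
      by (rule a_unit_mem[OF commutator_mod_subgrp[OF N G b_G[OF z]] _ d(2)])
    then show ?thesis by simp
  qed
  have ab: "commutator (b \<zeta>) (a 1) \<in> ?N" if z: "\<zeta> \<in> E" for \<zeta>
    using subgrp_uminus[OF normal_in_subgrp[OF N] ba[OF z]] by (simp add: uminus_commutator)
  have bb: "commutator (b \<zeta>) (b \<zeta>') = 0" for \<zeta> \<zeta>'
    by (simp add: commutator_eq_0_iff b_comm)
  have "der G \<subseteq> ?N"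
    unfolding spinal_group_def
  proof (rule der_gen_subset)
    show "normal_in ?N (gen (insert (a 1) (b ` E)))" using N by (simp add: spinal_group_def)
    show "commutator g h \<in> ?N" if "g \<in> insert (a 1) (b ` E)" "h \<in> insert (a 1) (b ` E)" for g h
      using that ba ab bb subgrp_zero[OF normal_in_subgrp[OF N]] by auto
  qed
  then show ?thesis by (simp add: y_def)
qed

text \<open>Two nonzero entries give two different second letters. Supports \<open>{x, y}\<close>
  and \<open>{x, y'}\<close> meet in \<open>x\<close> only, so commutators of such elements live at
  \<open>x\<close> alone and realise there all commutators of elements of \<open>der G\<close>.
  Hence the second derived subgroup.\<close>

lemma at_letter_G:
  assumes x: "x \<in> X" and k: "k \<in> dser 2 G"
  shows "at_vertex [x] k \<in> G"
proof -
  obtain \<xi> where e: "\<xi> \<in> E" "nonzero \<xi>" by (rule E_witness)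
  obtain d d' where d: "d \<in> {1..<p}" "d' \<in> {1..<p}" "d \<noteq> d'" "\<not> p dvd \<xi> d" "\<not> p dvd \<xi> d'"
    by (rule nonzero_two[OF e])
  define y y' where "y = (x - d) mod p" and "y' = (x - d') mod p"
  have yy: "y \<noteq> y'"
  proof
    assume "y = y'"
    then have "p dvd (x - d) - (x - d')" unfolding y_def y'_def by (simp add: mod_eq_dvd_iff)
    then have "d' mod p = d mod p" by (simp add: mod_eq_dvd_iff)
    then show False using d by simp
  qed
  have "subgrp {k \<in> UNIV. at_vertex [x] k \<in> G}"
    by (rule subgrp_preimage[OF hom_on_at_vertex _ G]) (simp add: subgrp_def)
  moreover have "commutator k l \<in> {k \<in> UNIV. at_vertex [x] k \<in> G}" if kl: "k \<in> der G" "l \<in> der G" for k l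
  proof -
    obtain g where g: "g \<in> pair_supp x y" "k = sec g [x]"
      using subsetD[OF der_pair_supp[OF x e(1) d(1,4)] kl(1)] by (auto simp: y_def)
    obtain h where h: "h \<in> pair_supp x y'" "l = sec h [x]"
      using subsetD[OF der_pair_supp[OF x e(1) d(2,5)] kl(2)] by (auto simp: y'_def)
    have gh: "g \<in> St 1" "h \<in> St 1" using g h by (auto simp: pair_supp_def)
    note cSt = commutator_in[OF subgrp_St gh]
    have "commutator g h = at_vertex [x] (commutator k l)"
    proof (rule at_vertex_eqI)
      fix u :: "int list" assume "length u = length [x]"
      then obtain z where u: "u = [z]" by (auto simp: length_Suc_conv)
      show "app (commutator g h) u = u" using St_1_letter[OF cSt] u by simp
      have "sec (commutator g h) [z] = commutator (sec g [z]) (sec h [z])"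
        by (rule hom_on_commutator[OF hom_on_sec_letter subgrp_St gh])
      moreover have "sec g [z] = 0 \<or> sec h [z] = 0" if "z \<noteq> x"
        using that g(1) h(1) yy by (auto simp: pair_supp_def)
      ultimately show "sec (commutator g h) u = (if u = [x] then commutator k l else 0)"
        using g(2) h(2) u by auto
    qed
    then show ?thesis using cSt St_G by auto
  qed
  ultimately have "der (der G) \<subseteq> {k \<in> UNIV. at_vertex [x] k \<in> G}" by (rule der_least)
  moreover have "dser 2 G = der (der G)" by (simp add: numeral_2_eq_2)
  ultimately show ?thesis using k by auto
qed

text \<open>Each level costs two derived steps: copies of \<open>dser (2 * n) G\<close> below
  \<open>v\<close> lie in \<open>G\<close>, so copies of its second derived subgroup lie in
  \<open>dser 2 G\<close>, and the one-letter case applies to them.\<close>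

lemma at_vertex_G: "u \<in> words p n \<Longrightarrow> k \<in> dser (2 * n) G \<Longrightarrow> at_vertex u k \<in> G"
proof (induction n arbitrary: u k)
  case (Suc n)
  then obtain x v where u: "u = x # v" "x \<in> X" "v \<in> words p n" by (auto simp: words_Suc)
  have "at_vertex v ` dser 2 (dser (2 * n) G) = dser 2 (at_vertex v ` dser (2 * n) G)"
    by (rule image_dser[OF hom_on_at_vertex subgrp_dser[OF G]])
  also have "\<dots> \<subseteq> dser 2 G" using Suc.IH[OF u(3)] by (intro dser_mono) auto
  finally have "at_vertex v ` dser 2 (dser (2 * n) G) \<subseteq> dser 2 G" .
  moreover have "dser 2 (dser (2 * n) G) = dser (2 * Suc n) G" by (simp add: dser_add[symmetric] del: dser_Suc)
  ultimately have "at_vertex v k \<in> dser 2 G" using Suc.prems(2) by blast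
  then have "at_vertex [x] (at_vertex v k) \<in> G" by (rule at_letter_G[OF u(2)])
  then show ?case using u(1) at_vertex_Cons[of x v k] by simp
qed simp

section \<open>Normal subgroups and just-infiniteness\<close>

lemma transitive: "u \<in> words p n \<Longrightarrow> v \<in> words p n \<Longrightarrow> \<exists>g\<in>G. app g u = v"
proof (induction n arbitrary: u v)
  case 0
  then show ?case using subgrp_zero[OF G] by force
next
  case (Suc n)
  then obtain x u' y v' where u: "u = x # u'" "x \<in> X" "u' \<in> words p n"
    and v: "v = y # v'" "y \<in> X" "v' \<in> words p n" by (auto simp: words_Suc)
  obtain g where g: "g \<in> G" "app g u' = v'" using Suc.IH u v by blast
  then obtain h where h: "h \<in> St 1" "g = sec h [x]" using sec_St_full[OF u(2)] by blast
  have "app (h + a (y - x)) u = v"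
    using u v g h St_1_letter[OF h(1)] app_Cons[of h x u'] app_Cons[of "a (y - x)" x v']
    by (simp add: app_a)
  moreover have "h + a (y - x) \<in> G" using h St_G by (intro subgrp_add G a_G) blast
  ultimately show ?case by blast
qed

text \<open>Let \<open>g\<close> in \<open>L\<close> move \<open>v\<close>. For \<open>H\<close> and
  \<open>K\<close> supported below \<open>v\<close>, the iterated commutator of \<open>g\<close>,
  \<open>H\<close>, \<open>K\<close> lies in \<open>L\<close> and equals
  \<open>commutator H K\<close>, as the conjugate of \<open>H\<close> by \<open>g\<close> has
  disjoint support and commutes with \<open>K\<close>. This is the one derived step beyond the
  \<open>2 * n\<close> that place \<open>H\<close> and \<open>K\<close> in \<open>G\<close>;
  transitivity spreads the copies over the level.\<close>

lemma normal_contains_copies: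
  assumes L: "normal_in L G" "L \<noteq> {0}"
  obtains n where "\<And>v k. v \<in> words p n \<Longrightarrow> k \<in> dser (2 * n + 1) G \<Longrightarrow> at_vertex v k \<in> L"
proof -
  have Ls: "subgrp L" "L \<subseteq> G" using L(1) by (auto simp: normal_in_def)
  obtain g where g: "g \<in> L" "g \<noteq> 0" using L(2) subgrp_zero[OF Ls(1)] by blast
  obtain u where "app g u \<noteq> u" using g(2) taut_eqI[of g 0] by auto
  then obtain v where v: "v \<in> words p (length u)" "app g v \<noteq> v"
    using fix_words_imp[of g "length u" u] g(1) Ls(2) by blast
  define n where "n = length u"
  have lv: "length v = n" using v(1) by (simp add: words_def n_def)
  define w where "w = app g v"
  have w: "length w = length v" "w \<noteq> v" using v(2) by (simp_all add: w_def)
  have sub: "subgrp {k \<in> UNIV. at_vertex v k \<in> L}"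
    by (rule subgrp_preimage[OF hom_on_at_vertex _ Ls(1)]) (simp add: subgrp_def)
  have "der (dser (2 * n) G) \<subseteq> {k \<in> UNIV. at_vertex v k \<in> L}"
  proof (rule der_least[OF sub])
    fix h k assume hk: "h \<in> dser (2 * n) G" "k \<in> dser (2 * n) G"
    define H K where "H = at_vertex v h" and "K = at_vertex v k"
    have HK: "H \<in> G" "K \<in> G" unfolding H_def K_def using v(1) hk by (auto intro!: at_vertex_G simp: n_def)
    define m where "m = - sec g v + - h + sec g v"
    define c where "c = - g + - H + g + H"
    have c: "c = at_vertex w m + H"
      using conj_at_vertex[of g v "- h"] hom_on_uminus[OF hom_on_at_vertex, of UNIV h v]
      by (simp add: c_def H_def m_def w_def subgrp_def)
    have "c = - g + (- H + g + H)" by (simp only: c_def grp_simps)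
    then have "c \<in> L"
      using g(1) Ls HK by (simp only:) (intro subgrp_add subgrp_uminus normal_in_conj[OF L(1)])
    then have "- c + (- K + c + K) \<in> L"
      using Ls HK by (intro subgrp_add subgrp_uminus normal_in_conj[OF L(1)])
    moreover have "- c + (- K + c + K) = at_vertex v (commutator h k)"
    proof -
      let ?A = "at_vertex w m"
      have "?A + K = K + ?A" unfolding K_def by (rule commutator_at_vertex_disjoint[OF w])
      then have AK: "- K + ?A = ?A - K" by (metis add_diff_cancel minus_add_cancel add.assoc diff_conv_add_uminus)
      have "- c + (- K + c + K) = - H + - ?A + (- K + ?A) + H + K" unfolding c by (simp only: grp_simps)
      also have "\<dots> = commutator H K" unfolding AK by (simp only: commutator_def grp_simps)
      also have "\<dots> = at_vertex v (commutator h k)"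
        unfolding H_def K_def by (rule hom_on_commutator[OF hom_on_at_vertex, of UNIV, symmetric]) (auto simp: subgrp_def)
      finally show ?thesis .
    qed
    ultimately show "commutator h k \<in> {k \<in> UNIV. at_vertex v k \<in> L}" by simp
  qed
  then have base: "at_vertex v k \<in> L" if "k \<in> dser (2 * n + 1) G" for k using that by auto
  have "at_vertex v' k \<in> L" if v': "v' \<in> words p n" and k: "k \<in> dser (2 * n + 1) G" for v' k
  proof -
    obtain h where h: "h \<in> G" "app h v = v'" using transitive v(1) v' n_def by blast
    \<comment> \<open>Conjugation by \<open>h\<close> twists by its section at \<open>v\<close>; the
      twist is undone in advance, inside a normal subgroup of \<open>G\<close>.\<close>
    have "sec h v + k - sec h v \<in> dser (2 * n + 1) G"
      using h(1) k by (intro normal_in_conj'[OF G normal_in_dser[OF G]] sec_G)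
    then have "- h + at_vertex v (sec h v + k - sec h v) + h \<in> L"
      by (intro normal_in_conj[OF L(1) h(1)] base)
    moreover have "- h + at_vertex v (sec h v + k - sec h v) + h = at_vertex v' k"
      unfolding conj_at_vertex h(2) by (simp only: grp_simps)
    ultimately show ?thesis by simp
  qed
  then show ?thesis using that by blast
qed

lemma fin_idx_dser_G: "fin_idx (dser k G) G"
  by (rule fin_idx_dser[OF G fin_gen_G torsion])

text \<open>An element of \<open>St n\<close> whose sections all lie in
  \<open>dser (2 * n + 1) G\<close> is a finite sum of copies contained in \<open>L\<close>, and
  such elements form a subgroup of finite index because the terms of the derived series have finite
  index.\<close>

lemma just_infinite:
  assumes L: "normal_in L G" "L \<noteq> {0}"
  shows "fin_idx L G"
proof -
  have Ls: "subgrp L" "L \<subseteq> G" using L(1) by (auto simp: normal_in_def)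
  obtain n where n: "\<And>v k. v \<in> words p n \<Longrightarrow> k \<in> dser (2 * n + 1) G \<Longrightarrow> at_vertex v k \<in> L"
    using normal_contains_copies[OF L] by blast
  let ?W = "words p n"
  have len: "length v = n" if "v \<in> ?W" for v using that by (simp add: words_def)
  define Q where "Q = {g \<in> St n. \<forall>v\<in>?W. g \<in> {g \<in> St n. sec g v \<in> dser (2 * n + 1) G}}"
  have "fin_idx Q (St n)"
    unfolding Q_def
  proof (rule fin_idx_Inter[OF finite_words subgrp_St])
    fix v assume "v \<in> ?W"
    then show "fin_idx {g \<in> St n. sec g v \<in> dser (2 * n + 1) G} (St n)"
      using fin_idx_preimage[OF hom_on_sec[OF len] subgrp_St fin_idx_dser_G, of v] St_G sec_G by blast
  qed
  then have Q: "fin_idx Q G" using fin_idx_trans[OF _ fin_idx_St G] by blast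
  have "Q \<subseteq> L"
  proof
    fix g assume "g \<in> Q"
    then have g: "g \<in> St n" "\<And>v. v \<in> ?W \<Longrightarrow> sec g v \<in> dser (2 * n + 1) G" by (auto simp: Q_def)
    have "\<exists>l\<in>L. l \<in> St n \<and> (\<forall>u. length u = n \<longrightarrow> sec l u = (if u \<in> S then sec g u else 0))"
      if "finite S" "S \<subseteq> ?W" for S
      using that
    proof (induction S rule: finite_induct)
      case empty
      show ?case by (rule bexI[of _ 0]) (use subgrp_zero[OF Ls(1)] subgrp_zero[OF subgrp_St] in auto)
    next
      case (insert v S)
      then obtain l where l: "l \<in> L" "l \<in> St n"
        "\<forall>u. length u = n \<longrightarrow> sec l u = (if u \<in> S then sec g u else 0)" by auto
      let ?h = "at_vertex v (sec g v)"
      have v: "v \<in> ?W" "length v = n" using insert.prems len by auto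
      have h: "?h \<in> L" using n g(2) v by blast
      then have "?h \<in> St n" using Ls(2) v by (auto simp: St_def app_at_vertex)
      then have "l + ?h \<in> St n" using l(2) by (intro subgrp_add subgrp_St)
      moreover have "l + ?h \<in> L" using l(1) h by (intro subgrp_add Ls)
      moreover have "sec (l + ?h) u = (if u \<in> insert v S then sec g u else 0)" if "length u = n" for u
        using that l(3) insert.hyps v by (auto simp: sec_add St_fix[OF l(2)] sec_at_vertex)
      ultimately show ?case by blast
    qed
    from this[OF finite_words subset_refl] obtain l where l: "l \<in> L" "l \<in> St n"
      "\<forall>u. length u = n \<longrightarrow> sec l u = (if u \<in> ?W then sec g u else 0)" by blast
    have "l = g"
    proof (rule taut_eq_level[of n])
      fix u :: "int list" assume u: "length u = n"
      show "app l u = app g u" using St_fix[OF l(2) u] St_fix[OF g(1) u] by simp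
      show "sec l u = sec g u" using l(3) u sec_outside_words[of g u] g(1) St_G[of n] by auto
    qed
    then show "g \<in> L" using l(1) by simp
  qed
  then show ?thesis using fin_idx_mono[OF Q Ls(1) _ Ls(2)] by blast
qed

lemma residually_finite:
  assumes "k \<in> G" "k \<noteq> 0"
  shows "\<exists>W. normal_in W G \<and> fin_idx W G \<and> k \<notin> W"
proof -
  obtain u where "app k u \<noteq> u" using assms(2) taut_eqI[of k 0] by auto
  then have "k \<notin> St (length u)" by (auto simp: St_def)
  then show ?thesis using normal_in_St fin_idx_St by blast
qed

text \<open>No proper subgroup of a finite group maps onto the group, yet sections map the proper
  subgroup \<open>St 1\<close> onto \<open>G\<close>.\<close>

lemma infinite_G: "infinite G"
proof
  assume fin: "finite G"
  have "a 1 \<notin> St 1"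
  proof
    assume "a 1 \<in> St 1"
    then have "app (a 1) [0] = [0]" by (rule St_1_letter)
    then show False using p_gt1 by (simp add: app_a)
  qed
  then have "St 1 \<subset> G" using St_G a_G by blast
  then have "card (St 1) < card G" by (rule psubset_card_mono[OF fin])
  moreover have "card ((\<lambda>g. sec g [0]) ` St 1) \<le> card (St 1)"
    by (rule card_image_le[OF finite_subset[OF St_G fin]])
  ultimately show False using sec_St_full[of 0] p_pos by simp
qed

lemma not_fin_idx_0: "\<not> fin_idx {0} G"
proof
  assume "fin_idx {0} G"
  then obtain f :: "taut \<Rightarrow> taut set" where f: "finite (f ` G)" "\<forall>x\<in>G. \<forall>y\<in>G. f x = f y \<longrightarrow> x - y \<in> {0}"
    using fin_idx_colouring by blast
  then have "inj_on f G" by (auto intro!: inj_onI)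
  then show False using f(1) infinite_G finite_imageD by blast
qed

text \<open>If \<open>A\<close> and \<open>B\<close> commuted, their intersection would be abelian
  of finite index, hence finitely generated and torsion; its trivial derived subgroup would then
  have finite index in the infinite group \<open>G\<close>.\<close>

lemma normal_noncomm:
  assumes A: "normal_in A G" "A \<noteq> {0}" and B: "normal_in B G" "B \<noteq> {0}"
  shows "\<exists>x\<in>A. \<exists>y\<in>B. commutator x y \<noteq> 0"
proof (rule ccontr)
  assume *: "\<not> (\<exists>x\<in>A. \<exists>y\<in>B. commutator x y \<noteq> 0)"
  note Af = just_infinite[OF A] and Bf = just_infinite[OF B]
  have Bs: "subgrp B" "B \<subseteq> G" using B(1) by (auto simp: normal_in_def)
  have J: "fin_idx (A \<inter> B) G"
    using fin_idx_trans[OF fin_idx_Int_subgrp[OF Af Bs] Bf G] .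
  have Js: "subgrp (A \<inter> B)" by (rule fin_idx_subgrp[OF J])
  have "torsion_on (A \<inter> B)" using torsion Bs(2) by (auto simp: torsion_on_def)
  then have "fin_idx (der (A \<inter> B)) G"
    using fin_idx_trans[OF fin_idx_der[OF Js fin_gen_fin_idx[OF fin_gen_G J]] J G] by blast
  moreover have "der (A \<inter> B) = {0}"
  proof
    show "der (A \<inter> B) \<subseteq> {0}" by (rule der_least) (use * in \<open>auto simp: subgrp_def\<close>)
    show "{0} \<subseteq> der (A \<inter> B)" using subgrp_zero[OF subgrp_der] by blast
  qed
  ultimately show False using not_fin_idx_0 by simp
qed

end

section \<open>Dense subgroups\<close>

context spinal
begin

section \<open>Sections of proper dense subgroups\<close>

lemma dser_nonzero: "\<exists>k\<in>dser n G. k \<noteq> 0"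
proof (rule ccontr)
  assume "\<not> (\<exists>k\<in>dser n G. k \<noteq> 0)"
  then have "dser n G = {0}" using subgrp_zero[OF subgrp_dser[OF G]] by blast
  then show False using fin_idx_dser_G[of n] not_fin_idx_0 by simp
qed

text \<open>The product argument, with the sections at the words of one level as coordinates. They
  are jointly injective on \<open>St n\<close> because elements of \<open>G\<close> have trivial
  sections at all other words.\<close>

lemma full_dense_eq:
  assumes L: "subgrp L" "L \<subseteq> St n" and D: "dense_in D L"
    and full: "\<And>u. u \<in> words p n \<Longrightarrow> (\<lambda>g. sec g u) ` D = G"
    and copies: "\<And>u k. u \<in> words p n \<Longrightarrow> k \<in> dser m G \<Longrightarrow> at_vertex u k \<in> L"
  shows "D = L"
proof -
  obtain k where k: "k \<in> dser m G" "k \<noteq> 0" using dser_nonzero by blast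
  have len: "length u = n" if "u \<in> words p n" for u using that by (simp add: words_def)
  show ?thesis
  proof (rule subdirect_dense_eq[where I = "words p n" and \<phi> = "\<lambda>u g. sec g u" and G = G
        and K = "dser m G" and k = k])
    show "hom_on L (\<lambda>g. sec g u)" if "u \<in> words p n" for u
      using hom_on_subset[OF hom_on_sec[OF len[OF that]] L(2)] .
    show "(\<lambda>g. sec g u) ` L \<subseteq> G" for u using L(2) St_G sec_G by blast
    show "g = 0" if g: "g \<in> L" "\<And>u. u \<in> words p n \<Longrightarrow> sec g u = 0" for g
    proof (rule taut_eq_level[of n])
      fix u :: "int list" assume u: "length u = n"
      have gG: "g \<in> G" "g \<in> St n" using g(1) L(2) St_G by auto
      show "app g u = app 0 u" using St_fix[OF gG(2) u] by simp
      show "sec g u = sec 0 u" using g(2) sec_outside_words[OF gG(1), of u] u by auto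
    qed
    show "\<exists>g\<in>L. sec g u = k \<and> (\<forall>v\<in>words p n - {u}. sec g v = 0)"
      if u: "u \<in> words p n" "k \<in> dser m G" for u k
      by (rule bexI[of _ "at_vertex u k"]) (use u copies len in \<open>auto simp: sec_at_vertex\<close>)
  qed (use L D G full k dser_subset[OF G] finite_words just_infinite residually_finite normal_noncomm in auto)
qed

definition good :: "taut set \<Rightarrow> bool" where
  "good M \<longleftrightarrow> dense_in M G \<and> M \<noteq> G"

lemma good_subgrp: "good M \<Longrightarrow> subgrp M"
  and good_subset: "good M \<Longrightarrow> M \<subseteq> G"
  and good_dense: "good M \<Longrightarrow> dense_in M G"
  by (auto simp: good_def dense_in_def)

definition sect :: "int \<Rightarrow> taut set \<Rightarrow> taut set" where
  "sect x M = (\<lambda>g. sec g [x]) ` (M \<inter> St 1)"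

lemma sectI: "g \<in> M \<Longrightarrow> g \<in> St 1 \<Longrightarrow> sec g [x] \<in> sect x M"
  by (simp add: sect_def)

text \<open>\<open>St 1\<close> has finite index, so \<open>M\<close> induces the same permutations
  of the first level as \<open>G\<close>.\<close>

lemma dense_transitive:
  assumes M: "dense_in M G" and xy: "x \<in> X" "y \<in> X"
  shows "\<exists>m\<in>M. app m [x] = [y]"
proof -
  have "app (a (y - x)) [x] = [y]" using xy by (simp add: app_a)
  obtain m q where mq: "m \<in> M" "q \<in> St 1" "a (y - x) = m + q"
    using dense_in_decomp[OF M G fin_idx_St a_G] by blast
  have "app q (app m [x]) = [y]" using \<open>app (a (y - x)) [x] = [y]\<close> mq(3) by simp
  moreover have "app q (app m [x]) = app m [x]" using mq(2) by (intro St_fix[of q 1]) auto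
  ultimately show ?thesis using mq(1) by auto
qed

lemma sec_conj_fix:
  assumes "app m [y] = [x]" "h \<in> St 1"
  shows "sec (- m + h + m) [x] = - sec m [y] + sec h [y] + sec m [y]"
proof -
  have "app (- m) [x] = [y]" using assms(1) by (metis app_uminus_app)
  then show ?thesis using St_1_letter[OF assms(2), of y] by (simp add: sec_add sec_uminus)
qed

lemma conj_St: "h \<in> St 1 \<Longrightarrow> g \<in> G \<Longrightarrow> - g + h + g \<in> St 1"
  using normal_in_conj[OF normal_in_St] .

text \<open>For properness: if the section at \<open>x\<close> were full, conjugation by elements of
  \<open>M\<close> moving \<open>x\<close> to any other letter would make all sections full, so
  \<open>M\<close> would contain \<open>St 1\<close> and have finite index.\<close>

lemma good_sect:
  assumes M: "good M" and x: "x \<in> X"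
  shows "good (sect x M)"
  unfolding good_def
proof
  note d = dense_in_Int[OF good_dense[OF M] G fin_idx_St, of 1]
  show "dense_in (sect x M) G"
    using dense_in_image[OF d subgrp_St hom_on_sec_letter, of x] sec_St_full[OF x] by (simp add: sect_def)
  show "sect x M \<noteq> G"
  proof
    assume full: "sect x M = G"
    have "M \<inter> St 1 = St 1"
    proof (rule full_dense_eq[OF subgrp_St subset_refl d, of 2])
      fix u assume "u \<in> words p 1"
      then obtain y where y: "u = [y]" "y \<in> X" using words_Suc[of u p 0] by auto
      obtain m where m: "m \<in> M" "app m [x] = [y]" using dense_transitive[OF good_dense[OF M] x y(2)] by blast
      have mG: "m \<in> G" using m(1) good_subset[OF M] by blast
      show "(\<lambda>g. sec g u) ` (M \<inter> St 1) = G"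
      proof
        show "(\<lambda>g. sec g u) ` (M \<inter> St 1) \<subseteq> G" using St_G sec_G by blast
        show "G \<subseteq> (\<lambda>g. sec g u) ` (M \<inter> St 1)"
        proof
          fix g assume g: "g \<in> G"
          have "sec m [x] + g - sec m [x] \<in> G" using sec_G[OF mG] g G by (simp add: subgrp_add subgrp_diff)
          then have "sec m [x] + g - sec m [x] \<in> sect x M" by (simp only: full)
          then obtain h where h: "h \<in> M" "h \<in> St 1" "sec h [x] = sec m [x] + g - sec m [x]"
            unfolding sect_def by (elim imageE IntE) metis
          have "sec (- m + h + m) [y] = g" unfolding sec_conj_fix[OF m(2) h(2)] h(3) by (simp only: grp_simps)
          moreover have "- m + h + m \<in> M \<inter> St 1"
            using conj_St[OF h(2) mG] subgrp_conj[OF good_subgrp[OF M] h(1) m(1)] by blast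
          ultimately show "g \<in> (\<lambda>g. sec g u) ` (M \<inter> St 1)" unfolding y(1) by blast
        qed
      qed
    next
      show "at_vertex u k \<in> St 1" if u: "u \<in> words p 1" "k \<in> dser 2 G" for u k
        using at_vertex_G[of u 1 k] u by (auto simp: St_def app_at_vertex words_def)
    qed
    then have "M = G" using dense_in_fin_idx_eq[OF good_dense[OF M] fin_idx_St, of 1] by blast
    then show False using M by (simp add: good_def)
  qed
qed

definition conj_by :: "taut \<Rightarrow> taut set \<Rightarrow> taut set" where
  "conj_by g M = (\<lambda>m. - g + m + g) ` M"

lemma conj_byI: "m \<in> M \<Longrightarrow> - g + m + g \<in> conj_by g M"
  by (simp add: conj_by_def)

lemma good_conj_by:
  assumes M: "good M" and g: "g \<in> G"
  shows "good (conj_by g M)"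
  unfolding good_def
proof
  have h: "hom_on G (\<lambda>m. - g + m + g)" by (simp add: hom_on_def add.assoc)
  have eq: "x = - g + (g + x - g) + g" for x by (simp only: grp_simps)
  have "g + x - g \<in> G" if "x \<in> G" for x using that g G by (simp add: subgrp_add subgrp_diff)
  then have "G \<subseteq> (\<lambda>m. - g + m + g) ` G" using eq by blast
  then have "(\<lambda>m. - g + m + g) ` G = G" using subgrp_conj[OF G _ g] by blast
  then show "dense_in (conj_by g M) G"
    using dense_in_image[OF good_dense[OF M] G h] by (simp add: conj_by_def)
  show "conj_by g M \<noteq> G"
  proof
    assume *: "conj_by g M = G"
    have "G \<subseteq> M"
    proof
      fix x assume "x \<in> G"
      then have "- g + x + g \<in> conj_by g M" using * subgrp_conj[OF G _ g] by blast
      then obtain m where "m \<in> M" "- g + x + g = - g + m + g" by (auto simp: conj_by_def)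
      then show "x \<in> M" by simp
    qed
    then show False using M good_subset[OF M] by (auto simp: good_def)
  qed
qed

section \<open>Words in the conjugated directed elements\<close>

text \<open>A list of pairs \<open>(\<xi>, t)\<close> stands for the product of the conjugates \<open>cb t \<xi>\<close>. The sum
  \<open>acc \<phi> y\<close> reads off data of its section at \<open>y\<close>: the number of directed factors, their
  total exponent, or the total exponent of the rooted factors.\<close>

type_synonym 'c weight = "(int \<Rightarrow> int) \<Rightarrow> int \<Rightarrow> 'c"

primrec val :: "((int \<Rightarrow> int) \<times> int) list \<Rightarrow> taut" where
  "val [] = 0"
| "val (e # l) = cb (snd e) (fst e) + val l"

primrec cont :: "((int \<Rightarrow> int) \<times> int) list \<Rightarrow> int \<Rightarrow> int" where
  "cont [] = (\<lambda>d. 0)"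
| "cont (e # l) = (\<lambda>d. fst e d + cont l d)"

primrec acc :: "'c::comm_monoid_add weight \<Rightarrow> int \<Rightarrow> ((int \<Rightarrow> int) \<times> int) list \<Rightarrow> 'c" where
  "acc \<phi> y [] = 0"
| "acc \<phi> y (e # l) = \<phi> (fst e) ((y - snd e) mod p) + acc \<phi> y l"

definition wcount :: "nat weight" where "wcount \<xi> d = (if d = 0 then 1 else 0)"
definition wcont :: "int \<Rightarrow> int weight" where "wcont c \<xi> d = (if d = 0 then \<xi> c else 0)"
definition wrot :: "int weight" where "wrot \<xi> d = (if d = 0 then 0 else \<xi> d)"

abbreviation wf_list :: "((int \<Rightarrow> int) \<times> int) list \<Rightarrow> bool" where
  "wf_list l \<equiv> fst ` set l \<subseteq> E"

definition shift :: "int \<Rightarrow> ((int \<Rightarrow> int) \<times> int) list \<Rightarrow> ((int \<Rightarrow> int) \<times> int) list" where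
  "shift s l = map (\<lambda>e. (fst e, snd e - s)) l"

lemma shift_simps [simp]: "shift s [] = []" "shift s (e # l) = (fst e, snd e - s) # shift s l"
  "length (shift s l) = length l" "fst ` set (shift s l) = fst ` set l"
  by (auto simp: shift_def image_image)

lemma val_append: "val (l @ m) = val l + val m"
  by (induction l) (simp_all add: add.assoc)

lemma val_shift: "a s + val l = val (shift s l) + a s"
proof (induction l)
  case (Cons e l)
  have 1: "a s + cb (snd e) (fst e) = cb (snd e - s) (fst e) + a s"
    unfolding cb_conj[of "- s" "snd e" "fst e", simplified, symmetric] a_uminus by (simp only: grp_simps)
  have "a s + val (e # l) = (a s + cb (snd e) (fst e)) + val l" by (simp add: add.assoc)
  also have "\<dots> = cb (snd e - s) (fst e) + (a s + val l)" unfolding 1 by (simp add: add.assoc)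
  finally show ?case unfolding Cons by (simp add: add.assoc)
qed simp

lemma cont_append: "cont (l @ m) = (\<lambda>d. cont l d + cont m d)"
  by (induction l) (simp_all add: add.assoc)

lemma cont_shift [simp]: "cont (shift s l) = cont l"
  by (induction l) simp_all

lemma cont_E: "wf_list l \<Longrightarrow> cont l \<in> E"
  by (induction l) (simp_all add: E_0 E_add)

lemma val_St: "wf_list l \<Longrightarrow> val l \<in> St 1"
  by (induction l) (simp_all add: subgrp_zero[OF subgrp_St] subgrp_add[OF subgrp_St] cb_St[unfolded One_nat_def])

lemma acc_append: "acc \<phi> y (l @ m) = acc \<phi> y l + acc \<phi> y m"
  by (induction l) (simp_all add: add.assoc)

lemma acc_shift: "acc \<phi> y (shift s l) = acc \<phi> (y + s) l"
  by (induction l) (simp_all add: algebra_simps)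

lemma acc_mod: "acc \<phi> (y mod p) l = acc \<phi> y l"
  by (induction l) (simp_all add: mod_simps)

text \<open>As \<open>y\<close> runs over the letters, so does its difference from the parameter of
  any factor; local data therefore add up to a sum over all positions.\<close>

lemma sum_acc: "(\<Sum>y\<in>X. acc \<phi> y l) = (\<Sum>e\<leftarrow>l. \<Sum>d\<in>X. \<phi> (fst e) d)"
proof (induction l)
  case (Cons e l)
  have "\<not> p dvd 1" using p_gt1 by auto
  then have "bij_betw (\<lambda>y. (- snd e + y * 1) mod p) X X" by (rule coprime_mult_bij)
  then have "bij_betw (\<lambda>y. (y - snd e) mod p) X X" by simp
  then have "(\<Sum>y\<in>X. \<phi> (fst e) ((y - snd e) mod p)) = (\<Sum>d\<in>X. \<phi> (fst e) d)"
    by (rule sum.reindex_bij_betw)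
  then show ?case using Cons by (simp add: sum.distrib)
qed simp

lemma sum_X_0: "(\<Sum>d\<in>X. if d = 0 then f d else g d) = f 0 + (\<Sum>d\<in>{1..<p}. g d)"
proof -
  have "X = insert 0 {1..<p}" using p_pos by auto
  then have "(\<Sum>d\<in>X. if d = 0 then f d else g d) = f 0 + (\<Sum>d\<in>{1..<p}. if d = 0 then f d else g d)"
    by simp
  also have "(\<Sum>d\<in>{1..<p}. if d = 0 then f d else g d) = (\<Sum>d\<in>{1..<p}. g d)"
    by (rule sum.cong) auto
  finally show ?thesis .
qed

text \<open>Each factor is directed at exactly one letter.\<close>

lemma sum_count: "(\<Sum>y\<in>X. acc wcount y l) = length l"
  unfolding sum_acc by (induction l) (simp_all add: wcount_def sum_X_0)

lemma sum_cont: "(\<Sum>y\<in>X. acc (wcont c) y l) = cont l c"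
  unfolding sum_acc by (induction l) (simp_all add: wcont_def sum_X_0)

text \<open>Over all letters a factor contributes its exponent sum, which vanishes modulo
  \<open>p\<close>.\<close>

lemma sum_rot: "wf_list l \<Longrightarrow> p dvd (\<Sum>y\<in>X. acc wrot y l)"
  unfolding sum_acc by (induction l) (simp_all add: wrot_def sum_X_0 E_sum_zero)

lemma count_le: "acc wcount y l \<le> length l"
  by (induction l) (simp_all add: wcount_def)

lemma count_subset: "S \<subseteq> X \<Longrightarrow> (\<Sum>y\<in>S. acc wcount y l) \<le> length l"
  using sum_mono2[of X S "\<lambda>y. acc wcount y l"] sum_count by simp

lemma count_full: "acc wcount y l = length l \<Longrightarrow> val l = cb y (cont l)"
proof (induction l)
  case Nil
  then show ?case by (simp add: cb_def)
next
  case (Cons e l)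
  have "acc wcount y (e # l) = (if (y - snd e) mod p = 0 then 1 else 0) + acc wcount y l"
    by (simp add: wcount_def[of "fst e" "(y - snd e) mod p"])
  then have "(y - snd e) mod p = 0" "acc wcount y l = length l"
    using Cons.prems count_le[of y l] by (simp_all split: if_splits)
  moreover have "cb (snd e) (fst e) = cb y (fst e)"
    using \<open>(y - snd e) mod p = 0\<close> by (intro cb_cong) (simp add: mod_eq_dvd_iff mod_eq_0_iff_dvd dvd_diff_commute)
  ultimately show ?case using Cons.IH by (simp add: cb_add)
qed

text \<open>The data \<open>n\<close>, \<open>\<xi>\<close> and \<open>s\<close> belong to one word
  for \<open>g\<close> and need not be determined by \<open>g\<close>; no normal form is required,
  and the induction runs on \<open>n\<close>.\<close>

definition rep :: "nat \<Rightarrow> (int \<Rightarrow> int) \<Rightarrow> int \<Rightarrow> taut \<Rightarrow> bool" where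
  "rep n \<xi> s g \<longleftrightarrow> (\<exists>l. wf_list l \<and> length l = n \<and> cont l = \<xi> \<and> g = val l + a s)"

lemma rep_a: "rep 0 (\<lambda>d. 0) s (a s)"
  unfolding rep_def by (rule exI[of _ "[]"]) simp

lemma rep_b: "\<xi> \<in> E \<Longrightarrow> rep 1 \<xi> 0 (b \<xi>)"
  unfolding rep_def by (rule exI[of _ "[(\<xi>, 0)]"]) simp

lemma rep_add:
  assumes "rep n \<xi> s g" "rep m \<zeta> t h"
  shows "rep (n + m) (\<lambda>d. \<xi> d + \<zeta> d) (s + t) (g + h)"
proof -
  obtain l where l: "wf_list l" "length l = n" "cont l = \<xi>" "g = val l + a s" using assms(1) by (auto simp: rep_def)
  obtain k where k: "wf_list k" "length k = m" "cont k = \<zeta>" "h = val k + a t" using assms(2) by (auto simp: rep_def)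
  have "g + h = val l + (a s + val k) + a t" by (simp add: l k add.assoc)
  also have "\<dots> = val (l @ shift s k) + a (s + t)" unfolding val_shift by (simp add: val_append a_add add.assoc)
  finally have "g + h = val (l @ shift s k) + a (s + t)" .
  moreover have "wf_list (l @ shift s k)" using l k by (auto simp: image_Un)
  ultimately show ?thesis unfolding rep_def
    by (intro exI[of _ "l @ shift s k"]) (simp add: l k cont_append)
qed

lemma rep_uminus:
  assumes "rep n \<xi> s g"
  shows "rep n (\<lambda>d. - \<xi> d) (- s) (- g)"
proof -
  have neg: "\<exists>k. wf_list k \<and> length k = length l \<and> cont k = (\<lambda>d. - cont l d) \<and> val k = - val l"
    if "wf_list l" for l
    using that
  proof (induction l)
    case (Cons e l)
    then obtain k where k: "wf_list k" "length k = length l" "cont k = (\<lambda>d. - cont l d)" "val k = - val l" by auto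
    have "cb (snd e) (\<lambda>d. - fst e d) = - cb (snd e) (fst e)"
      by (simp only: cb_def b_uminus grp_simps)
    then have "val (k @ [(\<lambda>d. - fst e d, snd e)]) = - val (e # l)"
      by (simp add: val_append k minus_add)
    moreover have "cont (k @ [(\<lambda>d. - fst e d, snd e)]) = (\<lambda>d. - cont (e # l) d)"
      by (simp add: cont_append k algebra_simps)
    ultimately show ?case using k Cons.prems E_uminus
      by (intro exI[of _ "k @ [(\<lambda>d. - fst e d, snd e)]"]) auto
  qed simp
  obtain l where l: "wf_list l" "length l = n" "cont l = \<xi>" "g = val l + a s" using assms by (auto simp: rep_def)
  obtain k where k: "wf_list k" "length k = n" "cont k = (\<lambda>d. - \<xi> d)" "val k = - val l" using neg[OF l(1)] l by auto
  have "- g = a (- s) + val k" by (simp add: l k a_uminus minus_add)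
  also have "\<dots> = val (shift (- s) k) + a (- s)" by (rule val_shift)
  finally show ?thesis unfolding rep_def using k by (intro exI[of _ "shift (- s) k"]) simp
qed

lemma rep_diff: "rep n \<xi> s g \<Longrightarrow> rep m \<zeta> t h \<Longrightarrow> rep (n + m) (\<lambda>d. \<xi> d - \<zeta> d) (s - t) (g - h)"
  using rep_add[OF _ rep_uminus] by simp

lemma rep_ex: "g \<in> G \<Longrightarrow> \<exists>n \<xi> s. rep n \<xi> s g"
proof -
  have "G \<subseteq> {g. \<exists>n \<xi> s. rep n \<xi> s g}"
  proof (rule G_least)
    show "subgrp {g. \<exists>n \<xi> s. rep n \<xi> s g}"
      using rep_a[of 0] rep_diff by (auto intro!: subgrpI) blast+
    show "a 1 \<in> {g. \<exists>n \<xi> s. rep n \<xi> s g}" using rep_a by blast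
    show "b \<xi> \<in> {g. \<exists>n \<xi> s. rep n \<xi> s g}" if "\<xi> \<in> E" for \<xi> using rep_b[OF that] by blast
  qed
  then show "g \<in> G \<Longrightarrow> \<exists>n \<xi> s. rep n \<xi> s g" by blast
qed

text \<open>A commutator uses each of its two words once with either sign, so all totals
  cancel.\<close>

lemma rep_der: "g \<in> der G \<Longrightarrow> \<exists>n. rep n (\<lambda>d. 0) 0 g"
proof -
  have "der G \<subseteq> {g. \<exists>n. rep n (\<lambda>d. 0) 0 g}"
  proof (rule der_least)
    show "subgrp {g. \<exists>n. rep n (\<lambda>d. 0) 0 g}"
    proof (rule subgrpI)
      show "0 \<in> {g. \<exists>n. rep n (\<lambda>d. 0) 0 g}" using rep_a[of 0] by auto
      fix g h assume "g \<in> {g. \<exists>n. rep n (\<lambda>d. 0) 0 g}" "h \<in> {g. \<exists>n. rep n (\<lambda>d. 0) 0 g}"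
      then obtain n m where "rep n (\<lambda>d. 0) 0 g" "rep m (\<lambda>d. 0) 0 h" by auto
      from rep_diff[OF this] show "g - h \<in> {g. \<exists>n. rep n (\<lambda>d. 0) 0 g}" by auto
    qed
    fix g h assume "g \<in> G" "h \<in> G"
    then obtain n \<xi> s m \<zeta> t where r: "rep n \<xi> s g" "rep m \<zeta> t h" using rep_ex by metis
    from rep_add[OF rep_add[OF rep_diff[OF rep_uminus[OF r(1)] r(2)] r(1)] r(2)]
    show "commutator g h \<in> {g. \<exists>n. rep n (\<lambda>d. 0) 0 g}"
      by (auto simp: commutator_def)
  qed
  then show "g \<in> der G \<Longrightarrow> \<exists>n. rep n (\<lambda>d. 0) 0 g" by blast
qed

text \<open>\<open>M\<close> approximates \<open>b \<gamma>\<close> up to the derived subgroup,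
  whose elements have words with zero totals.\<close>

lemma dense_rep:
  assumes M: "dense_in M G" and \<gamma>: "\<gamma> \<in> E"
  shows "\<exists>g\<in>M. \<exists>n. rep n \<gamma> 0 g"
proof -
  have "fin_idx (der G) G" using fin_idx_dser_G[of 1] by simp
  then obtain m q where mq: "m \<in> M" "q \<in> der G" "b \<gamma> = m + q"
    using dense_in_decomp[OF M G _ b_G[OF \<gamma>]] by blast
  obtain n where "rep n (\<lambda>d. 0) 0 q" using rep_der[OF mq(2)] by blast
  from rep_diff[OF rep_b[OF \<gamma>] this] have "rep (1 + n) \<gamma> 0 m" using mq(3) by simp
  then show ?thesis using mq(1) by blast
qed

lemma rep_sec:
  assumes "x \<in> X" "wf_list l"
  shows "rep (acc wcount x l) (\<lambda>c. acc (wcont c) x l) (acc wrot x l) (sec (val l) [x])"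
  using assms(2)
proof (induction l)
  case Nil
  then show ?case using rep_a[of 0] by simp
next
  case (Cons e l)
  let ?d = "(x - snd e) mod p"
  have 1: "rep (wcount (fst e) ?d) (\<lambda>c. wcont c (fst e) ?d) (wrot (fst e) ?d) (sec (cb (snd e) (fst e)) [x])"
    using rep_a rep_b Cons.prems by (simp add: sec_cb[OF assms(1)] wcount_def wcont_def wrot_def)
  have "sec (val (e # l)) [x] = sec (cb (snd e) (fst e)) [x] + sec (val l) [x]" by (simp add: sec_add)
  then show ?case using rep_add[OF 1 Cons.IH] Cons.prems by simp
qed

text \<open>The word for the \<open>j\<close>-th multiple of \<open>val l + a s\<close> once all
  rotations have been collected on the right.\<close>

primrec pow_list :: "nat \<Rightarrow> int \<Rightarrow> ((int \<Rightarrow> int) \<times> int) list \<Rightarrow> ((int \<Rightarrow> int) \<times> int) list" where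
  "pow_list 0 s l = []"
| "pow_list (Suc j) s l = l @ shift s (pow_list j s l)"

lemma wf_pow_list: "wf_list l \<Longrightarrow> wf_list (pow_list j s l)"
  by (induction j) (auto simp: image_Un)

lemma nmul_val: "nmul j (val l + a s) = val (pow_list j s l) + a (int j * s)"
proof (induction j)
  case (Suc j)
  have "nmul (Suc j) (val l + a s) = val l + (a s + val (pow_list j s l)) + a (int j * s)"
    using Suc by (simp add: add.assoc)
  also have "\<dots> = val (pow_list (Suc j) s l) + a (int (Suc j) * s)"
    unfolding val_shift by (simp add: val_append a_add add.assoc algebra_simps)
  finally show ?case .
qed simp

lemma acc_pow_list: "acc \<phi> y (pow_list j s l) = (\<Sum>k<j. acc \<phi> (y + int k * s) l)"
proof (induction j arbitrary: y)
  case (Suc j)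
  have "acc \<phi> y (pow_list (Suc j) s l) = acc \<phi> y l + (\<Sum>k<j. acc \<phi> (y + s + int k * s) l)"
    by (simp add: acc_append acc_shift Suc)
  also have "\<dots> = (\<Sum>k<Suc j. acc \<phi> (y + int k * s) l)"
    unfolding sum.lessThan_Suc_shift by (simp add: algebra_simps)
  finally show ?case .
qed simp

text \<open>The shifts by multiples of \<open>s\<close> run through all residues, so every section
  of the \<open>p\<close>-th multiple accumulates the totals of \<open>l\<close> over all
  letters.\<close>

lemma acc_full_pow:
  assumes "\<not> p dvd s"
  shows "acc \<phi> y (pow_list (nat p) s l) = (\<Sum>y\<in>X. acc \<phi> y l)"
proof -
  have "acc \<phi> y (pow_list (nat p) s l) = (\<Sum>k\<in>X. acc \<phi> (y + k * s) l)"
    unfolding acc_pow_list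
    by (rule sum.reindex_bij_witness[where i = nat and j = int]) auto
  also have "\<dots> = (\<Sum>k\<in>X. acc \<phi> ((y + k * s) mod p) l)" by (simp only: acc_mod)
  also have "\<dots> = (\<Sum>y\<in>X. acc \<phi> y l)"
    by (rule sum.reindex_bij_betw[OF coprime_mult_bij[OF assms]])
  finally show ?thesis .
qed

lemma nonzero_part:
  assumes "nonzero (cont l)"
  shows "\<exists>x\<in>X. nonzero (\<lambda>c. acc (wcont c) x l)"
proof (rule ccontr)
  assume *: "\<not> (\<exists>x\<in>X. nonzero (\<lambda>c. acc (wcont c) x l))"
  have "p dvd cont l d" if "d \<in> {1..<p}" for d
    unfolding sum_cont[symmetric] using * that by (intro dvd_sum) (auto simp: nonzero_def)
  then show False using assms by (auto simp: nonzero_def)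
qed

section \<open>Bringing generators into iterated sections\<close>

text \<open>Passing to a section shortens the representing list unless all its factors share a vertex;
  torsion makes the \<open>p\<close>-th power usable when the element moves the first level.\<close>

lemma reach_directed:
  assumes "good M" "g \<in> M" "rep n \<gamma> s g" "nonzero \<gamma>"
  shows "\<exists>M' t \<xi>. good M' \<and> \<xi> \<in> E \<and> nonzero \<xi> \<and> cb t \<xi> \<in> M'"
  using assms
proof (induction n arbitrary: M g \<gamma> s rule: less_induct)
  case (less n)
  have fixing: ?case if M: "good M" "g \<in> M" "rep n \<gamma> s g" "nonzero \<gamma>" "p dvd s" for M g s
  proof -
    obtain l where l: "wf_list l" "length l = n" "cont l = \<gamma>" "g = val l + a s" using M(3) by (auto simp: rep_def)
    have "a s = a 0" using M(5) by (intro a_cong) auto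
    then have g: "g = val l" using l(4) by simp
    \<comment> \<open>The exponent totals at the letters add up to \<open>\<gamma>\<close>, so one
      of them is nonzero.\<close>
    obtain x where x: "x \<in> X" "nonzero (\<lambda>c. acc (wcont c) x l)" using nonzero_part M(4) l(3) by blast
    show ?thesis
    proof (cases "acc wcount x l = n")
      case True
      then have "g = cb x \<gamma>" using count_full[of x l] l g by simp
      then show ?thesis using M cont_E[OF l(1)] l(3) by blast
    next
      case False
      then have "acc wcount x l < n" using count_le[of x l] l(2) by simp
      moreover have "sec g [x] \<in> sect x M" using M(2) g val_St[OF l(1)] by (intro sectI) auto
      moreover have "rep (acc wcount x l) (\<lambda>c. acc (wcont c) x l) (acc wrot x l) (sec g [x])"
        unfolding g by (rule rep_sec[OF x(1) l(1)])
      ultimately show ?thesis using less.IH good_sect[OF M(1) x(1)] x(2) by blast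
    qed
  qed
  show ?case
  proof (cases "p dvd s")
    case True
    then show ?thesis using fixing less.prems by blast
  next
    case False
    obtain l where l: "wf_list l" "length l = n" "cont l = \<gamma>" "g = val l + a s" using less.prems(3) by (auto simp: rep_def)
    define m where "m = pow_list (nat p) s l"
    have m: "wf_list m" unfolding m_def by (rule wf_pow_list[OF l(1)])
    have "a (p * s) = a 0" by (rule a_cong) simp
    then have pg: "nmul (nat p) g = val m" using p_pos by (simp add: l(4) nmul_val m_def)
    have X0: "0 \<in> X" using p_pos by simp
    \<comment> \<open>The section of the \<open>p\<close>-th multiple has a word of the same length
      and exponent total, but its rotation is divisible by \<open>p\<close>. Nothing is shortened
      here; the case already treated applies to it with the same \<open>n\<close>.\<close>
    have "acc wcount 0 m = n" "(\<lambda>c. acc (wcont c) 0 m) = \<gamma>" "p dvd acc wrot 0 m"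
      using sum_count[of l] sum_cont[of _ l] sum_rot[OF l(1)] l
      unfolding m_def acc_full_pow[OF False] by auto
    then have "rep n \<gamma> (acc wrot 0 m) (sec (val m) [0])" "p dvd acc wrot 0 m"
      using rep_sec[OF X0 m] by simp_all
    moreover have "sec (val m) [0] \<in> sect 0 M"
      using subgrp_nmul[OF good_subgrp[OF less.prems(1)] less.prems(2), of "nat p"] pg val_St[OF m] by (intro sectI) auto
    ultimately show ?thesis using fixing good_sect[OF less.prems(1) X0] less.prems(4) by blast
  qed
qed

text \<open>Powers of \<open>a\<close> permute the letters of \<open>X\<close> transitively and have
  trivial sections, so conjugating by them transports sections unchanged.\<close>

lemma sect_rot_invariant:
  assumes M: "good M" and a1: "a 1 \<in> M" and x: "x \<in> X"
  shows "sect x M = sect 0 M"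
proof -
  have ak: "a k \<in> M" for k using a_mult_mem[OF good_subgrp[OF M] a1, of k] by simp
  have sub: "sect y M \<subseteq> sect z M" if yz: "y \<in> X" "z \<in> X" for y z
  proof
    fix g assume "g \<in> sect y M"
    then obtain h where h: "h \<in> M" "h \<in> St 1" "g = sec h [y]" by (auto simp: sect_def)
    let ?h = "- a (z - y) + h + a (z - y)"
    have "app (a (z - y)) [y] = [z]" using yz by (simp add: app_a)
    from sec_conj_fix[OF this h(2)] have "sec ?h [z] = g" using h(3) by simp
    moreover have "?h \<in> M" "?h \<in> St 1" using subgrp_conj[OF good_subgrp[OF M] h(1) ak] conj_St[OF h(2) a_G] by auto
    ultimately show "g \<in> sect z M" using sectI by blast
  qed
  show ?thesis using sub[OF x, of 0] sub[of 0 x] x p_pos by auto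
qed

text \<open>At a letter \<open>d\<close> with nonzero exponent the section of \<open>b \<xi>\<close>
  generates all rotations. Conjugating \<open>b \<xi>\<close> by an element of \<open>M\<close> that
  moves \<open>0\<close> to \<open>d\<close> puts a conjugate of \<open>b \<xi>\<close> into the
  same section group; its conjugator \<open>h\<close> is only known to lie in
  \<open>G\<close>.\<close>

lemma reach_rooted:
  assumes M: "good M" and \<xi>: "\<xi> \<in> E" "nonzero \<xi>" and bM: "b \<xi> \<in> M"
  shows "\<exists>M' h. good M' \<and> a 1 \<in> M' \<and> h \<in> G \<and> - h + b \<xi> + h \<in> M'"
proof -
  obtain d where d: "d \<in> {1..<p}" "\<not> p dvd \<xi> d" using \<xi>(2) by (auto simp: nonzero_def)
  then have dX: "d \<in> X" "0 \<in> X" by auto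
  have bSt: "b \<xi> \<in> St 1" using cb_St[OF \<xi>(1), of 0] by simp
  have "sec (b \<xi>) [d] \<in> sect d M" using bM bSt by (rule sectI)
  then have "a (\<xi> d) \<in> sect d M" using d by (simp add: sec_b)
  then have a1: "a 1 \<in> sect d M"
    by (rule a_unit_mem[OF good_subgrp[OF good_sect[OF M dX(1)]] _ d(2)])
  obtain m where m: "m \<in> M" "app m [0] = [d]" using dense_transitive[OF good_dense[OF M] dX(2,1)] by blast
  have mG: "m \<in> G" using m(1) good_subset[OF M] by blast
  have "sec (- m + b \<xi> + m) [d] \<in> sect d M"
    using subgrp_conj[OF good_subgrp[OF M] bM m(1)] conj_St[OF bSt mG] by (rule sectI)
  then have "- sec m [0] + b \<xi> + sec m [0] \<in> sect d M"
    unfolding sec_conj_fix[OF m(2) bSt] by (simp add: sec_b)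
  then show ?thesis using good_sect[OF M dX(1)] a1 sec_G[OF mG] by blast
qed

text \<open>Induction on the length of the conjugator. Passing to the section at a letter
  \<open>c\<close> with \<open>\<xi> c\<close> invertible gives \<open>b \<xi>\<close> conjugated by
  \<open>sec v [0]\<close> and a rotation conjugated by \<open>sec v [c]\<close>; conjugating the
  rotation back leaves the difference of these two sections as the new conjugator.\<close>

lemma reach_both:
  assumes "good M" "a 1 \<in> M" "rep n \<gamma> s h" "- h + b \<xi> + h \<in> M" "\<xi> \<in> E" "nonzero \<xi>"
  shows "\<exists>M'. good M' \<and> a 1 \<in> M' \<and> b \<xi> \<in> M'"
  using assms
proof (induction n arbitrary: M \<gamma> s h rule: less_induct)
  case (less n)
  note M = less.prems(1) and a1 = less.prems(2)
  have Ms: "subgrp M" by (rule good_subgrp[OF M])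
  have ak: "a k \<in> M" for k using a_mult_mem[OF Ms a1, of k] by simp
  obtain l where l: "wf_list l" "length l = n" "cont l = \<gamma>" "h = val l + a s" using less.prems(3) by (auto simp: rep_def)
  define v where "v = val l"
  define g where "g = - v + b \<xi> + v"
  have v: "v \<in> St 1" unfolding v_def by (rule val_St[OF l(1)])
  have bSt: "b \<xi> \<in> St 1" using cb_St[OF \<open>\<xi> \<in> E\<close>, of 0] by simp
  have "g = a s + (- h + b \<xi> + h) - a s" unfolding g_def l(4) v_def by (simp only: grp_simps)
  moreover have "a s + (- h + b \<xi> + h) - a s \<in> M"
    by (rule subgrp_diff[OF Ms subgrp_add[OF Ms ak less.prems(4)] ak])
  ultimately have gM: "g \<in> M" by simp
  have gSt: "g \<in> St 1" unfolding g_def by (rule subgrp_conj[OF subgrp_St bSt v])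
  show ?case
  proof (cases "acc wcount 0 l = n")
    case True
    \<comment> \<open>All factors merge into \<open>b \<gamma>\<close>, which commutes with
      \<open>b \<xi>\<close>.\<close>
    then have "v = b \<gamma>" using count_full[of 0 l] l by (simp add: v_def)
    then have "g = b \<xi>" unfolding g_def by (simp add: add.assoc b_comm[of \<xi> \<gamma>])
    then show ?thesis using M a1 gM by blast
  next
    case False
    obtain d d' where d: "d \<in> {1..<p}" "d' \<in> {1..<p}" "d \<noteq> d'" "\<not> p dvd \<xi> d" "\<not> p dvd \<xi> d'"
      by (rule nonzero_two[OF less.prems(5,6)])
    \<comment> \<open>The counts at \<open>0\<close>, \<open>d\<close> and \<open>d'\<close> sum to
      at most \<open>n\<close>, and the count at \<open>0\<close> is not \<open>n\<close>; hence
      \<open>d\<close> or \<open>d'\<close> makes the new conjugator shorter.\<close>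
    have "(\<Sum>y\<in>{0, d, d'}. acc wcount y l) \<le> length l" using d by (intro count_subset) auto
    then have "acc wcount 0 l + acc wcount d l + acc wcount d' l \<le> n" using d l(2) by simp
    then have "acc wcount 0 l + acc wcount d l < n \<or> acc wcount 0 l + acc wcount d' l < n"
      using False by linarith
    then obtain c where c: "c \<in> {1..<p}" "\<not> p dvd \<xi> c" "acc wcount 0 l + acc wcount c l < n" using d by blast
    then have cX: "c \<in> X" "0 \<in> X" by auto
    let ?M1 = "sect c M" and ?h0 = "sec v [0]" and ?hc = "sec v [c]"
    have M1: "good ?M1" by (rule good_sect[OF M cX(1)])
    have vG: "v \<in> G" using v St_G by blast
    have sg: "sec g [x] = - sec v [x] + sec (b \<xi>) [x] + sec v [x]" for x
      unfolding g_def by (rule hom_on_conj[OF hom_on_sec_letter subgrp_St bSt v])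
    have "sec g [0] \<in> ?M1"
      using sectI[OF gM gSt, of 0] sect_rot_invariant[OF M a1 cX(1)] by simp
    then have 0: "- ?h0 + b \<xi> + ?h0 \<in> ?M1" unfolding sg by (simp add: sec_b)
    have "sec g [c] \<in> ?M1" by (rule sectI[OF gM gSt])
    then have "- ?hc + a (\<xi> c) + ?hc \<in> ?M1" unfolding sg using c(1) by (simp add: sec_b)
    from conj_byI[OF this, of "- ?hc"] have "a (\<xi> c) \<in> conj_by (- ?hc) ?M1"
      by (simp add: add.assoc)
    moreover have M2: "good (conj_by (- ?hc) ?M1)"
      by (intro good_conj_by M1 subgrp_uminus[OF G] sec_G vG)
    ultimately have a2: "a 1 \<in> conj_by (- ?hc) ?M1" using a_unit_mem[OF good_subgrp _ c(2)] by blast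
    have "- (- ?hc) + (- ?h0 + b \<xi> + ?h0) + - ?hc = - (?h0 - ?hc) + b \<xi> + (?h0 - ?hc)"
      by (simp only: grp_simps)
    then have b2: "- (?h0 - ?hc) + b \<xi> + (?h0 - ?hc) \<in> conj_by (- ?hc) ?M1"
      using conj_byI[OF 0, of "- ?hc"] by simp
    from rep_diff[OF rep_sec[OF cX(2) l(1)] rep_sec[OF cX(1) l(1)]]
    show ?thesis unfolding v_def[symmetric] by (rule less.IH[OF c(3) M2 a2 _ b2 less.prems(5,6)])
  qed
qed

lemma b_sum_mem: 
  assumes "subgrp S" "finite I" "\<And>i. i \<in> I \<Longrightarrow> b (f i) \<in> S"
  shows "b (\<lambda>c. \<Sum>i\<in>I. f i c) \<in> S"
  using assms(2,3)
  by (induction I rule: finite_induct) (simp_all add: subgrp_zero[OF assms(1)] b_add subgrp_add[OF assms(1)])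

text \<open>The section at \<open>0\<close> keeps \<open>a\<close>, \<open>b \<xi>\<close> and every
  directed element of \<open>M\<close>. If it gains none, some letter must carry an exponent total
  whose directed element is still missing, since these totals add up to \<open>\<gamma>\<close>; the
  section there is shorter, and the induction continues with it.\<close>

lemma grow_directed:
  assumes "good M" "a 1 \<in> M" "b \<xi> \<in> M" "\<xi> \<in> E" "nonzero \<xi>" "b \<gamma> \<notin> M" "g \<in> M" "rep n \<gamma> s g"
  shows "\<exists>M'. good M' \<and> a 1 \<in> M' \<and> b \<xi> \<in> M' \<and> b ` E \<inter> M \<subset> b ` E \<inter> M'"
  using assms
proof (induction n arbitrary: M \<gamma> s g rule: less_induct)
  case (less n)
  note M = less.prems(1) and a1 = less.prems(2)
  have Ms: "subgrp M" by (rule good_subgrp[OF M])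
  have ak: "a k \<in> M" for k using a_mult_mem[OF Ms a1, of k] by simp
  let ?M1 = "sect 0 M"
  have X0: "0 \<in> X" using p_pos by simp
  have M1: "good ?M1" by (rule good_sect[OF M X0])
  have M1s: "subgrp ?M1" by (rule good_subgrp[OF M1])
  have bM1: "b \<zeta> \<in> ?M1" if "\<zeta> \<in> E" "b \<zeta> \<in> M" for \<zeta>
  proof -
    have "b \<zeta> \<in> St 1" using cb_St[OF that(1), of 0] by simp
    from sectI[OF that(2) this, of 0] show ?thesis by (simp add: sec_b)
  qed
  have a1': "a 1 \<in> ?M1"
  proof -
    obtain d where d: "d \<in> {1..<p}" "\<not> p dvd \<xi> d" using less.prems(5) by (auto simp: nonzero_def)
    have "b \<xi> \<in> St 1" using cb_St[OF less.prems(4), of 0] by simp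
    from sectI[OF less.prems(3) this, of d] have "a (\<xi> d) \<in> sect d M" using d(1) by (simp add: sec_b)
    then have "a (\<xi> d) \<in> ?M1" using sect_rot_invariant[OF M a1, of d] d(1) by simp
    then show ?thesis by (rule a_unit_mem[OF M1s _ d(2)])
  qed
  have sub: "b ` E \<inter> M \<subseteq> b ` E \<inter> ?M1" using bM1 by blast
  show ?case
  proof (cases "b ` E \<inter> M = b ` E \<inter> ?M1")
    case False
    then show ?thesis using sub M1 a1' bM1[OF less.prems(4,3)] by blast
  next
    case True
    obtain l where l: "wf_list l" "length l = n" "cont l = \<gamma>" "g = val l + a s" using less.prems(8) by (auto simp: rep_def)
    have "val l = g - a s" using l(4) by simp
    then have vM: "val l \<in> M" using subgrp_diff[OF Ms less.prems(7) ak] by simp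
    have \<gamma>E: "\<gamma> \<in> E" using cont_E[OF l(1)] l(3) by simp
    have "\<exists>x\<in>X. b (\<lambda>c. acc (wcont c) x l) \<notin> ?M1"
    proof (rule ccontr)
      assume "\<not> (\<exists>x\<in>X. b (\<lambda>c. acc (wcont c) x l) \<notin> ?M1)"
      then have "b (\<lambda>c. \<Sum>x\<in>X. acc (wcont c) x l) \<in> ?M1" by (intro b_sum_mem M1s) auto
      then have "b \<gamma> \<in> ?M1" unfolding sum_cont using l(3) by simp
      then show False using True \<gamma>E less.prems(6) by blast
    qed
    then obtain x where x: "x \<in> X" "b (\<lambda>c. acc (wcont c) x l) \<notin> ?M1" by blast
    \<comment> \<open>If all factors were directed at \<open>x\<close>, the word would be a
      conjugate of \<open>b \<gamma>\<close> by a rotation, and \<open>M\<close> contains all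
      rotations.\<close>
    have "acc wcount x l \<noteq> n"
    proof
      assume "acc wcount x l = n"
      then have "val l = - a x + b \<gamma> + a x" using count_full[of x l] l by (simp add: cb_def)
      then have "b \<gamma> = a x + val l - a x" by (simp add: add.assoc)
      moreover have "a x + val l - a x \<in> M" using vM ak by (intro subgrp_diff subgrp_add Ms)
      ultimately show False using less.prems(6) by simp
    qed
    then have lt: "acc wcount x l < n" using count_le[of x l] l(2) by simp
    have "sec (val l) [x] \<in> ?M1"
      using sectI[OF vM val_St[OF l(1)], of x] sect_rot_invariant[OF M a1 x(1)] by simp
    from less.IH[OF lt M1 a1' bM1[OF less.prems(4,3)] less.prems(4,5) x(2) this rep_sec[OF x(1) l(1)]]
    show ?thesis using True by simp
  qed
qed

section \<open>Absence of proper dense subgroups\<close>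

theorem no_proper_dense_G: "no_proper_dense G"
  unfolding no_proper_dense_def
proof (intro allI impI)
  fix M assume "dense_in M G"
  show "M = G"
  proof (rule ccontr)
    assume "M \<noteq> G"
    then have M: "good M" using \<open>dense_in M G\<close> by (simp add: good_def)
    obtain \<xi>0 where e0: "\<xi>0 \<in> E" "nonzero \<xi>0" by (rule E_witness)
    obtain g n where "g \<in> M" "rep n \<xi>0 0 g" using dense_rep[OF good_dense[OF M] e0(1)] by blast
    from reach_directed[OF M this e0(2)] obtain M1 t \<xi> where M1: "good M1" "\<xi> \<in> E" "nonzero \<xi>" "cb t \<xi> \<in> M1"
      by blast
    \<comment> \<open>Conjugation by a rotation moves the first letter of the directed path back to
      \<open>0\<close>.\<close>
    have M2: "good (conj_by (- a t) M1)" by (intro good_conj_by M1 subgrp_uminus[OF G] a_G)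
    have "b \<xi> \<in> conj_by (- a t) M1" using conj_byI[OF M1(4), of "- a t"] by (simp add: cb_def add.assoc)
    from reach_rooted[OF M2 M1(2,3) this] obtain M3 h where M3: "good M3" "a 1 \<in> M3" "h \<in> G" "- h + b \<xi> + h \<in> M3"
      by blast
    obtain n \<gamma> s where "rep n \<gamma> s h" using rep_ex[OF M3(3)] by blast
    from reach_both[OF M3(1,2) this M3(4) M1(2,3)] obtain M4 where M4: "good M4" "a 1 \<in> M4" "b \<xi> \<in> M4" by blast
    have finE: "finite (b ` E)" using finite_subset[OF image_mono[OF subset_UNIV] finite_range_dir[OF p_pos]] .
    have False if "good M" "a 1 \<in> M" "b \<xi> \<in> M" for M
      using that
    \<comment> \<open>The number of directed elements missing from \<open>M\<close> is finite even
      when \<open>E\<close> is infinite, and \<open>grow_directed\<close> lowers it; when none is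
      missing, \<open>M\<close> contains all generators.\<close>
    proof (induction "card (b ` E - M)" arbitrary: M rule: less_induct)
      case less
      have "\<not> G \<subseteq> M" using less.prems(1) good_subset by (auto simp: good_def)
      then obtain \<gamma> where \<gamma>: "\<gamma> \<in> E" "b \<gamma> \<notin> M" using G_least[OF good_subgrp] less.prems by blast
      obtain g n where "g \<in> M" "rep n \<gamma> 0 g" using dense_rep[OF good_dense[OF less.prems(1)] \<gamma>(1)] by blast
      from grow_directed[OF less.prems M1(2,3) \<gamma>(2) this] obtain M' where
        M': "good M'" "a 1 \<in> M'" "b \<xi> \<in> M'" "b ` E \<inter> M \<subset> b ` E \<inter> M'" by blast
      have "b ` E - M' \<subset> b ` E - M" using M'(4) by blast
      then have "card (b ` E - M') < card (b ` E - M)" using finE by (intro psubset_card_mono) auto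
      then show False using less.hyps M' by blast
    qed
    then show False using M4 by blast
  qed
qed

text \<open>A finite-index normal subgroup \<open>L\<close> contains copies of a derived subgroup at some level, so
  at a deeper level \<open>N\<close> all its sections are the whole group, to which the previous theorem applies.\<close>

theorem no_proper_dense_fin_idx:
  assumes "fin_idx L G"
  shows "no_proper_dense L"
proof -
  obtain L' where L': "fin_idx L' G" "normal_in L' G" "L' \<subseteq> L" using fin_idx_core[OF assms G] by blast
  have "L' \<noteq> {0}" using L'(1) not_fin_idx_0 by blast
  then obtain n where n: "\<And>v k. v \<in> words p n \<Longrightarrow> k \<in> dser (2 * n + 1) G \<Longrightarrow> at_vertex v k \<in> L'"
    using normal_contains_copies[OF L'(2)] by blast
  \<comment> \<open>Below level \<open>n\<close> there are copies of \<open>dser m G\<close> in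
    \<open>L'\<close>, and the sections of \<open>dser m G\<close> at level \<open>m\<close> are all
    of \<open>G\<close>; hence the level \<open>n + m\<close>.\<close>
  define m where "m = 2 * n + 1"
  define N where "N = n + m"
  define K where "K = L' \<inter> St N"
  have L's: "subgrp L'" "L' \<subseteq> G" using L'(2) by (auto simp: normal_in_def)
  have K: "fin_idx K G"
    using fin_idx_trans[OF fin_idx_Int_subgrp[OF L'(1) subgrp_St St_G] fin_idx_St G] by (simp add: K_def)
  have Ks: "subgrp K" "K \<subseteq> St N" by (auto simp: K_def intro!: subgrp_Int L's subgrp_St)
  have split: "\<exists>v w. u = v @ w \<and> v \<in> words p n \<and> w \<in> words p m" if "u \<in> words p N" for u
    using that set_take_subset[of n u] set_drop_subset[of n u]
    by (intro exI[of _ "take n u"] exI[of _ "drop n u"]) (auto simp: words_def N_def)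
  have atK: "at_vertex v h \<in> K" if v: "v \<in> words p n" and h: "h \<in> dser m G" for v h
  proof -
    have "at_vertex v h \<in> L'" using n[OF v] h by (simp add: m_def)
    moreover have "at_vertex v h \<in> St (n + m)"
    proof (rule St_sec_St)
      show "at_vertex v h \<in> St n" using calculation L's(2) v
        by (auto simp: St_def app_at_vertex words_def)
      show "sec (at_vertex v h) u \<in> St m" if "u \<in> words p n" for u
        using that v h dser_St subgrp_zero[OF subgrp_St] by (auto simp: sec_at_vertex words_def)
    qed
    ultimately show ?thesis by (simp add: K_def N_def)
  qed
  have full: "(\<lambda>g. sec g u) ` K = G" if u: "u \<in> words p N" for u
  proof
    show "(\<lambda>g. sec g u) ` K \<subseteq> G" using Ks(2) St_G sec_G by blast
    obtain v w where vw: "u = v @ w" "v \<in> words p n" "w \<in> words p m" using split[OF u] by blast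
    show "G \<subseteq> (\<lambda>g. sec g u) ` K"
    proof
      fix g assume "g \<in> G"
      then obtain h where h: "h \<in> dser m G" "g = sec h w" using sec_dser[OF vw(3), of 0] by auto
      have "sec (at_vertex v h) u = g" using vw h by (simp add: sec_append sec_at_vertex)
      then show "g \<in> (\<lambda>g. sec g u) ` K" using atK[OF vw(2) h(1)] by blast
    qed
  qed
  \<comment> \<open>\<open>2 * m\<close> derived steps put the copy below \<open>w\<close> into
    \<open>G\<close>, and \<open>m\<close> more put it into \<open>dser m G\<close>, whose copies
    below \<open>v\<close> lie in \<open>K\<close>.\<close>
  have copies: "at_vertex u k \<in> K" if u: "u \<in> words p N" and k: "k \<in> dser (2 * m + m) G" for u k
  proof -
    obtain v w where vw: "u = v @ w" "v \<in> words p n" "w \<in> words p m" using split[OF u] by blast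
    have "at_vertex w ` dser m (dser (2 * m) G) = dser m (at_vertex w ` dser (2 * m) G)"
      by (rule image_dser[OF hom_on_at_vertex subgrp_dser[OF G]])
    also have "\<dots> \<subseteq> dser m G" using at_vertex_G[OF vw(3)] by (intro dser_mono) auto
    finally have "at_vertex w k \<in> dser m G" using k dser_add[of m "2 * m" G] by (auto simp: add.commute)
    then show ?thesis using atK[OF vw(2)] vw(1) at_vertex_append[of v w k] by simp
  qed
  have "no_proper_dense K"
    unfolding no_proper_dense_def
  proof (intro allI impI)
    fix D assume D: "dense_in D K"
    show "D = K"
    proof (rule full_dense_eq[OF Ks D _ copies])
      fix u assume u: "u \<in> words p N"
      then have "hom_on K (\<lambda>g. sec g u)" using hom_on_subset[OF hom_on_sec Ks(2)] by (auto simp: words_def)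
      from dense_in_image[OF D Ks(1) this] show "(\<lambda>g. sec g u) ` D = G"
        using no_proper_dense_G full[OF u] by (auto simp: no_proper_dense_def)
    qed
  qed
  moreover have "fin_idx K L"
  proof -
    have "K \<subseteq> L" using L'(3) by (auto simp: K_def)
    then show ?thesis
      using fin_idx_Int_subgrp[OF K fin_idx_subgrp[OF assms] fin_idx_subset[OF assms]] by (simp add: Int_absorb2)
  qed
  ultimately show ?thesis using no_proper_dense_up fin_idx_subgrp[OF assms] by blast
qed

end

section \<open>Transfer to the given groups\<close>

text \<open>\<open>H\<close> comes as an arbitrary carrier with its own operation, while the theory
  above needs a type of class \<open>group_add\<close>. The symmetric group on the element type
  hosts \<open>H\<close> by Cayley's theorem.\<close>

typedef 'a bijection = "{f :: 'a \<Rightarrow> 'a. bij f}"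
  morphisms bij_app Abs_bijection
  by (rule exI[of _ id]) auto

setup_lifting type_definition_bijection

instantiation bijection :: (type) group_add
begin

lift_definition zero_bijection :: "'a bijection" is id by simp
lift_definition plus_bijection :: "'a bijection \<Rightarrow> 'a bijection \<Rightarrow> 'a bijection" is "\<lambda>f g. g \<circ> f"
  by (rule bij_comp)
lift_definition uminus_bijection :: "'a bijection \<Rightarrow> 'a bijection" is "inv_into UNIV"
  by (rule bij_imp_bij_inv)
definition minus_bijection :: "'a bijection \<Rightarrow> 'a bijection \<Rightarrow> 'a bijection" where
  "minus_bijection f g = f + - g"

instance
proof
  fix a b c :: "'a bijection"
  show "a + b + c = a + (b + c)" by transfer (simp add: comp_assoc)
  show "0 + a = a" by transfer simp
  show "a + 0 = a" by transfer simp
  show "- a + a = 0" by transfer (auto simp: bij_is_surj surj_f_inv_f fun_eq_iff)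
  show "a + - b = a - b" by (simp add: minus_bijection_def)
qed

end

section \<open>Groups with an explicit carrier inside additive types\<close>

locale group_embedding = group A for A :: "('a, 'm) monoid_scheme" (structure) +
  fixes \<iota> :: "'a \<Rightarrow> 'b::group_add"
  assumes inj: "inj_on \<iota> (carrier A)"
    and add: "x \<in> carrier A \<Longrightarrow> y \<in> carrier A \<Longrightarrow> \<iota> (x \<otimes> y) = \<iota> x + \<iota> y"
begin

lemma emb_one: "\<iota> \<one> = 0"
  using add[of \<one> \<one>] add_left_cancel[of "\<iota> \<one>" "\<iota> \<one>" 0] by simp

lemma emb_inv: "x \<in> carrier A \<Longrightarrow> \<iota> (inv x) = - \<iota> x"
  using add[of x "inv x"] minus_unique[of "\<iota> x" "\<iota> (inv x)"] by (simp add: emb_one)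

lemma emb_diff: "x \<in> carrier A \<Longrightarrow> y \<in> carrier A \<Longrightarrow> \<iota> (x \<otimes> inv y) = \<iota> x - \<iota> y"
  by (simp add: add emb_inv)

lemma emb_pow: "x \<in> carrier A \<Longrightarrow> \<iota> (x [^] (n::nat)) = nmul n (\<iota> x)"
proof (induction n)
  case (Suc n)
  have "\<iota> (x [^] Suc n) = \<iota> (x \<otimes> x [^] n)" using nat_pow_Suc2[OF Suc.prems] by simp
  then show ?case using Suc by (simp add: add)
qed (simp add: emb_one)

lemma subgrp_emb: "subgroup K A \<Longrightarrow> subgrp (\<iota> ` K)"
proof (rule subgrpI)
  assume K: "subgroup K A"
  show "0 \<in> \<iota> ` K" using subgroup.one_closed[OF K] emb_one by force
  fix x y assume "x \<in> \<iota> ` K" "y \<in> \<iota> ` K"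
  then obtain k l where kl: "k \<in> K" "l \<in> K" "x = \<iota> k" "y = \<iota> l" by auto
  then have "x - y = \<iota> (k \<otimes> inv l)" using subgroup.mem_carrier[OF K] by (simp add: emb_diff)
  moreover have "k \<otimes> inv l \<in> K" using kl K by (simp add: subgroup.m_closed subgroup.m_inv_closed)
  ultimately show "x - y \<in> \<iota> ` K" by blast
qed

lemma subgroup_vimage:
  assumes "subgrp P"
  shows "subgroup {x \<in> carrier A. \<iota> x \<in> P} A"
proof (rule subgroup.intro)
  show "inv x \<in> {x \<in> carrier A. \<iota> x \<in> P}" if "x \<in> {x \<in> carrier A. \<iota> x \<in> P}" for x
    using that assms by (simp add: emb_inv subgrp_uminus)
qed (use assms in \<open>auto simp: add emb_one subgrp_add subgrp_zero\<close>)

lemma finite_index_iff: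
  assumes "subgroup K A"
  shows "finite_index K A \<longleftrightarrow> fin_idx (\<iota> ` K) (\<iota> ` carrier A)"
proof -
  have K: "K \<subseteq> carrier A" using assms by (rule subgroup.subset)
  have "(\<lambda>j. j + \<iota> x) ` \<iota> ` K = \<iota> ` (K #> x)" if "x \<in> carrier A" for x
    using that K by (auto simp: r_coset_def image_iff add subset_iff)
  then have "(\<lambda>x. (\<lambda>j. j + x) ` \<iota> ` K) ` \<iota> ` carrier A = (`) \<iota> ` (rcosets K)"
    unfolding image_image RCOSETS_def by auto
  moreover have "inj_on ((`) \<iota>) (rcosets K)"
  proof (rule inj_on_subset)
    show "inj_on ((`) \<iota>) (Pow (carrier A))" by (rule inj_on_image_Pow[OF inj])
    show "rcosets K \<subseteq> Pow (carrier A)" using rcosets_part_G[OF assms] by blast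
  qed
  ultimately have "finite (rcosets K) \<longleftrightarrow> finite ((\<lambda>x. (\<lambda>j. j + x) ` \<iota> ` K) ` \<iota> ` carrier A)"
    by (simp add: finite_image_iff)
  then show ?thesis
    using assms K by (auto simp: finite_index_def fin_idx_def subgrp_emb)
qed

lemma emb_generate:
  assumes S: "S \<subseteq> carrier A"
  shows "\<iota> ` generate A S = gen (\<iota> ` S)"
proof
  show "gen (\<iota> ` S) \<subseteq> \<iota> ` generate A S"
    using generate_is_subgroup[OF S] by (intro gen_least subgrp_emb) (auto intro: generate.incl)
  have "\<iota> x \<in> gen (\<iota> ` S)" if "x \<in> generate A S" for x
    using that
  proof (induction rule: generate.induct)
    case one
    then show ?case using emb_one subgrp_zero[OF subgrp_gen] by simp
  next
    case (incl h)
    then show ?case by (intro gen_incl) auto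
  next
    case (inv h)
    then have "- \<iota> h \<in> gen (\<iota> ` S)" by (intro subgrp_uminus subgrp_gen gen_incl) auto
    then show ?case using inv S by (simp add: emb_inv subset_iff)
  next
    case (eng h1 h2)
    have "h1 \<in> carrier A" "h2 \<in> carrier A" using eng(1,2) generate_in_carrier[OF S] by auto
    then show ?case using eng(3,4) by (simp add: add subgrp_add[OF subgrp_gen])
  qed
  then show "\<iota> ` generate A S \<subseteq> gen (\<iota> ` S)" by blast
qed

text \<open>If \<open>M\<close> had infinite index, any finite-index subgroup over its image would
  pull back to a subgroup different from \<open>M\<close>, hence to the whole carrier; so the image
  of \<open>M\<close> would be proper and dense.\<close>

lemma maximal_subgroup_finite_index:
  assumes nd: "no_proper_dense (\<iota> ` carrier A)" and M: "maximal_subgroup M A"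
  shows "finite_index M A"
proof (rule ccontr)
  assume nf: "\<not> finite_index M A"
  have Ms: "subgroup M A" "M \<noteq> carrier A" and
    max: "\<And>K. subgroup K A \<Longrightarrow> M \<subseteq> K \<Longrightarrow> K = M \<or> K = carrier A"
    using M by (auto simp: maximal_subgroup_def)
  have MA: "M \<subseteq> carrier A" using Ms(1) by (rule subgroup.subset)
  have "dense_in (\<iota> ` M) (\<iota> ` carrier A)"
    unfolding dense_in_def
  proof (intro conjI allI impI)
    show "subgrp (\<iota> ` M)" by (rule subgrp_emb[OF Ms(1)])
    show "\<iota> ` M \<subseteq> \<iota> ` carrier A" using MA by blast
    fix P assume "fin_idx P (\<iota> ` carrier A) \<and> \<iota> ` M \<subseteq> P"
    then have P: "fin_idx P (\<iota> ` carrier A)" "\<iota> ` M \<subseteq> P" by auto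
    let ?K = "{x \<in> carrier A. \<iota> x \<in> P}"
    have K: "subgroup ?K A" by (rule subgroup_vimage[OF fin_idx_subgrp[OF P(1)]])
    have im: "\<iota> ` ?K = P" using fin_idx_subset[OF P(1)] by auto
    have "finite_index ?K A" using finite_index_iff[OF K] P(1) im by simp
    then have "?K \<noteq> M" using nf by auto
    then have "?K = carrier A" using max[OF K] P(2) MA by blast
    then show "P = \<iota> ` carrier A" using im by simp
  qed
  then have "\<iota> ` M = \<iota> ` carrier A" using nd by (auto simp: no_proper_dense_def)
  then have "M = carrier A" using inj MA by (simp add: inj_on_image_eq_iff)
  then show False using Ms(2) by simp
qed

end

text \<open>The right regular representation, extended by the identity outside the carrier; right
  multiplication fits a sum that applies its left summand first.\<close>

definition cayley :: "('a, 'm) monoid_scheme \<Rightarrow> 'a \<Rightarrow> 'a bijection" where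
  "cayley A h = Abs_bijection (\<lambda>x. if x \<in> carrier A then x \<otimes>\<^bsub>A\<^esub> h else x)"

lemma (in group) group_embedding_cayley: "group_embedding G (cayley G)"
proof
  have app: "bij_app (cayley G h) = (\<lambda>x. if x \<in> carrier G then x \<otimes> h else x)" if h: "h \<in> carrier G" for h
    unfolding cayley_def
  proof (rule Abs_bijection_inverse, rule CollectI)
    show "bij (\<lambda>x. if x \<in> carrier G then x \<otimes> h else x)"
      by (rule o_bij[of "\<lambda>x. if x \<in> carrier G then x \<otimes> inv h else x"])
         (use h in \<open>auto simp: fun_eq_iff m_assoc\<close>)
  qed
  show "inj_on (cayley G) (carrier G)"
  proof (rule inj_onI)
    fix x y assume xy: "x \<in> carrier G" "y \<in> carrier G" "cayley G x = cayley G y"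
    then have "bij_app (cayley G x) \<one> = bij_app (cayley G y) \<one>" by simp
    then show "x = y" using xy(1,2) by (simp add: app)
  qed
  fix x y assume "x \<in> carrier G" "y \<in> carrier G"
  then show "cayley G (x \<otimes> y) = cayley G x + cayley G y"
    by (auto simp: bij_app_inject[symmetric] plus_bijection.rep_eq app fun_eq_iff m_assoc)
qed

lemma no_proper_dense_iso:
  assumes A: "group_embedding A \<iota>" and B: "group_embedding B \<kappa>"
    and K: "subgroup K A" and L: "subgroup L B" and iso: "A\<lparr>carrier := K\<rparr> \<cong> B\<lparr>carrier := L\<rparr>"
    and nd: "no_proper_dense (\<kappa> ` L)"
  shows "no_proper_dense (\<iota> ` K)"
proof -
  interpret A: group_embedding A \<iota> by (rule A)
  interpret B: group_embedding B \<kappa> by (rule B)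
  obtain \<theta> where \<theta>: "bij_betw \<theta> K L" "\<And>x y. x \<in> K \<Longrightarrow> y \<in> K \<Longrightarrow> \<theta> (x \<otimes>\<^bsub>A\<^esub> y) = \<theta> x \<otimes>\<^bsub>B\<^esub> \<theta> y"
    using iso by (auto simp: is_iso_def iso_def hom_def)
  have KA: "K \<subseteq> carrier A" and LB: "L \<subseteq> carrier B"
    using K L by (auto dest: subgroup.subset)
  have inj: "inj_on (\<lambda>x. \<kappa> (\<theta> x)) K"
    using comp_inj_on[OF bij_betw_imp_inj_on[OF \<theta>(1)], of \<kappa>] inj_on_subset[OF B.inj LB] \<theta>(1)
    by (simp add: bij_betw_def comp_def)
  \<comment> \<open>Pulls an element of the image of \<open>L\<close> back to \<open>K\<close> along
    the isomorphism and embeds it on the side of \<open>A\<close>.\<close>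
  let ?\<phi> = "\<lambda>y. \<iota> (inv_into K (\<lambda>x. \<kappa> (\<theta> x)) y)"
  have \<phi>: "?\<phi> (\<kappa> (\<theta> x)) = \<iota> x" if "x \<in> K" for x using inv_into_f_f[OF inj that] by simp
  have img: "\<kappa> ` L = (\<lambda>x. \<kappa> (\<theta> x)) ` K" using \<theta>(1) by (auto simp: bij_betw_def)
  have \<theta>B: "\<theta> x \<in> carrier B" if "x \<in> K" for x using \<theta>(1) that LB by (auto simp: bij_betw_def)
  have h: "hom_on (\<kappa> ` L) ?\<phi>"
    unfolding hom_on_def img
  proof safe
    fix x y assume xy: "x \<in> K" "y \<in> K"
    have xyK: "x \<otimes>\<^bsub>A\<^esub> y \<in> K" using K xy by (rule subgroup.m_closed)
    have "\<kappa> (\<theta> x) + \<kappa> (\<theta> y) = \<kappa> (\<theta> (x \<otimes>\<^bsub>A\<^esub> y))" using xy \<theta>(2) \<theta>B by (simp add: B.add)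
    then have "?\<phi> (\<kappa> (\<theta> x) + \<kappa> (\<theta> y)) = \<iota> (x \<otimes>\<^bsub>A\<^esub> y)" using \<phi>[OF xyK] by simp
    also have "\<dots> = ?\<phi> (\<kappa> (\<theta> x)) + ?\<phi> (\<kappa> (\<theta> y))" using xy KA by (simp add: \<phi> A.add subset_iff)
    finally show "?\<phi> (\<kappa> (\<theta> x) + \<kappa> (\<theta> y)) = ?\<phi> (\<kappa> (\<theta> x)) + ?\<phi> (\<kappa> (\<theta> y))" .
  qed
  have "inj_on ?\<phi> (\<kappa> ` L)"
    unfolding img
  proof (rule inj_onI, safe)
    fix x y assume "x \<in> K" "y \<in> K" "?\<phi> (\<kappa> (\<theta> x)) = ?\<phi> (\<kappa> (\<theta> y))"
    then show "\<kappa> (\<theta> x) = \<kappa> (\<theta> y)" using inj_onD[OF A.inj] KA by (auto simp: \<phi>)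
  qed
  from no_proper_dense_image[OF nd B.subgrp_emb[OF L] h this]
  have "no_proper_dense (?\<phi> ` \<kappa> ` L)" .
  moreover have "?\<phi> ` \<kappa> ` L = \<iota> ` K" unfolding img image_image using \<phi> by auto
  ultimately show ?thesis by simp
qed

text \<open>The letters \<open>1, \<dots>, p\<close> of \<open>tree_verts p\<close> become the residues modulo \<open>p\<close>, with \<open>p\<close>
  corresponding to \<open>0\<close>; on words with letters outside \<open>{0..<p}\<close> only the longest admissible prefix
  is moved.\<close>

definition res :: "nat \<Rightarrow> nat \<Rightarrow> int" where
  "res p x = int x mod int p"

definition unres :: "nat \<Rightarrow> int \<Rightarrow> nat" where
  "unres p y = (if y = 0 then p else nat y)"

definition ext_word :: "nat \<Rightarrow> (nat list \<Rightarrow> nat list) \<Rightarrow> int list \<Rightarrow> int list" where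
  "ext_word p f w = map (res p) (f (map (unres p) (takeWhile (\<lambda>y. y \<in> {0..<int p}) w)))
     @ dropWhile (\<lambda>y. y \<in> {0..<int p}) w"

definition emb :: "nat \<Rightarrow> (nat list \<Rightarrow> nat list) \<Rightarrow> taut" where
  "emb p f = Abs_taut (ext_word p f)"

section \<open>The given tree inside the tree of integer words\<close>

context
  fixes p :: nat
  assumes p: "p > 1"
begin

lemma res_unres: "y \<in> {0..<int p} \<Longrightarrow> res p (unres p y) = y"
  by (auto simp: res_def unres_def)

lemma unres_res: "x \<in> {1..p} \<Longrightarrow> unres p (res p x) = x"
  by (cases "x = p") (auto simp: res_def unres_def)

lemma res_in: "res p x \<in> {0..<int p}"
  using p by (simp add: res_def)

lemma unres_in: "y \<in> {0..<int p} \<Longrightarrow> unres p y \<in> {1..p}"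
  using p by (auto simp: unres_def)

lemma map_unres: "set u \<subseteq> {0..<int p} \<Longrightarrow> map (unres p) u \<in> tree_verts p"
  using unres_in by (auto simp: tree_verts_def subset_iff)

lemma map_res_unres: "set u \<subseteq> {0..<int p} \<Longrightarrow> map (res p) (map (unres p) u) = u"
  by (induction u) (auto simp: res_unres)

lemma map_unres_res: "v \<in> tree_verts p \<Longrightarrow> map (unres p) (map (res p) v) = v"
  by (induction v) (auto simp: unres_res)

lemma set_map_res: "set (map (res p) v) \<subseteq> {0..<int p}"
  using res_in by auto

text \<open>The part of a word that is left alone: starting with an inadmissible letter, if at all,
  makes the splitting unique.\<close>

abbreviation "bad r \<equiv> (r = [] \<or> hd r \<notin> {0..<int p})"

lemma ext_word_append:
  assumes "set u \<subseteq> {0..<int p}" "bad r"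
  shows "ext_word p f (u @ r) = map (res p) (f (map (unres p) u)) @ r"
proof -
  have 1: "takeWhile (\<lambda>y. y \<in> {0..<int p}) r = []" "dropWhile (\<lambda>y. y \<in> {0..<int p}) r = r"
    using assms(2) by (cases r; auto)+
  show ?thesis unfolding ext_word_def
    using assms(1) 1 by (subst takeWhile_append2, blast, subst dropWhile_append2, blast) simp
qed

lemma word_split:
  obtains u r where "w = u @ r" "set u \<subseteq> {0..<int p}" "bad r"
proof
  let ?Q = "\<lambda>y. y \<in> {0..<int p}"
  show "w = takeWhile ?Q w @ dropWhile ?Q w" by simp
  show "set (takeWhile ?Q w) \<subseteq> {0..<int p}" by (auto dest: set_takeWhileD)
  show "bad (dropWhile ?Q w)" using hd_dropWhile[of ?Q w] by blast
qed

lemma ext_word_mult: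
  assumes f: "f \<in> carrier (tree_aut p)"
  shows "ext_word p (f \<otimes>\<^bsub>tree_aut p\<^esub> g) w = ext_word p g (ext_word p f w)"
proof -
  obtain u r where w: "w = u @ r" "set u \<subseteq> {0..<int p}" "bad r" by (rule word_split)
  let ?v = "map (unres p) u"
  have v: "?v \<in> tree_verts p" by (rule map_unres[OF w(2)])
  have "(f \<otimes>\<^bsub>tree_aut p\<^esub> g) ?v = g (f ?v)" using v by (simp add: tree_aut_def compose_eq)
  then have "ext_word p (f \<otimes>\<^bsub>tree_aut p\<^esub> g) w = map (res p) (g (f ?v)) @ r"
    unfolding w(1) ext_word_append[OF w(2,3)] by simp
  also have "\<dots> = ext_word p g (map (res p) (f ?v) @ r)"
    unfolding ext_word_append[OF set_map_res w(3)] map_unres_res[OF tree_autD(3)[OF f v]] ..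
  also have "\<dots> = ext_word p g (ext_word p f w)" unfolding w(1) ext_word_append[OF w(2,3)] ..
  finally show ?thesis .
qed

lemma ext_word_one: "ext_word p \<one>\<^bsub>tree_aut p\<^esub> w = w"
proof -
  obtain u r where w: "w = u @ r" "set u \<subseteq> {0..<int p}" "bad r" by (rule word_split)
  have "\<one>\<^bsub>tree_aut p\<^esub> (map (unres p) u) = map (unres p) u"
    using map_unres[OF w(2)] by (simp add: tree_aut_def)
  then show ?thesis unfolding w(1) ext_word_append[OF w(2,3)] using map_res_unres[OF w(2)] by simp
qed

lemma app_emb:
  assumes f: "f \<in> carrier (tree_aut p)"
  shows "app (emb p f) = ext_word p f"
  unfolding emb_def
proof (rule Abs_taut_inverse, safe)
  interpret group "tree_aut p" by (rule group_tree_aut)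
  let ?g = "inv\<^bsub>tree_aut p\<^esub> f"
  have g: "?g \<in> carrier (tree_aut p)" using f by simp
  show "bij (ext_word p f)"
  proof (rule o_bij[of "ext_word p ?g"])
    show "ext_word p ?g \<circ> ext_word p f = id"
      using ext_word_mult[OF f, of ?g] f by (simp add: fun_eq_iff ext_word_one)
    show "ext_word p f \<circ> ext_word p ?g = id"
      using ext_word_mult[OF g, of f] f by (simp add: fun_eq_iff ext_word_one)
  qed
  show "take n (ext_word p f w) = ext_word p f (take n w)" for n w
  proof -
    obtain u r where w: "w = u @ r" "set u \<subseteq> {0..<int p}" "bad r" by (rule word_split)
    let ?v = "map (unres p) u"
    have v: "?v \<in> tree_verts p" by (rule map_unres[OF w(2)])
    have len: "length (f ?v) = length u" using tree_aut_append(1)[OF f v v] by simp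
    show ?thesis
    proof (cases "n \<le> length u")
      case True
      have tv: "take n ?v \<in> tree_verts p" "drop n ?v \<in> tree_verts p"
        using v tree_verts_simps(3)[of "take n ?v" "drop n ?v" p] by simp_all
      have "take n (f ?v) = f (take n ?v)" using tree_aut_append(2)[OF f tv] True by (simp add: min_absorb2)
      moreover have "set (take n u) \<subseteq> {0..<int p}" using w(2) set_take_subset by fast
      from ext_word_append[OF this, of "[]" f] have "ext_word p f (take n u) = map (res p) (f (take n ?v))"
        by (simp add: take_map)
      ultimately show ?thesis
        unfolding w(1) ext_word_append[OF w(2,3)] using True len by (simp add: take_map)
    next
      case False
      \<comment> \<open>A truncation of \<open>r\<close> is empty or still starts with the
        inadmissible letter.\<close>
      have "bad (take (n - length u) r)" using w(3) False by (cases r) (auto simp: take_Cons')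
      from ext_word_append[OF w(2) this, of f] show ?thesis
        unfolding w(1) ext_word_append[OF w(2,3)] using False len by simp
    qed
  qed
qed

lemma emb_mult:
  assumes "f \<in> carrier (tree_aut p)" "g \<in> carrier (tree_aut p)"
  shows "emb p (f \<otimes>\<^bsub>tree_aut p\<^esub> g) = emb p f + emb p g"
proof (rule taut_eqI)
  interpret group "tree_aut p" by (rule group_tree_aut)
  show "app (emb p (f \<otimes>\<^bsub>tree_aut p\<^esub> g)) u = app (emb p f + emb p g) u" for u
    using assms by (simp add: app_emb ext_word_mult)
qed

lemma inj_on_emb: "inj_on (emb p) (carrier (tree_aut p))"
proof (rule inj_onI)
  fix f g assume fg: "f \<in> carrier (tree_aut p)" "g \<in> carrier (tree_aut p)" "emb p f = emb p g"
  then have eq: "ext_word p f = ext_word p g" by (metis app_emb)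
  show "f = g"
  proof (rule extensionalityI[of _ "tree_verts p"])
    show "f \<in> extensional (tree_verts p)" "g \<in> extensional (tree_verts p)"
      using fg(1,2) by (simp_all add: tree_autD(1))
    fix v assume v: "v \<in> tree_verts p"
    have "ext_word p h (map (res p) v) = map (res p) (h v)" for h
      using ext_word_append[OF set_map_res, of "[]" h v] map_unres_res[OF v] by simp
    then have "map (res p) (f v) = map (res p) (g v)" using eq by metis
    then have "map (unres p) (map (res p) (f v)) = map (unres p) (map (res p) (g v))" by simp
    then show "f v = g v"
      using map_unres_res[OF tree_autD(3)[OF fg(1) v]] map_unres_res[OF tree_autD(3)[OF fg(2) v]] by simp
  qed
qed

lemma group_embedding_emb: "group_embedding (tree_aut p) (emb p)"
  by (intro group_embedding.intro group_tree_aut group_embedding_axioms.intro inj_on_emb emb_mult)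

lemma int_p: "int p > 0"
  using p by simp

lemma emb_rooted_cycle: "emb p (rooted_cycle p) = rot (int p) 1"
proof (rule taut_eqI)
  fix w
  obtain u r where w: "w = u @ r" "set u \<subseteq> {0..<int p}" "bad r" by (rule word_split)
  have "app (emb p (rooted_cycle p)) w = map (res p) (rooted_cycle p (map (unres p) u)) @ r"
    unfolding app_emb[OF rooted_cycle_closed] w(1) ext_word_append[OF w(2,3)] ..
  also have "\<dots> = rot_word (int p) 1 (u @ r)"
  proof (cases u)
    case Nil
    then show ?thesis using w(3) by (cases r) (auto simp: rooted_cycle_def)
  next
    case (Cons x u')
    have x: "x \<in> {0..<int p}" "set u' \<subseteq> {0..<int p}" using w(2) Cons by auto
    have v: "unres p x # map (unres p) u' \<in> tree_verts p" using map_unres[OF w(2)] Cons by simp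
    have "res p (if unres p x = p then 1 else Suc (unres p x)) = (x + 1) mod int p"
      using x(1) p by (auto simp: res_def unres_def algebra_simps)
    then show ?thesis using v x map_res_unres[OF x(2)] Cons by (simp add: rooted_cycle_def)
  qed
  finally show "app (emb p (rooted_cycle p)) w = app (rot (int p) 1) w"
    unfolding app_rot[OF int_p] w(1) .
qed

lemma emb_rooted_cycle_pow: "emb p (rooted_cycle p [^]\<^bsub>tree_aut p\<^esub> (k::int)) = rot (int p) k"
proof -
  interpret group_embedding "tree_aut p" "emb p" by (rule group_embedding_emb)
  have nat: "emb p (rooted_cycle p [^]\<^bsub>tree_aut p\<^esub> (n::nat)) = rot (int p) (int n)" for n
  proof -
    have "nmul n (rot (int p) 1) = rot (int p) (int n)"
      by (induction n) (simp_all add: rot_0[OF int_p] rot_add[OF int_p, symmetric])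
    then show ?thesis by (simp add: emb_pow[OF rooted_cycle_closed] emb_rooted_cycle)
  qed
  show ?thesis
  proof (cases k rule: int_cases2)
    case (nonneg n)
    then show ?thesis by (simp add: int_pow_int nat)
  next
    case (nonpos n)
    have "rooted_cycle p [^]\<^bsub>tree_aut p\<^esub> k = inv\<^bsub>tree_aut p\<^esub> (rooted_cycle p [^]\<^bsub>tree_aut p\<^esub> n)"
      unfolding nonpos by (rule int_pow_neg_int[OF rooted_cycle_closed])
    then show ?thesis
      unfolding nonpos by (simp add: emb_inv rooted_cycle_closed nat rot_uminus[OF int_p])
  qed
qed

lemma emb_directed_aut: "emb p (directed_aut p e) = dir (int p) (\<lambda>d. e (nat d))"
proof (rule taut_eqI)
  interpret group "tree_aut p" by (rule group_tree_aut)
  let ?c = "\<lambda>k. rooted_cycle p [^]\<^bsub>tree_aut p\<^esub> (k::int)"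
  have cc: "?c k \<in> carrier (tree_aut p)" for k by (rule int_pow_closed[OF rooted_cycle_closed])
  have dc: "directed_aut p e \<in> carrier (tree_aut p)"
    using directed_aut_in_stab by (auto simp: level_one_stab_def)
  fix w
  obtain u r where w: "w = u @ r" "set u \<subseteq> {0..<int p}" "bad r" by (rule word_split)
  have "app (emb p (directed_aut p e)) w = map (res p) (directed_aut p e (map (unres p) u)) @ r"
    unfolding app_emb[OF dc] w(1) ext_word_append[OF w(2,3)] ..
  also have "\<dots> = dir_word (int p) (\<lambda>d. e (nat d)) (u @ r)"
    using w(2)
  proof (induction u)
    case Nil
    then show ?case using w(3) p by (cases r) (auto simp: directed_aut_def)
  next
    case (Cons x u)
    have x: "x \<in> {0..<int p}" "set u \<subseteq> {0..<int p}" using Cons.prems by auto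
    have v: "unres p x \<in> {1..p}" "map (unres p) u \<in> tree_verts p" using unres_in[OF x(1)] map_unres[OF x(2)] .
    have rot: "map (res p) (?c k (map (unres p) u)) @ r = rot_word (int p) k (u @ r)" for k
      using ext_word_append[OF x(2) w(3), of "?c k"] app_emb[OF cc, of k] emb_rooted_cycle_pow[of k] app_rot[OF int_p, of k]
      by simp
    show ?case
    proof (cases "x = 0")
      case True
      then have "unres p x = p" by (simp add: unres_def)
      then show ?thesis using Cons.IH[OF x(2)] True directed_aut_Cons[OF v, of e] by (simp add: res_def)
    next
      case False
      then have "unres p x = nat x" "nat x \<noteq> p" using x(1) by (auto simp: unres_def)
      then show ?thesis
        using False rot[of "e (nat x)"] directed_aut_Cons[OF v, of e] x(1) res_unres[OF x(1)] by simp
    qed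
  qed
  finally show "app (emb p (directed_aut p e)) w = app (dir (int p) (\<lambda>d. e (nat d))) w"
    unfolding app_dir[OF int_p] w(1) .
qed

text \<open>Integer combinations, without reduction modulo \<open>p\<close>, make closure under
  addition and negation immediate; \<open>dir\<close> sees only residues anyway.\<close>

definition span_family :: "nat \<Rightarrow> (nat \<Rightarrow> nat \<Rightarrow> int) \<Rightarrow> (int \<Rightarrow> int) set" where
  "span_family r e = range (\<lambda>c d. \<Sum>i=1..r. c i * e i (nat d))"

lemma dir_mult_mem:
  assumes S: "subgrp S" and e: "dir (int p) \<xi> \<in> S"
  shows "dir (int p) (\<lambda>d. c * \<xi> d) \<in> S"
proof -
  have nat: "dir (int p) (\<lambda>d. int n * \<xi> d) \<in> S" for n
  proof (induction n)
    case 0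
    then show ?case using subgrp_zero[OF S] dir_0[OF int_p] by simp
  next
    case (Suc n)
    have "dir (int p) (\<lambda>d. int (Suc n) * \<xi> d) = dir (int p) \<xi> + dir (int p) (\<lambda>d. int n * \<xi> d)"
      unfolding dir_add[OF int_p, symmetric] by (simp add: algebra_simps)
    then show ?case using Suc e S by (simp add: subgrp_add)
  qed
  show ?thesis
  proof (cases "c \<ge> 0")
    case True
    then show ?thesis using nat[of "nat c"] by simp
  next
    case False
    have "- dir (int p) (\<lambda>d. int (nat (- c)) * \<xi> d) \<in> S" using subgrp_uminus[OF S nat] .
    then show ?thesis using False unfolding dir_uminus[OF int_p, symmetric] by simp
  qed
qed

text \<open>Replacing the vectors by their span does not enlarge the group, since \<open>dir\<close>
  turns integer combinations of exponent functions into sums of automorphisms.\<close>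

lemma emb_spinal_group:
  "emb p ` carrier (multi_edge_spinal_group p r e) = spinal_group (int p) (span_family r e)"
proof -
  interpret group_embedding "tree_aut p" "emb p" by (rule group_embedding_emb)
  let ?S = "insert (rooted_cycle p) ((\<lambda>i. directed_aut p (e i)) ` {1..r})"
  let ?T = "insert (rot (int p) 1) ((\<lambda>i. dir (int p) (\<lambda>d. e i (nat d))) ` {1..r})"
  have "?S \<subseteq> carrier (tree_aut p)"
    using rooted_cycle_closed directed_aut_in_stab by (auto simp: level_one_stab_def)
  from emb_generate[OF this] have "emb p ` carrier (multi_edge_spinal_group p r e) = gen (emb p ` ?S)"
    by (simp add: multi_edge_spinal_group_def)
  also have "emb p ` ?S = ?T" by (simp add: emb_rooted_cycle emb_directed_aut image_image)
  also have "gen ?T = spinal_group (int p) (span_family r e)"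
  proof
    have "(\<lambda>d. e i (nat d)) \<in> span_family r e" if "i \<in> {1..r}" for i
    proof -
      have "(\<lambda>d. e i (nat d)) = (\<lambda>d. \<Sum>j=1..r. (if j = i then 1 else 0) * e j (nat d))"
        using that by (simp add: if_distrib[of "\<lambda>x. x * _"] cong: if_cong)
      then show ?thesis
        unfolding span_family_def by (rule range_eqI[where x = "\<lambda>j. if j = i then 1 else 0"])
    qed
    then show "gen ?T \<subseteq> spinal_group (int p) (span_family r e)"
      unfolding spinal_group_def by (intro gen_mono) auto
    have "dir (int p) (\<lambda>d. \<Sum>i\<in>I. c i * e i (nat d)) \<in> gen ?T" if "finite I" "I \<subseteq> {1..r}" for c I
      using that
    proof (induction I rule: finite_induct)
      case empty
      then show ?case using subgrp_zero[OF subgrp_gen] dir_0[OF int_p] by simp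
    next
      case (insert i I)
      have "dir (int p) (\<lambda>d. e i (nat d)) \<in> gen ?T" using insert.prems by (intro gen_incl) auto
      then have "dir (int p) (\<lambda>d. c i * e i (nat d)) \<in> gen ?T" by (rule dir_mult_mem[OF subgrp_gen])
      then show ?case using insert by (simp add: dir_add[OF int_p] subgrp_add[OF subgrp_gen])
    qed
    then show "spinal_group (int p) (span_family r e) \<subseteq> gen ?T"
      unfolding spinal_group_def
      by (intro gen_least subgrp_gen) (auto simp: span_family_def intro: gen_incl)
  qed
  finally show ?thesis .
qed

lemma span_family_nonzero:
  assumes "r \<ge> 1" "lin_indep_mod p r e"
  shows "\<exists>\<xi>\<in>span_family r e. \<exists>d\<in>{1..<int p}. \<not> int p dvd \<xi> d"
proof -
  \<comment> \<open>The coefficients \<open>(1, 0, ..., 0)\<close> are not all zero modulo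
    \<open>p\<close>, so by independence the first vector has an entry nonzero modulo
    \<open>p\<close>.\<close>
  define c :: "nat \<Rightarrow> int" where "c i = (if i = 1 then 1 else 0)" for i
  have "\<not> [c 1 = 0] (mod int p)" using p by (simp add: c_def cong_def)
  then obtain j where j: "j \<in> {1..p - 1}" "\<not> [(\<Sum>i=1..r. c i * e i j) = 0] (mod int p)"
    using assms unfolding lin_indep_mod_def by (meson atLeastAtMost_iff order_refl)
  define \<xi> where "\<xi> = (\<lambda>d. \<Sum>i=1..r. c i * e i (nat d))"
  have "\<not> int p dvd \<xi> (int j)" using j(2) by (simp add: cong_0_iff \<xi>_def)
  moreover have "\<xi> \<in> span_family r e" by (simp add: span_family_def \<xi>_def)
  moreover have "int j \<in> {1..<int p}" using j(1) p by auto
  ultimately show ?thesis by blast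
qed

lemma group_embedding_spinal:
  "group_embedding (multi_edge_spinal_group p r e) (emb p)"
proof -
  interpret T: group_embedding "tree_aut p" "emb p" by (rule group_embedding_emb)
  have "insert (rooted_cycle p) ((\<lambda>i. directed_aut p (e i)) ` {1..r}) \<subseteq> carrier (tree_aut p)"
    using rooted_cycle_closed directed_aut_in_stab by (auto simp: level_one_stab_def)
  from T.generate_incl[OF this] have sub: "carrier (multi_edge_spinal_group p r e) \<subseteq> carrier (tree_aut p)"
    by (simp add: multi_edge_spinal_group_def)
  show ?thesis
  proof (intro group_embedding.intro group_multi_edge_spinal_group group_embedding_axioms.intro)
    show "inj_on (emb p) (carrier (multi_edge_spinal_group p r e))" by (rule inj_on_subset[OF T.inj sub])
    fix x y assume "x \<in> carrier (multi_edge_spinal_group p r e)" "y \<in> carrier (multi_edge_spinal_group p r e)"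
    then show "emb p (x \<otimes>\<^bsub>multi_edge_spinal_group p r e\<^esub> y) = emb p x + emb p y"
      using sub T.add[of x y] by (auto simp: multi_edge_spinal_group_def)
  qed
qed

end

theorem corollary1p3:
  fixes p r :: nat and e :: "nat \<Rightarrow> nat \<Rightarrow> int"
    and H :: "('h, 'm) monoid_scheme" and M :: "'h set"
  assumes "Factorial_Ring.prime p" and "odd p"
    and "r \<ge> 1" and "lin_indep_mod p r e"
    and "torsion_group (multi_edge_spinal_group p r e)"
    and "group H" and "commensurable H (multi_edge_spinal_group p r e)"
    and "maximal_subgroup M H"
  shows "finite_index M H"
proof -
  let ?S = "multi_edge_spinal_group p r e" and ?E = "span_family r e"
  have p: "p > 1" using assms(1) by (rule prime_gt_1_nat)
  interpret S: group_embedding ?S "emb p" by (rule group_embedding_spinal[OF p])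
  interpret H: group H by (rule assms(6))
  interpret C: group_embedding H "cayley H" by (rule H.group_embedding_cayley)
  have img: "emb p ` carrier ?S = spinal_group (int p) ?E" by (rule emb_spinal_group[OF p])
  have "torsion_on (spinal_group (int p) ?E)"
    unfolding torsion_on_def img[symmetric]
  proof safe
    fix g assume g: "g \<in> carrier ?S"
    then obtain n :: nat where n: "n > 0" "g [^]\<^bsub>?S\<^esub> n = \<one>\<^bsub>?S\<^esub>"
      using assms(5) by (auto simp: torsion_group_def)
    then have "nmul n (emb p g) = 0" using S.emb_pow[OF g, of n] S.emb_one by simp
    then show "\<exists>n>0. nmul n (emb p g) = 0" using n(1) by blast
  qed
  then interpret spinal "int p" ?E
  proof (unfold_locales)
    show "prime (int p)" using assms(1) by simp
    show "(\<lambda>_. 0) \<in> ?E" unfolding span_family_def[OF p] by (rule range_eqI[of _ _ "\<lambda>_. 0"]) simp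
    show "(\<lambda>d. \<xi> d + \<zeta> d) \<in> ?E" if mem: "\<xi> \<in> ?E" "\<zeta> \<in> ?E" for \<xi> \<zeta>
    proof -
      obtain c c' where "\<xi> = (\<lambda>d. \<Sum>i=1..r. c i * e i (nat d))" "\<zeta> = (\<lambda>d. \<Sum>i=1..r. c' i * e i (nat d))"
        using mem unfolding span_family_def[OF p] by blast
      then have "(\<lambda>d. \<xi> d + \<zeta> d) = (\<lambda>d. \<Sum>i=1..r. (c i + c' i) * e i (nat d))"
        by (simp add: sum.distrib distrib_right)
      then show ?thesis
        unfolding span_family_def[OF p] by (rule range_eqI[where x = "\<lambda>i. c i + c' i"])
    qed
    show "(\<lambda>d. - \<xi> d) \<in> ?E" if mem: "\<xi> \<in> ?E" for \<xi>
    proof -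
      obtain c where "\<xi> = (\<lambda>d. \<Sum>i=1..r. c i * e i (nat d))"
        using mem unfolding span_family_def[OF p] by blast
      then have "(\<lambda>d. - \<xi> d) = (\<lambda>d. \<Sum>i=1..r. (- c i) * e i (nat d))" by (simp add: sum_negf)
      then show ?thesis
        unfolding span_family_def[OF p] by (rule range_eqI[where x = "\<lambda>i. - c i"])
    qed
  qed (use span_family_nonzero[OF p assms(3,4)] in blast)
  obtain K L where KL: "finite_index K H" "finite_index L ?S" "H\<lparr>carrier := K\<rparr> \<cong> ?S\<lparr>carrier := L\<rparr>"
    using assms(7) by (auto simp: commensurable_def)
  have sub: "subgroup K H" "subgroup L ?S" using KL by (auto simp: finite_index_def)
  have "fin_idx (emb p ` L) (spinal_group (int p) ?E)"
    using S.finite_index_iff[OF sub(2)] KL(2) img by simp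
  \<comment> \<open>The property passes from the spinal group down to \<open>L\<close>, across the
    isomorphism to \<open>K\<close>, and up to \<open>H\<close>.\<close>
  then have "no_proper_dense (emb p ` L)" by (rule no_proper_dense_fin_idx)
  then have "no_proper_dense (cayley H ` K)"
    by (rule no_proper_dense_iso[OF C.group_embedding_axioms S.group_embedding_axioms sub KL(3)])
  moreover have "fin_idx (cayley H ` K) (cayley H ` carrier H)"
    using C.finite_index_iff[OF sub(1)] KL(1) by simp
  ultimately have "no_proper_dense (cayley H ` carrier H)"
    using no_proper_dense_up C.subgrp_emb[OF H.subgroup_self] by blast
  then show ?thesis using assms(8) by (rule C.maximal_subgroup_finite_index)
qed

end
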